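(* Assume the Riemann Hypothesis, i.e. every non-trivial zero $\rho$ of the Riemann zeta-function $\zeta(s)$ satisfies $\operatorname{Re}\rho = 1/2$. Let $b$ be any real number with $b \neq -1/2$, and for positive integers $n$ define $$k_{n,b} := \sum_{\rho}\left(1-\left(\frac{\rho+b}{\rho-1-b}\right)^n\right),$$ where the sum runs over all non-trivial zeros $\rho$ of $\zeta(s)$, counted with multiplicity. Then, as $n\to\infty$, $$k_{n,b} = \frac{|2b+1|}{2}\, n\ln n + \frac{|2b+1|}{2}\left(\gamma - 1 - \ln\frac{2\pi}{|2b+1|}\right) n + o(n),$$ where $\gamma$ is the Euler–Mascheroni constant.
   Context: The non-trivial zeros of $\zeta(s)$ are its zeros in the strip $0<\operatorname{Re}s<1$; they occur in complex-conjugate pairs with equal multiplicities. The sum defining $k_{n,b}$ is taken with each zero $\rho$ grouped with its complex conjugate $\bar\rho$ (equivalently, as the limit as $T\to\infty$ of the partial sums over zeros with $|\operatorname{Im}\rho|\le T$); under the Riemann Hypothesis the resulting sum is real. *)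

theory Defs
  imports "HOL-Complex_Analysis.Complex_Analysis" "HOL-Library.Landau_Symbols"
begin

text \<open>
  The Riemann zeta function, as the analytic continuation of its Dirichlet series to the
  complex plane without the pole at 1. By the identity theorem there is at most one such
  function once its value at the pole is fixed; we use the convention that this value is 0.
  That the continuation exists is classical.
\<close>

definition zeta :: "complex \<Rightarrow> complex" where
  "zeta = (THE f. f holomorphic_on (- {1}) \<and>
                  (\<forall>s. Re s > 1 \<longrightarrow> (\<lambda>n. 1 / of_nat (Suc n) powr s) sums f s) \<and>
                  f 1 = 0)"

definition nontrivial_zeros :: "complex set" where
  "nontrivial_zeros = {\<rho>. 0 < Re \<rho> \<and> Re \<rho> < 1 \<and> zeta \<rho> = 0}"

definition riemann_hypothesis :: bool where
  "riemann_hypothesis \<longleftrightarrow> (\<forall>\<rho>\<in>nontrivial_zeros. Re \<rho> = 1 / 2)"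

text \<open>
  The index set is finite, since the zeros of zeta are isolated and zeta has a pole at 1.
  The factor \<^term>\<open>zorder zeta \<rho>\<close> accounts for multiplicities, and the symmetric
  truncation keeps each zero together with its complex conjugate.
\<close>

definition k_partial :: "nat \<Rightarrow> real \<Rightarrow> real \<Rightarrow> complex" where
  "k_partial n b T =
     (\<Sum>\<rho> | \<rho> \<in> nontrivial_zeros \<and> \<bar>Im \<rho>\<bar> \<le> T.
        of_int (zorder zeta \<rho>) * (1 - ((\<rho> + of_real b) / (\<rho> - 1 - of_real b)) ^ n))"

definition k_coeff :: "nat \<Rightarrow> real \<Rightarrow> complex" where
  "k_coeff n b = Lim at_top (k_partial n b)"

end

theory Submission
  imports Defs "HOL-Real_Asymp.Real_Asymp"
begin

text \<open>
  Put $a = |b + 1/2|$ and write the zeros as $1/2 + i\gamma$. Pairing $\gamma$ with $-\gamma$,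
  $k_{n,b}$ is the sum over the zeros of $f(\gamma)$ with $f(t) = 1 - \Re(((it+a)/(it-a))^n)$.
  The function $f$ has a bounded harmonic extension $u$ to the left half plane, so that
  $u(-h + i\gamma)$ is the Poisson integral of $f$. Interchanging sum and integral,
  \[ \sum_\gamma u(-h+i\gamma) = \frac1\pi\int f(t) \sum_\gamma \frac{h}{h^2+(t-\gamma)^2}\,dt
     = \frac1\pi\int f(t)\, \Re\frac{\xi'}{\xi}\Bigl(\frac12+h+it\Bigr)\,dt, \]
  so no zero counting is needed. For fixed $h$ the density is
  $\frac12\ln(\sqrt{t^2+a^2}/2\pi) + O(2^{-h}) + O_h(1/(1+|t|))$, and the integrals
  $\int f = 2\pi an$ and $\int f(t)\ln\sqrt{t^2+a^2}\,dt = 2\pi an(\ln 2a + H_n - 1)$ are exact.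
  Replacing $u(-h+i\gamma)$ by $f(\gamma)$ costs at most a Poisson kernel of width
  $H = \sqrt{2anh}$ at $\gamma$, hence $4H\,\Re(\xi'/\xi)(1/2+H) = O(\sqrt n\ln n)$ in total.
  Finally $h$ is taken large.
\<close>

text \<open>\<open>zeta\<close> is a definite description, so a continuation has to be exhibited
  before anything can be said about it; it is read off from the entire function \<open>xi\<close>.
  The argument then rests on three properties of \<open>xi\<close>. Evenness about 1/2 removes the
  constant in the partial fractions of xi'/xi. Growth whose logarithm is o(R^2) removes their
  remainder. Non-vanishing outside the open strip identifies its zeros with
  \<open>nontrivial_zeros\<close>, which are cut out by strict inequalities. The functional equation
  is first proved for real s in (-1, 0): there every term on both sides is nonnegative, so sums and
  integrals may be exchanged without any convergence argument. The same device serves for the zeros: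
  under the Riemann Hypothesis the paired summands are nonnegative, so the sum over zeros is an
  integral over counting measure with values in \<open>ennreal\<close>, and its finiteness is a
  result of the estimate and not a condition for it.\<close>

subsection \<open>The zeta function on the half plane of real part above -1\<close>

text \<open>\<open>trap_term n s\<close> is \<open>s - 1\<close> times the error of the trapezoidal rule for \<open>y \<mapsto> y powr - s\<close> on
  \<open>[n, n + 1]\<close>.\<close>

definition trap_term :: "nat \<Rightarrow> complex \<Rightarrow> complex" where
  "trap_term n s = (s - 1) * (of_nat n powr - s + of_nat (Suc n) powr - s) / 2 +
     of_nat (Suc n) powr (1 - s) - of_nat n powr (1 - s)"

lemma trap_term_has_integral:
  fixes n :: nat and s :: complex
  assumes "n > 0 \<or> Re s < 0" "Re s < 1 \<or> n > 0"
  shows "((\<lambda>y. of_real ((y - real n) * (real n + 1 - y) / 2) * ((s - 1) * s * (s + 1)) * of_real y powr (- s - 2))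
          has_integral trap_term n s) {real n..real n + 1}"
proof -
  \<comment> \<open>The kernel is quadratic in y, so the integrand is a combination of three powers;
    their antiderivatives have denominators s - 1, s and s + 1, which the prefactor cancels.\<close>
  define c1 c2 c3 where "c1 = s * (s + 1) / 2" and "c2 = - (s - 1) * (s + 1) * (2 * n + 1) / 2"
    and "c3 = (s - 1) * s * n * (n + 1) / 2"
  define A where "A = (\<lambda>y. c1 * of_real y powr (1 - s) + c2 * of_real y powr (- s) + c3 * of_real y powr (- s - 1))"
  have cont: "continuous_on {real n..real n + 1} A"
  proof (cases "n = 0")
    case True
    \<comment> \<open>Only the power with exponent - s - 1 may blow up at 0, and its coefficient
      vanishes at n = 0.\<close>
    then have "c3 = 0" by (simp add: c3_def)
    then show ?thesis unfolding A_def using assms True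
      by (auto intro!: continuous_intros)
  next
    case False
    then show ?thesis unfolding A_def
      by (auto intro!: continuous_intros)
  qed
  have der: "(A has_vector_derivative of_real ((y - real n) * (real n + 1 - y) / 2) * ((s - 1) * s * (s + 1)) * of_real y powr (- s - 2)) (at y)"
    if "y \<in> {real n<..<real n + 1}" for y :: real
  proof -
    from that have y: "y > 0" by simp
    then have nz: "of_real y \<noteq> (0::complex)" "complex_of_real y \<notin> \<real>\<^sub>\<le>\<^sub>0" by (auto simp: complex_nonpos_Reals_iff)
    have e1: "of_real y powr (1 - s - 1) = (of_real y)^2 * complex_of_real y powr (- s - 2)"
      "of_real y powr (- s - 1) = of_real y * complex_of_real y powr (- s - 2)"
      "of_real y powr (- s) = (of_real y)^2 * complex_of_real y powr (- s - 2)"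
      "of_real y powr (- s - 1 - 1) = complex_of_real y powr (- s - 2)"
      using nz by (simp_all add: powr_diff powr_minus powr_numeral field_simps power2_eq_square)
    have "((\<lambda>z. c1 * z powr (1 - s) + c2 * z powr (- s) + c3 * z powr (- s - 1)) has_field_derivative
        c1 * ((1 - s) * of_real y powr (1 - s - 1)) + c2 * ((- s) * of_real y powr (- s - 1)) + c3 * ((- s - 1) * of_real y powr (- s - 1 - 1))) (at (of_real y))"
      using nz by (auto intro!: derivative_eq_intros)
    moreover have "c1 * ((1 - s) * of_real y powr (1 - s - 1)) + c2 * ((- s) * of_real y powr (- s - 1)) + c3 * ((- s - 1) * of_real y powr (- s - 1 - 1))
       = of_real ((y - real n) * (real n + 1 - y) / 2) * ((s - 1) * s * (s + 1)) * of_real y powr (- s - 2)"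
      unfolding e1 c1_def c2_def c3_def by (simp add: field_simps power2_eq_square)
    ultimately have "((\<lambda>z. c1 * z powr (1 - s) + c2 * z powr (- s) + c3 * z powr (- s - 1)) has_field_derivative
        of_real ((y - real n) * (real n + 1 - y) / 2) * ((s - 1) * s * (s + 1)) * of_real y powr (- s - 2)) (at (of_real y))"
      by (simp only:)
    then show ?thesis unfolding A_def
      by (rule has_vector_derivative_real_field)
  qed
  have pw: "of_real y powr (1 - s) = of_real y * complex_of_real y powr (- s)"
      "of_real y powr (- s) = of_real y * complex_of_real y powr (- s - 1)" if "y > 0" for y :: real
    using that by (simp_all add: powr_diff powr_minus field_simps)
  have "A (real n + 1) - A (real n) = trap_term n s"
  proof (cases "n = 0")
    case True
    then show ?thesis by (simp add: A_def c1_def c2_def c3_def trap_term_def field_simps)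
  next
    case False
    have A1: "A (real n + 1) = (s - 1) / 2 * of_nat (Suc n) powr (- s) + of_nat (Suc n) powr (1 - s)"
    proof -
      have "A (real n + 1) = (c1 * (n+1)^2 + c2 * (n+1) + c3) * complex_of_real (n+1) powr (- s - 1)"
        unfolding A_def using pw[of "real n + 1"] by (simp add: algebra_simps power2_eq_square)
      also have "c1 * (n+1)^2 + c2 * (n+1) + c3 = ((s - 1) / 2 * (n + 1) + (n+1)^2)"
        by (simp add: c1_def c2_def c3_def field_simps power2_eq_square)
      also have "\<dots> * complex_of_real (n+1) powr (- s - 1) = (s - 1) / 2 * complex_of_real (n+1) powr (- s) + complex_of_real (n+1) powr (1 - s)"
        using pw[of "real n + 1"] by (simp add: field_simps power2_eq_square)
      finally show ?thesis by (simp add: add_ac)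
    qed
    have A2: "A (real n) = - (s - 1) / 2 * of_nat n powr (- s) + of_nat n powr (1 - s)"
    proof -
      have "A (real n) = (c1 * n^2 + c2 * n + c3) * complex_of_real n powr (- s - 1)"
        unfolding A_def using pw[of "real n"] False by (simp add: algebra_simps power2_eq_square)
      also have "c1 * n^2 + c2 * n + c3 = (- (s - 1) / 2 * n + n^2)"
        by (simp add: c1_def c2_def c3_def field_simps power2_eq_square)
      also have "\<dots> * complex_of_real n powr (- s - 1) = - (s - 1) / 2 * of_nat n powr (- s) + of_nat n powr (1 - s)"
        using pw[of "real n"] False by (simp add: field_simps power2_eq_square)
      finally show ?thesis by (simp add: add_ac)
    qed
    show ?thesis unfolding A1 A2 trap_term_def by (simp add: field_simps)
  qed
  \<comment> \<open>Differentiability is required only inside the interval: at n = 0 the left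
    endpoint is a branch point of the powers.\<close>
  with fundamental_theorem_of_calculus_interior[OF _ cont der] show ?thesis by simp
qed

text \<open>The kernel is at most 1 on an interval of length 1. The exponent - Re s - 2 is two
  better than that of the Dirichlet series, which makes the corrections summable for Re s >
  -1.\<close>

lemma trap_term_bound:
  assumes "n > 0" "Re s \<ge> -2"
  shows "norm (trap_term n s) \<le> norm ((s - 1) * s * (s + 1)) * real n powr (- Re s - 2)"
proof -
  have "norm (trap_term n s) \<le> norm ((s - 1) * s * (s + 1)) * real n powr (- Re s - 2) * Henstock_Kurzweil_Integration.content (cbox (real n) (real n + 1))"
  proof (rule has_integral_bound)
    show "((\<lambda>y. of_real ((y - real n) * (real n + 1 - y) / 2) * ((s - 1) * s * (s + 1)) * of_real y powr (- s - 2))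
          has_integral trap_term n s) (cbox (real n) (real n + 1))"
      using trap_term_has_integral[of n s] assms by simp
    fix y assume y: "y \<in> cbox (real n) (real n + 1)"
    then have y': "y \<ge> n" "y \<le> n + 1" "y > 0" using assms by auto
    have "(y - real n) * (real n + 1 - y) \<le> 1 * 1" using y' by (intro mult_mono) auto
    moreover have "(y - real n) * (real n + 1 - y) \<ge> 0" using y' by auto
    ultimately have q: "\<bar>(y - real n) * (real n + 1 - y) / 2\<bar> \<le> 1" by simp
    have "norm (complex_of_real y powr (- s - 2)) = y powr (- Re s - 2)"
      using y' by (simp add: norm_powr_real_powr)
    also have "\<dots> \<le> real n powr (- Re s - 2)" using y' assms by (intro powr_mono2') auto
    finally have p: "norm (complex_of_real y powr (- s - 2)) \<le> real n powr (- Re s - 2)" .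
    show "norm (of_real ((y - real n) * (real n + 1 - y) / 2) * ((s - 1) * s * (s + 1)) * of_real y powr (- s - 2))
       \<le> norm ((s - 1) * s * (s + 1)) * real n powr (- Re s - 2)"
      unfolding norm_mult norm_of_real
      using q p mult_mono[OF q p] mult_mono[OF mult_mono[OF q order_refl] p, of "norm ((s - 1) * s * (s + 1))"]
      by (simp add: norm_mult)
  qed auto
  then show ?thesis by simp
qed

text \<open>\<open>zeta_W s\<close> is $(s-1)\zeta(s)$ on $\Re s > -1$.\<close>

definition zeta_W :: "complex \<Rightarrow> complex" where
  "zeta_W s = (s + 1) / 2 + (\<Sum>n. trap_term (Suc n) s)"

lemma trap_term_holomorphic: "n > 0 \<Longrightarrow> trap_term n holomorphic_on A"
  unfolding trap_term_def by (intro holomorphic_intros) auto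

lemma summable_trapezoid_majorant: "Re s > -1 \<Longrightarrow> summable (\<lambda>n. real (Suc n) powr (- Re s - 2))"
  by (subst summable_Suc_iff, subst summable_real_powr_iff) auto

lemma summable_trap_term:
  assumes "Re s > -1"
  shows "summable (\<lambda>n. trap_term (Suc n) s)"
proof (rule summable_comparison_test')
  show "summable (\<lambda>n. norm ((s - 1) * s * (s + 1)) * real (Suc n) powr (- Re s - 2))"
    by (rule summable_mult[OF summable_trapezoid_majorant[OF assms]])
  show "norm (trap_term (Suc n) s) \<le> norm ((s - 1) * s * (s + 1)) * real (Suc n) powr (- Re s - 2)" for n
    using assms by (intro trap_term_bound) auto
qed

lemma zeta_W_holomorphic: "zeta_W holomorphic_on {s. Re s > -1}"
proof -
  have "(\<lambda>s. \<Sum>n. trap_term (Suc n) s) holomorphic_on {s. Re s > -1}"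
  proof (rule holomorphic_uniform_sequence[where f = "\<lambda>N s. \<Sum>n<N. trap_term (Suc n) s"])
    show "open {s. Re s > -1}" by (rule open_halfspace_Re_gt)
    show "(\<lambda>s. \<Sum>n<N. trap_term (Suc n) s) holomorphic_on {s. - 1 < Re s}" for N
      by (intro holomorphic_intros trap_term_holomorphic) auto
    fix x assume "x \<in> {s. Re s > -1}"
    then have x: "Re x > -1" by simp
    \<comment> \<open>Half the distance to the line Re s = -1, so that Re s stays at least -1 + d on
      the disc.\<close>
    define d where "d = (Re x + 1) / 2"
    have d: "d > 0" using x by (simp add: d_def)
    have re: "Re s \<ge> -1 + d" if "s \<in> cball x d" for s
      using that abs_Re_le_cmod[of "x - s"] by (auto simp: dist_norm d_def field_simps abs_if split: if_splits)
    have "continuous_on (cball x d) (\<lambda>s. (s - 1) * s * (s + 1))" by (intro continuous_intros)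
    then have "bounded ((\<lambda>s. (s - 1) * s * (s + 1)) ` cball x d)"
      by (intro compact_imp_bounded compact_continuous_image) auto
    then obtain K where "\<forall>z\<in>(\<lambda>s. (s - 1) * s * (s + 1)) ` cball x d. norm z \<le> K"
      unfolding bounded_iff by blast
    then have K: "norm ((s - 1) * s * (s + 1)) \<le> K" if "s \<in> cball x d" for s
      using that by blast
    have "uniform_limit (cball x d) (\<lambda>N s. \<Sum>n<N. trap_term (Suc n) s) (\<lambda>s. \<Sum>n. trap_term (Suc n) s) sequentially"
    proof (rule Weierstrass_m_test)
      show "summable (\<lambda>n. K * real (Suc n) powr (- (-1 + d) - 2))"
        using summable_trapezoid_majorant[of "of_real (-1+d)"] d by (intro summable_mult) (simp add: algebra_simps)
      fix n s assume s: "s \<in> cball x d"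
      have "norm (trap_term (Suc n) s) \<le> norm ((s - 1) * s * (s + 1)) * real (Suc n) powr (- Re s - 2)"
        using re[OF s] d by (intro trap_term_bound) auto
      also have "\<dots> \<le> K * real (Suc n) powr (- (-1 + d) - 2)"
        using re[OF s] K[OF s] by (intro mult_mono powr_mono) (auto intro: order_trans[OF norm_ge_zero])
      finally show "norm (trap_term (Suc n) s) \<le> K * real (Suc n) powr (- (-1 + d) - 2)" .
    qed
    moreover have "cball x d \<subseteq> {s. Re s > -1}" using re d by force
    ultimately show "\<exists>d>0. cball x d \<subseteq> {s. - 1 < Re s} \<and> uniform_limit (cball x d) (\<lambda>N s. \<Sum>n<N. trap_term (Suc n) s) (\<lambda>s. \<Sum>n. trap_term (Suc n) s) sequentially"
      using d by blast
  qed
  then show ?thesis unfolding zeta_W_def by (intro holomorphic_intros) auto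
qed

text \<open>On Re s >= 1/2 only the three linear factors of the trapezoidal bound grow with s,
  whence the cube. This half plane is enough for the growth of \<open>xi_center\<close>, which is
  even.\<close>

lemma zeta_W_bound: "\<exists>C>0. \<forall>s. Re s \<ge> 1/2 \<longrightarrow> norm (zeta_W s) \<le> C * (1 + norm s) ^ 3"
proof -
  define S where "S = (\<Sum>n. real (Suc n) powr (- (1/2) - 2))"
  have sS: "summable (\<lambda>n. real (Suc n) powr (- (1/2) - 2))"
    using summable_trapezoid_majorant[of "1/2"] by simp
  have S0: "S \<ge> 0" unfolding S_def by (intro suminf_nonneg sS) auto
  have "norm (zeta_W s) \<le> (1 + S) * (1 + norm s) ^ 3" if s: "Re s \<ge> 1/2" for s
  proof -
    let ?D = "norm ((s - 1) * s * (s + 1))"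
    have "norm (\<Sum>n. trap_term (Suc n) s) \<le> (\<Sum>n. ?D * real (Suc n) powr (- (1/2) - 2))"
    proof (rule norm_suminf_le[OF _ summable_mult[OF sS]])
      fix n
      have "norm (trap_term (Suc n) s) \<le> ?D * real (Suc n) powr (- Re s - 2)"
        using s by (intro trap_term_bound) auto
      also have "\<dots> \<le> ?D * real (Suc n) powr (- (1/2) - 2)"
        using s by (intro mult_mono powr_mono) auto
      finally show "norm (trap_term (Suc n) s) \<le> ?D * real (Suc n) powr (- (1/2) - 2)" .
    qed
    also have "\<dots> = ?D * S" unfolding S_def by (rule suminf_mult[OF sS])
    also have "?D \<le> (1 + norm s) * (1 + norm s) * (1 + norm s)"
      unfolding norm_mult using norm_triangle_ineq4[of s 1] norm_triangle_ineq[of s 1]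
      by (intro mult_mono) auto
    finally have 1: "norm (\<Sum>n. trap_term (Suc n) s) \<le> (1 + norm s)^3 * S"
      using S0 by (simp add: mult_right_mono power3_eq_cube mult.assoc)
    have "norm ((s + 1) / 2) = norm (s + 1) / 2" by (simp add: norm_divide)
    then have "norm ((s + 1) / 2) \<le> 1 + norm s"
      using norm_triangle_ineq[of s 1] norm_ge_zero[of s] unfolding norm_one by linarith
    also have "\<dots> \<le> (1 + norm s)^3" using self_le_power[of "1 + norm s" 3] by simp
    finally have "norm ((s + 1) / 2) \<le> (1 + norm s)^3" .
    with 1 show ?thesis unfolding zeta_W_def
      by (intro norm_triangle_le) (simp add: algebra_simps)
  qed
  moreover have "1 + S > 0" using S0 by simp
  ultimately show ?thesis by blast
qed

text \<open>The trapezoidal errors telescope: their partial sum is s - 1 times the partial Dirichlet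
  sum plus boundary terms, and those tend to constants when Re s > 1.\<close>

lemma zeta_W_sums:
  assumes "Re s > 1"
  shows "(\<lambda>n. (s - 1) * (1 / of_nat (Suc n) powr s)) sums zeta_W s"
proof -
  define a where "a = (\<lambda>n. of_nat n powr - s :: complex)"
  have part: "(\<Sum>n<N. trap_term (Suc n) s) = (s - 1) * (\<Sum>n<N. a (Suc n)) + (s - 1) * (a (Suc N) - 1) / 2 + of_nat (Suc N) powr (1 - s) - 1" for N
  proof (induction N)
    case 0
    then show ?case by (simp add: a_def)
  next
    case (Suc N)
    show ?case unfolding sum.lessThan_Suc Suc.IH
      by (simp add: trap_term_def a_def field_simps)
  qed
  have lim: "(\<lambda>n. of_nat (Suc n) powr z :: complex) \<longlonglongrightarrow> 0" if "Re z < 0" for z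
  proof (rule tendsto_norm_zero_cancel)
    have "(\<lambda>n. real n powr Re z) \<longlonglongrightarrow> 0"
      using that by (intro tendsto_neg_powr filterlim_real_sequentially) auto
    then have "(\<lambda>n. real (Suc n) powr Re z) \<longlonglongrightarrow> 0" by (rule LIMSEQ_Suc)
    then show "(\<lambda>n. norm (of_nat (Suc n) powr z :: complex)) \<longlonglongrightarrow> 0"
      by (simp add: norm_powr_real_powr)
  qed
  have "(\<lambda>N. \<Sum>n<N. trap_term (Suc n) s) \<longlonglongrightarrow> (\<Sum>n. trap_term (Suc n) s)"
    using summable_LIMSEQ[OF summable_trap_term[of s]] assms by simp
  then have "(\<lambda>N. (\<Sum>n<N. trap_term (Suc n) s) - (s - 1) * (a (Suc N) - 1) / 2 - of_nat (Suc N) powr (1 - s) + 1)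
      \<longlonglongrightarrow> (\<Sum>n. trap_term (Suc n) s) - (s - 1) * (0 - 1) / 2 - 0 + 1"
    unfolding a_def using assms by (intro tendsto_intros lim) auto
  then have "(\<lambda>N. \<Sum>n<N. (s - 1) * a (Suc n)) \<longlonglongrightarrow> zeta_W s"
    unfolding part zeta_W_def sum_distrib_left[symmetric] by (simp add: diff_divide_distrib add_divide_distrib algebra_simps)
  then show ?thesis unfolding sums_def a_def by (simp add: powr_minus field_simps)
qed

section \<open>Gamma integrals on the half line and the partial fractions of coth\<close>

lemma nn_integral_exhaust:
  fixes f :: "'a \<Rightarrow> ennreal" and A :: "nat \<Rightarrow> 'a set"
  assumes "incseq A" "\<And>i. A i \<in> sets M" and [measurable]: "f \<in> borel_measurable M"
  shows "(\<lambda>i. \<integral>\<^sup>+x. f x * indicator (A i) x \<partial>M) \<longlonglongrightarrow> (\<integral>\<^sup>+x. f x * indicator (\<Union>i. A i) x \<partial>M)"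
proof (rule nn_integral_LIMSEQ)
  show "incseq (\<lambda>i x. f x * indicator (A i) x)"
    using assms(1) by (auto simp: incseq_def le_fun_def indicator_def subset_iff)
  show "(\<lambda>x. f x * indicator (A i) x) \<in> borel_measurable M" for i
    using assms(2)[of i] by measurable
  fix x
  show "(\<lambda>i. f x * indicator (A i) x) \<longlonglongrightarrow> f x * indicator (\<Union>i. A i) x"
  proof (cases "x \<in> (\<Union>i. A i)")
    case True
    then obtain i where "x \<in> A i" by blast
    then have "x \<in> A j" if "j \<ge> i" for j using assms(1) that by (auto simp: incseq_def)
    then have "\<forall>\<^sub>F j in sequentially. f x * indicator (A j) x = f x * indicator (\<Union>i. A i) x"
      using True by (auto simp: eventually_sequentially intro!: exI[of _ i])
    then show ?thesis by (rule tendsto_eventually)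
  qed (auto simp: indicator_def)
qed

lemma nn_integral_substitution_square:
  fixes f :: "real \<Rightarrow> real"
  assumes [measurable]: "f \<in> borel_measurable borel"
  shows "(\<integral>\<^sup>+u. ennreal (f u) * indicator {0..} u \<partial>lborel) =
         (\<integral>\<^sup>+x. ennreal (f (x ^ 2) * (2 * x)) * indicator {0..} x \<partial>lborel)"
proof -
  have eq: "(\<integral>\<^sup>+u. ennreal (f u) * indicator {0..real k ^ 2} u \<partial>lborel) =
        (\<integral>\<^sup>+x. ennreal (f (x ^ 2) * (2 * x)) * indicator {0..real k} x \<partial>lborel)" for k :: nat
  proof -
    have "(\<integral>\<^sup>+u. f u * indicator {0 ^ 2..real k ^ 2} u \<partial>lborel) =
        (\<integral>\<^sup>+x. f (x ^ 2) * (2 * x) * indicator {0..real k} x \<partial>lborel)"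
    proof (rule nn_integral_substitution[where g = "\<lambda>x. x ^ 2" and g' = "\<lambda>x. 2 * x"])
      show "set_borel_measurable borel {0\<^sup>2..(real k)\<^sup>2} f"
        unfolding set_borel_measurable_def by measurable
    qed (auto intro!: derivative_eq_intros continuous_intros)
    moreover have "(\<integral>\<^sup>+u. f u * indicator {0 ^ 2..real k ^ 2} u \<partial>lborel) = (\<integral>\<^sup>+u. ennreal (f u) * indicator {0..real k ^ 2} u \<partial>lborel)"
      by (intro nn_integral_cong) (simp add: indicator_def)
    moreover have "(\<integral>\<^sup>+x. f (x ^ 2) * (2 * x) * indicator {0..real k} x \<partial>lborel) = (\<integral>\<^sup>+x. ennreal (f (x ^ 2) * (2 * x)) * indicator {0..real k} x \<partial>lborel)"
      by (intro nn_integral_cong) (simp add: indicator_def)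
    ultimately show ?thesis by simp
  qed
  have U1: "(\<Union>k. {0..real k ^ 2}) = {0..}"
  proof safe
    fix u :: real assume "0 \<le> u"
    obtain k :: nat where k: "u \<le> real k" using real_arch_simple by blast
    have "real k \<le> real k * real k" by (cases k) simp_all
    then have "real k \<le> real k ^ 2" by (simp only: power2_eq_square)
    with k \<open>0 \<le> u\<close> show "u \<in> (\<Union>k. {0..real k ^ 2})" by (intro UN_I[of k]) (auto intro: order_trans simp del: of_nat_power)
  qed auto
  have U2: "(\<Union>k. {0..real k}) = {0..}"
    using real_arch_simple by auto
  have "(\<lambda>k. \<integral>\<^sup>+u. ennreal (f u) * indicator {0..real k ^ 2} u \<partial>lborel) \<longlonglongrightarrow> (\<integral>\<^sup>+u. ennreal (f u) * indicator (\<Union>k. {0..real k ^ 2}) u \<partial>lborel)"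
  proof (rule nn_integral_exhaust)
    show "incseq (\<lambda>k. {0..real k ^ 2})" by (rule incseq_SucI) (simp add: power_mono)
  qed auto
  moreover have "(\<lambda>k. \<integral>\<^sup>+x. ennreal (f (x ^ 2) * (2 * x)) * indicator {0..real k} x \<partial>lborel) \<longlonglongrightarrow>
        (\<integral>\<^sup>+x. ennreal (f (x ^ 2) * (2 * x)) * indicator (\<Union>k. {0..real k}) x \<partial>lborel)"
    by (rule nn_integral_exhaust) (auto simp: incseq_def)
  ultimately show ?thesis unfolding eq U1 U2 by (rule LIMSEQ_unique)
qed

lemma nn_integral_powr_exp:
  assumes p: "p > 0" and y: "y > 0"
  shows "(\<integral>\<^sup>+x. ennreal (x powr (p - 1) * exp (- (y * x))) * indicator {0..} x \<partial>lborel) = ennreal (Gamma p * y powr - p)"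
proof -
  let ?h = "\<lambda>x. ennreal (x powr (p - 1) * exp (- (y * x))) * indicator {0..} x"
  have "ennreal (Gamma p) = (\<integral>\<^sup>+t. ennreal (indicator {0..} t * t powr (p - 1) / exp t) \<partial>lborel)"
    by (rule Gamma_conv_nn_integral_real[OF p])
  also have "\<dots> = ennreal \<bar>y\<bar> * (\<integral>\<^sup>+x. ennreal (indicator {0..} (0 + y * x) * (0 + y * x) powr (p - 1) / exp (0 + y * x)) \<partial>lborel)"
    by (rule nn_integral_real_affine) (use y in auto)
  also have "(\<integral>\<^sup>+x. ennreal (indicator {0..} (0 + y * x) * (0 + y * x) powr (p - 1) / exp (0 + y * x)) \<partial>lborel)
       = (\<integral>\<^sup>+x. ennreal (y powr (p - 1)) * ?h x \<partial>lborel)"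
  proof (intro nn_integral_cong)
    fix x :: real
    show "ennreal (indicator {0..} (0 + y * x) * (0 + y * x) powr (p - 1) / exp (0 + y * x)) = ennreal (y powr (p - 1)) * ?h x"
    proof (cases "x \<ge> 0")
      case True
      then show ?thesis using y
        by (simp add: powr_mult exp_minus field_simps ennreal_mult[symmetric])
    next
      case False
      then have "\<not> y * x \<ge> 0" using y by (simp add: zero_le_mult_iff)
      then show ?thesis using False by simp
    qed
  qed
  also have "\<dots> = ennreal (y powr (p - 1)) * (\<integral>\<^sup>+x. ?h x \<partial>lborel)"
    by (rule nn_integral_cmult) auto
  finally have "ennreal (Gamma p) = ennreal (y powr p) * (\<integral>\<^sup>+x. ?h x \<partial>lborel)"
    using y by (simp add: mult.assoc[symmetric] ennreal_mult[symmetric] powr_mult_base)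
  then have "ennreal (y powr - p) * ennreal (Gamma p) = ennreal (y powr - p) * ennreal (y powr p) * (\<integral>\<^sup>+x. ?h x \<partial>lborel)"
    by (simp add: mult.assoc)
  also have "ennreal (y powr - p) * ennreal (y powr p) = 1"
    using y by (simp add: ennreal_mult[symmetric] powr_add[symmetric])
  finally show ?thesis using p by (simp add: ennreal_mult[symmetric] mult.commute)
qed

text \<open>Put u = x^2 and write 1 / (u + c^2) as the integral of exp (- (u + c^2) v) over v >= 0.
  Exchanging the integrals leaves one Gamma integral in u and one in v; the range of s keeps both
  Gamma arguments positive.\<close>

lemma nn_integral_powr_over_square_add:
  assumes s: "-1 < s" "s < 1" and c: "c > 0"
  shows "(\<integral>\<^sup>+x. ennreal (x powr (s - 1) * (2 * x / (x ^ 2 + c ^ 2))) * indicator {0..} x \<partial>lborel) =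
     ennreal (Gamma ((s + 1) / 2) * Gamma ((1 - s) / 2) * c powr (s - 1))"
proof -
  let ?f = "\<lambda>u. u powr ((s - 1) / 2) / (u + c ^ 2)"
  have "(\<integral>\<^sup>+x. ennreal (x powr (s - 1) * (2 * x / (x ^ 2 + c ^ 2))) * indicator {0..} x \<partial>lborel) =
      (\<integral>\<^sup>+x. ennreal (?f (x ^ 2) * (2 * x)) * indicator {0..} x \<partial>lborel)"
  proof (intro nn_integral_cong)
    fix x :: real
    have "x powr (s - 1) = (x ^ 2) powr ((s - 1) / 2)" if "x \<ge> 0"
      using that by (cases "x = 0") (simp_all add: powr_powr diff_divide_distrib flip: powr_numeral)
    then show "ennreal (x powr (s - 1) * (2 * x / (x ^ 2 + c ^ 2))) * indicator {0..} x = ennreal (?f (x ^ 2) * (2 * x)) * indicator {0..} x"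
      by (simp add: indicator_def)
  qed
  also have "\<dots> = (\<integral>\<^sup>+u. ennreal (?f u) * indicator {0..} u \<partial>lborel)"
    by (rule nn_integral_substitution_square[symmetric]) measurable
  also have "\<dots> = (\<integral>\<^sup>+u. \<integral>\<^sup>+v. ennreal (u powr ((s + 1) / 2 - 1) * exp (- (v * u))) * indicator {0..} u * (ennreal (exp (- (c ^ 2 * v))) * indicator {0..} v) \<partial>lborel \<partial>lborel)"
  proof (intro nn_integral_cong)
    fix u :: real
    show "ennreal (?f u) * indicator {0..} u = (\<integral>\<^sup>+v. ennreal (u powr ((s + 1) / 2 - 1) * exp (- (v * u))) * indicator {0..} u * (ennreal (exp (- (c ^ 2 * v))) * indicator {0..} v) \<partial>lborel)"
    proof (cases "u \<ge> 0")
      case True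
      have pos: "u + c ^ 2 > 0" using True c by (simp add: add_nonneg_pos)
      have "(\<integral>\<^sup>+v. ennreal (u powr ((s + 1) / 2 - 1) * exp (- (v * u))) * indicator {0..} u * (ennreal (exp (- (c ^ 2 * v))) * indicator {0..} v) \<partial>lborel)
         = (\<integral>\<^sup>+v. ennreal (u powr ((s - 1) / 2)) * (ennreal (v powr (1 - 1) * exp (- ((u + c ^ 2) * v))) * indicator {0..} v) \<partial>lborel)"
      proof (rule nn_integral_cong_AE)
        \<comment> \<open>In HOL \<open>0 powr 0\<close> is 0, so v = 0 is discarded before
          \<open>v powr (1 - 1)\<close> is read as 1.\<close>
        have "AE v in lborel. v \<noteq> (0::real)" by (rule AE_lborel_singleton)
        then show "AE v in lborel. ennreal (u powr ((s + 1) / 2 - 1) * exp (- (v * u))) * indicator {0..} u * (ennreal (exp (- (c ^ 2 * v))) * indicator {0..} v)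
          = ennreal (u powr ((s - 1) / 2)) * (ennreal (v powr (1 - 1) * exp (- ((u + c ^ 2) * v))) * indicator {0..} v)"
        proof eventually_elim
          case (elim v)
          have "exp (- (v * u)) * exp (- (c ^ 2 * v)) = exp (- ((u + c ^ 2) * v))"
            by (simp add: exp_add[symmetric] algebra_simps)
          moreover have "(s + 1) / 2 - 1 = (s - 1) / 2" by (simp add: field_simps)
          ultimately show ?case
            using True elim by (simp add: indicator_def ennreal_mult[symmetric] mult.assoc)
        qed
      qed
      also have "\<dots> = ennreal (u powr ((s - 1) / 2)) * ennreal (Gamma 1 * (u + c ^ 2) powr - 1)"
        using nn_integral_powr_exp[of 1 "u + c ^ 2"] pos by (subst nn_integral_cmult) auto
      also have "\<dots> = ennreal (?f u)"
        using pos by (simp add: ennreal_mult[symmetric] powr_minus_divide)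
      finally show ?thesis using True by simp
    qed simp
  qed
  also have "\<dots> = (\<integral>\<^sup>+v. \<integral>\<^sup>+u. ennreal (u powr ((s + 1) / 2 - 1) * exp (- (v * u))) * indicator {0..} u * (ennreal (exp (- (c ^ 2 * v))) * indicator {0..} v) \<partial>lborel \<partial>lborel)"
    by (rule lborel_pair.Fubini') measurable
  also have "\<dots> = (\<integral>\<^sup>+v. ennreal (Gamma ((s + 1) / 2)) * (ennreal (v powr ((1 - s) / 2 - 1) * exp (- (c ^ 2 * v))) * indicator {0..} v) \<partial>lborel)"
  proof (rule nn_integral_cong_AE)
    have "AE v in lborel. v \<noteq> (0::real)" by (rule AE_lborel_singleton)
    then show "AE v in lborel. (\<integral>\<^sup>+u. ennreal (u powr ((s + 1) / 2 - 1) * exp (- (v * u))) * indicator {0..} u * (ennreal (exp (- (c ^ 2 * v))) * indicator {0..} v) \<partial>lborel)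
      = ennreal (Gamma ((s + 1) / 2)) * (ennreal (v powr ((1 - s) / 2 - 1) * exp (- (c ^ 2 * v))) * indicator {0..} v)"
    proof eventually_elim
      case (elim v)
      show ?case
      proof (cases "v > 0")
        case True
        have e: "- ((s + 1) / 2) = (1 - s) / 2 - 1" by (simp add: field_simps)
        have "(\<integral>\<^sup>+u. ennreal (u powr ((s + 1) / 2 - 1) * exp (- (v * u))) * indicator {0..} u * (ennreal (exp (- (c ^ 2 * v))) * indicator {0..} v) \<partial>lborel)
          = ennreal (Gamma ((s + 1) / 2) * v powr - ((s + 1) / 2)) * (ennreal (exp (- (c ^ 2 * v))) * indicator {0..} v)"
          using nn_integral_powr_exp[of "(s + 1) / 2" v] True s by (subst nn_integral_multc) auto
        then show ?thesis unfolding e using True s by (simp add: ennreal_mult[symmetric] mult_ac)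
      next
        case False
        then show ?thesis using elim by simp
      qed
    qed
  qed
  also have "\<dots> = ennreal (Gamma ((s + 1) / 2)) * ennreal (Gamma ((1 - s) / 2) * (c ^ 2) powr - ((1 - s) / 2))"
    using nn_integral_powr_exp[of "(1 - s) / 2" "c ^ 2"] s c by (subst nn_integral_cmult) auto
  also have "(c ^ 2) powr - ((1 - s) / 2) = c powr (s - 1)"
  proof -
    have "(c powr 2) powr - ((1 - s) / 2) = c powr (2 * - ((1 - s) / 2))" by (rule powr_powr)
    also have "2 * - ((1 - s) / 2) = s - 1" by (simp add: field_simps)
    finally show ?thesis using c by simp
  qed
  finally show ?thesis using s by (simp add: ennreal_mult[symmetric] mult.assoc)
qed

text \<open>The value is coth (x / 2) / 2 - 1 / x. It comes from the logarithmic derivative of the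
  reflection formula for \<open>rGamma z * rGamma (- z)\<close>, in which the two Digamma series
  combine to the sum; z = i x / (2 pi) produces the denominators x^2 + (2 pi m)^2.\<close>

lemma coth_partial_fractions:
  fixes x :: real
  assumes x: "x > 0"
  shows "(\<lambda>m. 2 * x / (x ^ 2 + (2 * pi * real (Suc m)) ^ 2)) sums ((1 + exp (- x)) / (1 - exp (- x)) / 2 - 1 / x)"
proof -
  define z where "z = \<i> * of_real (x / (2 * pi))"
  have imz: "Im z \<noteq> 0" using x by (simp add: z_def)
  have nI: "z \<notin> \<int>\<^sub>\<le>\<^sub>0" "- z \<notin> \<int>\<^sub>\<le>\<^sub>0" "1 + z \<noteq> 0" "1 - z \<noteq> 0" "z \<noteq> 0" "- z \<noteq> 0" 
    using imz by (auto simp: complex_eq_iff elim!: nonpos_Ints_cases)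
  define Sn Cs where "Sn = sin (of_real pi * z)" and "Cs = cos (of_real pi * z)"
  have piz: "of_real pi * z = \<i> * of_real (x / 2)" by (simp add: z_def)
  have Sn: "Sn = \<i> * of_real ((exp (x / 2) - exp (- (x / 2))) / 2)"
    unfolding Sn_def piz sin_exp_eq by (simp add: exp_of_real[symmetric] mult.assoc[symmetric] field_simps)
  have Cs: "Cs = of_real ((exp (x / 2) + exp (- (x / 2))) / 2)"
    unfolding Cs_def piz cos_exp_eq by (simp add: exp_of_real[symmetric] mult.assoc[symmetric] field_simps)
  have "exp (x / 2) - exp (- (x / 2)) > 0" using x by simp
  then have S0: "Sn \<noteq> 0" unfolding Sn by (simp only: mult_eq_0_iff of_real_eq_0_iff) auto
  have "((\<lambda>z. rGamma z * rGamma (- z)) has_field_derivative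
      (rGamma z * (- 1 * (- rGamma (- z) * Digamma (- z))) + (- rGamma z * Digamma z) * rGamma (- z))) (at z)"
    using nI by (auto intro!: derivative_eq_intros has_field_derivative_rGamma_no_nonpos_int simp: field_simps)
  moreover have "((\<lambda>z. -z * sin (of_real pi * z) / of_real pi) has_field_derivative - (Sn + z * (Cs * of_real pi)) / of_real pi) (at z)"
    unfolding Sn_def Cs_def by (auto intro!: derivative_eq_intros simp: field_simps)
  ultimately have "rGamma z * (- 1 * (- rGamma (- z) * Digamma (- z))) + (- rGamma z * Digamma z) * rGamma (- z) = - (Sn + z * (Cs * of_real pi)) / of_real pi"
    unfolding rGamma_reflection_complex' by (rule DERIV_unique)
  then have "(rGamma z * rGamma (- z)) * (Digamma (- z) - Digamma z) = - (Sn + z * (Cs * of_real pi)) / of_real pi"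
    by (simp add: algebra_simps)
  then have "of_real pi * (z * Sn * (Digamma (- z) - Digamma z)) = of_real pi * (Sn + z * (Cs * of_real pi))"
    unfolding rGamma_reflection_complex' Sn_def[symmetric] by (simp add: field_simps)
  then have "z * Sn * (Digamma (- z) - Digamma z) = Sn + z * (Cs * of_real pi)"
    by (subst (asm) mult_left_cancel) auto
  then have dd: "Digamma (- z) - Digamma z = 1 / z + of_real pi * Cs / Sn"
    using S0 nI by (simp add: field_simps)
  \<comment> \<open>Starting the Digamma series at 1 + z and 1 - z leaves exactly the terms with m
    >= 1.\<close>
  have D1: "Digamma (1 + z) = Digamma z + 1 / z" "Digamma (1 - z) = Digamma (- z) - 1 / z"
    using Digamma_plus1[of z] Digamma_plus1[of "- z"] nI by (simp_all add: add.commute)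
  have "(\<lambda>k. (inverse (of_nat (Suc k)) - inverse (1 + z + of_nat k)) - (inverse (of_nat (Suc k)) - inverse (1 - z + of_nat k)))
      sums ((Digamma (1 + z) + euler_mascheroni) - (Digamma (1 - z) + euler_mascheroni))"
    using nI summable_Digamma[of "1 + z"] summable_Digamma[of "1 - z"]
    by (intro sums_diff) (auto simp: Digamma_def summable_sums)
  moreover have "(inverse (of_nat (Suc k)) - inverse (1 + z + of_nat k)) - (inverse (of_nat (Suc k)) - inverse (1 - z + of_nat k))
     = 2 * of_real pi * \<i> * of_real (2 * x / (x ^ 2 + (2 * pi * real (Suc k)) ^ 2))" for k
  proof -
    have n: "1 + z + of_nat k \<noteq> 0" "1 - z + of_nat k \<noteq> 0" using imz by (auto simp: complex_eq_iff)
    have q: "x ^ 2 + (2 * pi * real (Suc k)) ^ 2 > 0" using x by (intro add_pos_nonneg) auto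
    have z2: "z ^ 2 = - of_real (x ^ 2 / (4 * pi ^ 2))" by (simp add: z_def power_mult_distrib power_divide)
    have e: "(1 + z + of_nat k) * (1 - z + of_nat k) = of_real ((x ^ 2 + (2 * pi * real (Suc k)) ^ 2) / (4 * pi ^ 2))"
    proof -
      have "(1 + z + of_nat k) * (1 - z + of_nat k) = (of_nat (Suc k)) ^ 2 - z ^ 2" by (simp add: algebra_simps power2_eq_square)
      also have "\<dots> = of_real (real (Suc k) ^ 2 + x ^ 2 / (4 * pi ^ 2))" unfolding z2 by simp
      also have "real (Suc k) ^ 2 + x ^ 2 / (4 * pi ^ 2) = (x ^ 2 + (2 * pi * real (Suc k)) ^ 2) / (4 * pi ^ 2)"
        by (simp add: field_simps power_mult_distrib del: of_nat_Suc)
      finally show ?thesis .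
    qed
    have "(inverse (of_nat (Suc k)) - inverse (1 + z + of_nat k)) - (inverse (of_nat (Suc k)) - inverse (1 - z + of_nat k))
       = inverse (1 - z + of_nat k) - inverse (1 + z + of_nat k)" by simp
    also have "\<dots> = 2 * z / ((1 + z + of_nat k) * (1 - z + of_nat k))" using n by (simp add: field_simps)
    also have "\<dots> = 2 * (\<i> * of_real (x / (2 * pi))) / of_real ((x ^ 2 + (2 * pi * real (Suc k)) ^ 2) / (4 * pi ^ 2))"
      unfolding e by (simp only: z_def)
    also have "\<dots> = \<i> * of_real (2 * (x / (2 * pi)) / ((x ^ 2 + (2 * pi * real (Suc k)) ^ 2) / (4 * pi ^ 2)))" by simp
    also have "2 * (x / (2 * pi)) / ((x ^ 2 + (2 * pi * real (Suc k)) ^ 2) / (4 * pi ^ 2)) = 2 * pi * (2 * x / (x ^ 2 + (2 * pi * real (Suc k)) ^ 2))"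
      using q by (simp add: power2_eq_square divide_simps)
    finally show ?thesis by simp
  qed
  ultimately have "(\<lambda>k. 2 * of_real pi * \<i> * of_real (2 * x / (x ^ 2 + (2 * pi * real (Suc k)) ^ 2))) sums (1 / z - of_real pi * Cs / Sn)"
    using dd unfolding D1 by (simp add: algebra_simps)
  then have "(\<lambda>k. (2 * of_real pi * \<i> * of_real (2 * x / (x ^ 2 + (2 * pi * real (Suc k)) ^ 2))) / (2 * of_real pi * \<i>)) sums ((1 / z - of_real pi * Cs / Sn) / (2 * of_real pi * \<i>))"
    by (rule sums_divide)
  moreover have "2 * of_real pi * \<i> * c / (2 * of_real pi * \<i>) = c" for c by simp
  ultimately have "(\<lambda>k. complex_of_real (2 * x / (x ^ 2 + (2 * pi * real (Suc k)) ^ 2))) sums ((1 / z - of_real pi * Cs / Sn) / (2 * of_real pi * \<i>))"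
    by (simp only:)
  also have "(1 / z - of_real pi * Cs / Sn) / (2 * of_real pi * \<i>) = of_real ((1 + exp (- x)) / (1 - exp (- x)) / 2 - 1 / x)"
  proof -
    have "(exp (x / 2) + exp (- (x / 2))) / (exp (x / 2) - exp (- (x / 2))) = (1 + exp (- x)) / (1 - exp (- x))"
    proof -
      have "exp (- (x / 2)) = exp (x / 2) * exp (- x)" by (simp add: exp_add[symmetric])
      then have "(exp (x / 2) + exp (- (x / 2))) / (exp (x / 2) - exp (- (x / 2))) = (exp (x / 2) * (1 + exp (- x))) / (exp (x / 2) * (1 - exp (- x)))"
        by (simp add: algebra_simps)
      then show ?thesis by simp
    qed
    moreover have "(1 / z - of_real pi * Cs / Sn) / (2 * of_real pi * \<i>) = of_real ((exp (x / 2) + exp (- (x / 2))) / (exp (x / 2) - exp (- (x / 2))) / 2 - 1 / x)"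
    proof -
      have "1 / z / (2 * of_real pi * \<i>) = - 1 / of_real x" using x by (simp add: z_def field_simps)
      moreover have "of_real pi * Cs / Sn / (2 * of_real pi * \<i>) = - of_real ((exp (x / 2) + exp (- (x / 2))) / (exp (x / 2) - exp (- (x / 2))) / 2)"
      proof -
        define P Q where "P = exp (x / 2) + exp (- (x / 2))" and "Q = exp (x / 2) - exp (- (x / 2))"
        have "Q \<noteq> 0" using \<open>exp (x / 2) - exp (- (x / 2)) > 0\<close> by (simp add: Q_def)
        then show ?thesis unfolding Sn Cs P_def[symmetric] Q_def[symmetric] by (simp add: field_simps)
      qed
      ultimately show ?thesis by (simp add: diff_divide_distrib)
    qed
    ultimately show ?thesis by simp
  qed
  finally show ?thesis by (simp only: sums_of_real_iff)
qed

subsection \<open>The functional equation\<close>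

text \<open>The error of the trapezoidal rule on \<open>[n, n + 1]\<close>, applied to \<open>y \<mapsto> exp (- x y)\<close> and to
  \<open>y \<mapsto> y powr - s\<close>, has the same kernel $(y-n)(n+1-y)/2$; this links both Mellin-wise.\<close>

lemma trapezoid_exp_integral:
  fixes x :: real
  assumes x: "x > 0"
  shows "((\<lambda>y. (y - n) * (n + 1 - y) / 2 * (x ^ 2 * exp (- (x * y)))) has_integral
      exp (- (x * n)) * ((1 + exp (- x)) / 2 - (1 - exp (- x)) / x)) {n..n + 1}"
proof -
  define A where "A = (\<lambda>y. - ((y - n) * (n + 1 - y) / 2 * x * exp (- (x * y))) - (2 * n + 1 - 2 * y) / 2 * exp (- (x * y)) + exp (- (x * y)) / x)"
  have "((\<lambda>y. (y - n) * (n + 1 - y) / 2 * (x ^ 2 * exp (- (x * y)))) has_integral A (n + 1) - A n) {n..n + 1}"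
  proof (rule fundamental_theorem_of_calculus)
    fix y
    have "(A has_real_derivative (y - n) * (n + 1 - y) / 2 * (x ^ 2 * exp (- (x * y)))) (at y within {n..n + 1})"
      unfolding A_def using x by (auto intro!: derivative_eq_intros simp: field_simps power2_eq_square)
    then show "(A has_vector_derivative (y - n) * (n + 1 - y) / 2 * (x ^ 2 * exp (- (x * y)))) (at y within {n..n + 1})"
      by (simp add: has_real_derivative_iff_has_vector_derivative)
  qed simp
  moreover have "exp (- (x * (n + 1))) = exp (- (x * n)) * exp (- x)"
    by (simp add: exp_add[symmetric] algebra_simps)
  then have "A (n + 1) - A n = exp (- (x * n)) * ((1 + exp (- x)) / 2 - (1 - exp (- x)) / x)"
    by (simp add: A_def diff_divide_distrib add_divide_distrib algebra_simps)
  ultimately show ?thesis by simp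
qed

lemma trap_term_real:
  fixes s :: real
  assumes s: "-1 < s" "s < 0"
  shows "((\<lambda>y::real. (y - real n) * (real n + 1 - y) / 2 * ((s - 1) * s * (s + 1)) * y powr (- s - 2)) has_integral
     Re (trap_term n (of_real s))) {real n..real n + 1}"
proof -
  have "((\<lambda>y. Re (of_real ((y - real n) * (real n + 1 - y) / 2) * ((of_real s - 1) * of_real s * (of_real s + 1)) * of_real y powr (- of_real s - 2)))
          has_integral Re (trap_term n (of_real s))) {real n..real n + 1}"
    using trap_term_has_integral[of n "of_real s"] s by (intro has_integral_Re) auto
  then show ?thesis
  proof (rule has_integral_eq[rotated])
    fix y :: real assume "y \<in> {real n..real n + 1}"
    then have "complex_of_real y powr (- of_real s - 2) = of_real (y powr (- s - 2))"
      using powr_of_real[of y "- s - 2"] by simp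
    moreover have "(of_real s - 1) * of_real s * (of_real s + 1) = complex_of_real ((s - 1) * s * (s + 1))" by simp
    ultimately show "Re (of_real ((y - real n) * (real n + 1 - y) / 2) * ((of_real s - 1) * of_real s * (of_real s + 1)) * of_real y powr (- of_real s - 2))
      = (y - real n) * (real n + 1 - y) / 2 * ((s - 1) * s * (s + 1)) * y powr (- s - 2)"
      by (simp only: of_real_mult[symmetric] Re_complex_of_real)
  qed
qed

text \<open>By \<open>trapezoid_exp_integral\<close> the integrand is an integral of the kernel
  against x^2 exp (- x y). Exchanging the order, the x-integral is Gamma (s + 2)
  \<open>y powr - (s + 2)\<close>, and the kernel integrated against this power is
  \<open>trap_term\<close> up to the factor (s - 1) s (s + 1), which is positive for s in (-1,
  0).\<close>

lemma nn_integral_Mellin_trapezoid: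
  fixes s :: real and n :: nat
  assumes s: "-1 < s" "s < 0"
  shows "(\<integral>\<^sup>+x. ennreal (x powr (s - 1) * (exp (- (x * n)) * ((1 + exp (- x)) / 2 - (1 - exp (- x)) / x))) * indicator {0<..} x \<partial>lborel)
     = ennreal (Gamma (s + 2) / ((s - 1) * s * (s + 1)) * Re (trap_term n (of_real s)))"
proof -
  define D where "D = (s - 1) * s * (s + 1)"
  have D: "D > 0" unfolding D_def using s by (simp add: mult_neg_neg)
  let ?P = "\<lambda>y::real. (y - real n) * (real n + 1 - y) / 2"
  have P: "?P y \<ge> 0" if "y \<in> {real n..real n + 1}" for y using that by simp
  have "(\<integral>\<^sup>+x. ennreal (x powr (s - 1) * (exp (- (x * n)) * ((1 + exp (- x)) / 2 - (1 - exp (- x)) / x))) * indicator {0<..} x \<partial>lborel)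
     = (\<integral>\<^sup>+x. \<integral>\<^sup>+y. ennreal (?P y) * indicator {real n..real n + 1} y * (ennreal (x powr (s + 2 - 1) * exp (- (y * x))) * indicator {0..} x) \<partial>lborel \<partial>lborel)"
  proof (rule nn_integral_cong_AE)
    have "AE x in lborel. x \<noteq> (0::real)" by (rule AE_lborel_singleton)
    then show "AE x in lborel. ennreal (x powr (s - 1) * (exp (- (x * n)) * ((1 + exp (- x)) / 2 - (1 - exp (- x)) / x))) * indicator {0<..} x
      = (\<integral>\<^sup>+y. ennreal (?P y) * indicator {real n..real n + 1} y * (ennreal (x powr (s + 2 - 1) * exp (- (y * x))) * indicator {0..} x) \<partial>lborel)"
    proof eventually_elim
      case (elim x)
      show ?case
      proof (cases "x > 0")
        case True
        have sp: "x powr (s + 2 - 1) = x powr (s - 1) * x ^ 2"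
          using True powr_add[of x "s - 1" 2] by (simp add: add.commute)
        have "(\<integral>\<^sup>+y. ennreal (?P y * (x ^ 2 * exp (- (x * y)))) * indicator {real n..real n + 1} y \<partial>lborel)
          = ennreal (exp (- (x * n)) * ((1 + exp (- x)) / 2 - (1 - exp (- x)) / x))"
          using trapezoid_exp_integral[OF True, of "real n"] P
          by (intro nn_integral_has_integral_lebesgue') (auto simp: add.commute)
        then have "ennreal (x powr (s - 1)) * (\<integral>\<^sup>+y. ennreal (?P y * (x ^ 2 * exp (- (x * y)))) * indicator {real n..real n + 1} y \<partial>lborel)
          = ennreal (x powr (s - 1) * (exp (- (x * n)) * ((1 + exp (- x)) / 2 - (1 - exp (- x)) / x)))"
          by (simp only: ennreal_mult'[OF powr_ge_zero])
        also have "ennreal (x powr (s - 1)) * (\<integral>\<^sup>+y. ennreal (?P y * (x ^ 2 * exp (- (x * y)))) * indicator {real n..real n + 1} y \<partial>lborel)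
          = (\<integral>\<^sup>+y. ennreal (x powr (s - 1)) * (ennreal (?P y * (x ^ 2 * exp (- (x * y)))) * indicator {real n..real n + 1} y) \<partial>lborel)"
          by (rule nn_integral_cmult[symmetric]) measurable
        also have "\<dots> = (\<integral>\<^sup>+y. ennreal (?P y) * indicator {real n..real n + 1} y * (ennreal (x powr (s + 2 - 1) * exp (- (y * x))) * indicator {0..} x) \<partial>lborel)"
        proof (intro nn_integral_cong)
          fix y :: real
          show "ennreal (x powr (s - 1)) * (ennreal (?P y * (x ^ 2 * exp (- (x * y)))) * indicator {real n..real n + 1} y)
            = ennreal (?P y) * indicator {real n..real n + 1} y * (ennreal (x powr (s + 2 - 1) * exp (- (y * x))) * indicator {0..} x)"
          proof (cases "y \<in> {real n..real n + 1}")
            case y: True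
            have "ennreal (x powr (s - 1)) * ennreal (?P y * (x ^ 2 * exp (- (x * y)))) = ennreal (?P y) * ennreal (x powr (s + 2 - 1) * exp (- (y * x)))"
              using P[OF y] unfolding sp by (subst ennreal_mult[symmetric], simp, simp)+ (simp add: mult_ac)
            then show ?thesis using y True by simp
          qed simp
        qed
        finally show ?thesis using True by simp
      next
        case False
        then show ?thesis using elim by simp
      qed
    qed
  qed
  also have "\<dots> = (\<integral>\<^sup>+y. \<integral>\<^sup>+x. ennreal (?P y) * indicator {real n..real n + 1} y * (ennreal (x powr (s + 2 - 1) * exp (- (y * x))) * indicator {0..} x) \<partial>lborel \<partial>lborel)"
    by (rule lborel_pair.Fubini') measurable
  also have "\<dots> = (\<integral>\<^sup>+y. ennreal (Gamma (s + 2) / D) * (ennreal (?P y * D * y powr (- s - 2)) * indicator {real n..real n + 1} y) \<partial>lborel)"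
  proof (rule nn_integral_cong_AE)
    have "AE y in lborel. y \<noteq> (0::real)" by (rule AE_lborel_singleton)
    then show "AE y in lborel. (\<integral>\<^sup>+x. ennreal (?P y) * indicator {real n..real n + 1} y * (ennreal (x powr (s + 2 - 1) * exp (- (y * x))) * indicator {0..} x) \<partial>lborel)
      = ennreal (Gamma (s + 2) / D) * (ennreal (?P y * D * y powr (- s - 2)) * indicator {real n..real n + 1} y)"
    proof eventually_elim
      case (elim y)
      show ?case
      proof (cases "y \<in> {real n..real n + 1}")
        case True
        then have y: "y > 0" using elim by auto
        have "(\<integral>\<^sup>+x. ennreal (?P y) * indicator {real n..real n + 1} y * (ennreal (x powr (s + 2 - 1) * exp (- (y * x))) * indicator {0..} x) \<partial>lborel)
          = ennreal (?P y) * indicator {real n..real n + 1} y * ennreal (Gamma (s + 2) * y powr - (s + 2))"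
          using nn_integral_powr_exp[of "s + 2" y] s y by (subst nn_integral_cmult) auto
        also have "\<dots> = ennreal (?P y) * ennreal (Gamma (s + 2) * y powr - (s + 2))" using True by simp
        also have "\<dots> = ennreal (?P y * (Gamma (s + 2) * y powr - (s + 2)))"
          using P[OF True] by (rule ennreal_mult'[symmetric])
        also have "?P y * (Gamma (s + 2) * y powr - (s + 2)) = Gamma (s + 2) / D * (?P y * D * y powr (- s - 2))"
          using D by (simp add: field_simps)
        also have "ennreal \<dots> = ennreal (Gamma (s + 2) / D) * ennreal (?P y * D * y powr (- s - 2))"
          using D s by (intro ennreal_mult') auto
        finally show ?thesis using True by simp
      qed simp
    qed
  qed
  also have "\<dots> = ennreal (Gamma (s + 2) / D) * ennreal (Re (trap_term n (of_real s)))"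
  proof (subst nn_integral_cmult)
    have "(\<integral>\<^sup>+y. ennreal (?P y * D * y powr (- s - 2)) * indicator {real n..real n + 1} y \<partial>lborel) = ennreal (Re (trap_term n (of_real s)))"
      using trap_term_real[OF s, of n] P D unfolding D_def
      by (intro nn_integral_has_integral_lebesgue') (auto simp: add.commute)
    then show "ennreal (Gamma (s + 2) / D) * (\<integral>\<^sup>+y. ennreal (?P y * D * y powr (- s - 2)) * indicator {real n..real n + 1} y \<partial>lborel)
      = ennreal (Gamma (s + 2) / D) * ennreal (Re (trap_term n (of_real s)))" by simp
  qed measurable
  also have "\<dots> = ennreal (Gamma (s + 2) / D * Re (trap_term n (of_real s)))"
    using D s by (intro ennreal_mult'[symmetric]) auto
  finally show ?thesis unfolding D_def .
qed

lemma Re_trap_term_nonneg: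
  fixes s :: real
  assumes s: "-1 < s" "s < 0"
  shows "Re (trap_term n (of_real s)) \<ge> 0"
proof (rule has_integral_nonneg[OF trap_term_real[OF s, of n]])
  have D: "(s - 1) * s * (s + 1) \<ge> 0" using s by (simp add: mult_nonpos_nonpos)
  fix y :: real assume y: "y \<in> {real n..real n + 1}"
  then have "(y - real n) * (real n + 1 - y) / 2 \<ge> 0" by simp
  from mult_nonneg_nonneg[OF mult_nonneg_nonneg[OF this D] powr_ge_zero]
  show "0 \<le> (y - real n) * (real n + 1 - y) / 2 * ((s - 1) * s * (s + 1)) * y powr (- s - 2)" .
qed

text \<open>The function x powr (s - 1) times (coth (x / 2) / 2 - 1 / x) is integrated in two ways.
  As a geometric series in exp (- x) it gives the trapezoidal corrections, that is
  \<open>zeta_W s\<close>; as a partial fraction series it gives the Dirichlet series at 1 - s > 1.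
  All terms are nonnegative for s in (-1, 0).\<close>

lemma zeta_W_functional_equation_real:
  fixes s :: real
  assumes s: "-1 < s" "s < 0"
    and z: "(\<lambda>m. 1 / real (Suc m) powr (1 - s)) sums z"
  shows "Gamma (s + 2) / ((s - 1) * s * (s + 1)) * Re (zeta_W (of_real s))
     = (2 * pi) powr (s - 1) * Gamma ((s + 1) / 2) * Gamma ((1 - s) / 2) * z"
proof -
  define D where "D = (s - 1) * s * (s + 1)"
  have D: "D > 0" unfolding D_def using s by (simp add: mult_neg_neg)
  define c where "c = (\<lambda>x::real. (1 + exp (- x)) / 2 - (1 - exp (- x)) / x)"
  define t where "t = (\<lambda>n. Re (trap_term n (of_real s)))"
  have c0: "c x \<ge> 0" if "x > 0" for x
  proof -
    have "0 \<le> exp (- (x * 0)) * c x" unfolding c_def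
      by (rule has_integral_nonneg[OF trapezoid_exp_integral[OF that, of 0]]) auto
    then show ?thesis by simp
  qed
  have t0: "t n \<ge> 0" for n unfolding t_def by (rule Re_trap_term_nonneg[OF s])
  have tsum: "t sums Re (zeta_W (of_real s))"
  proof -
    have "(\<lambda>n. t (Suc n)) sums Re (\<Sum>n. trap_term (Suc n) (of_real s))"
      unfolding t_def using s by (intro sums_Re summable_sums summable_trap_term) auto
    \<comment> \<open>Since \<open>0 powr z\<close> is 0, the term with index 0 is exactly the
      summand (s + 1) / 2 in the definition of \<open>zeta_W\<close>.\<close>
    moreover have t0: "t 0 = (s + 1) / 2" by (simp add: t_def trap_term_def field_simps)
    have "Re (zeta_W (of_real s)) = t 0 + Re (\<Sum>n. trap_term (Suc n) (of_real s))"
      unfolding t0 by (simp add: zeta_W_def)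
    ultimately have "(\<lambda>n. t (Suc n)) sums (Re (zeta_W (of_real s)) - t 0)" by simp
    then show ?thesis by (simp only: sums_Suc_iff) simp
  qed
  have z': "(\<lambda>m. (2 * pi * real (Suc m)) powr (s - 1)) sums ((2 * pi) powr (s - 1) * z)"
  proof -
    have "(2 * pi * real (Suc m)) powr (s - 1) = (2 * pi) powr (s - 1) * (1 / real (Suc m) powr (1 - s))" for m
      using powr_minus_divide[of "real (Suc m)" "1 - s"] by (simp add: powr_mult del: of_nat_Suc)
    then show ?thesis using sums_mult[OF z, of "(2 * pi) powr (s - 1)"] by simp
  qed
  have z0: "z \<ge> 0" using sums_le[OF _ sums_zero z] by simp
  let ?L = "\<lambda>n x. ennreal (x powr (s - 1) * (exp (- (x * real n)) * c x)) * indicator {0<..} x"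
  let ?R = "\<lambda>m x. ennreal (x powr (s - 1) * (2 * x / (x ^ 2 + (2 * pi * real (Suc m)) ^ 2))) * indicator {0..} x"
  have pt: "(\<Sum>n. ?L n x) = (\<Sum>m. ?R m x)" if "x \<noteq> 0" for x
  proof (cases "x > 0")
    case True
    have "(\<lambda>n. exp (- x) ^ n) sums (1 / (1 - exp (- x)))" using True by (intro geometric_sums) simp
    then have g: "(\<lambda>n. exp (- (x * real n))) sums (1 / (1 - exp (- x)))" by (simp add: exp_of_nat_mult[symmetric] mult.commute)
    have "(\<lambda>n. x powr (s - 1) * (exp (- (x * real n)) * c x)) sums (x powr (s - 1) * (1 / (1 - exp (- x)) * c x))"
      by (intro sums_mult sums_mult2 g)
    then have 1: "(\<Sum>n. ?L n x) = ennreal (x powr (s - 1) * (1 / (1 - exp (- x)) * c x))"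
      using True c0[OF True] by (simp, subst suminf_ennreal2) (auto simp: sums_iff)
    have "1 / (1 - exp (- x)) * c x = (1 + exp (- x)) / (1 - exp (- x)) / 2 - 1 / x"
    proof -
      have "1 - exp (- x) \<noteq> 0" using True by simp
      then show ?thesis unfolding c_def using True by (simp add: field_simps)
    qed
    then have "(\<lambda>m. x powr (s - 1) * (2 * x / (x ^ 2 + (2 * pi * real (Suc m)) ^ 2))) sums (x powr (s - 1) * (1 / (1 - exp (- x)) * c x))"
      using coth_partial_fractions[OF True] by (intro sums_mult) simp
    then have 2: "(\<Sum>m. ?R m x) = ennreal (x powr (s - 1) * (1 / (1 - exp (- x)) * c x))"
      using True by (simp del: of_nat_Suc, subst suminf_ennreal2) (auto simp: sums_iff simp del: of_nat_Suc)
    show ?thesis unfolding 1 2 ..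
  next
    case False
    with that show ?thesis by simp
  qed
  have "(\<integral>\<^sup>+x. (\<Sum>n. ?L n x) \<partial>lborel) = (\<Sum>n. \<integral>\<^sup>+x. ?L n x \<partial>lborel)"
    unfolding c_def by (rule nn_integral_suminf) measurable
  also have "\<dots> = (\<Sum>n. ennreal (Gamma (s + 2) / D * t n))"
    unfolding c_def t_def D_def nn_integral_Mellin_trapezoid[OF s] ..
  also have "\<dots> = ennreal (Gamma (s + 2) / D * Re (zeta_W (of_real s)))"
    using sums_mult[OF tsum, of "Gamma (s + 2) / D"] t0 D s
    by (subst suminf_ennreal2) (auto simp: sums_iff)
  finally have 1: "(\<integral>\<^sup>+x. (\<Sum>n. ?L n x) \<partial>lborel) = ennreal (Gamma (s + 2) / D * Re (zeta_W (of_real s)))" .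
  have "(\<integral>\<^sup>+x. (\<Sum>m. ?R m x) \<partial>lborel) = (\<Sum>m. \<integral>\<^sup>+x. ?R m x \<partial>lborel)"
    by (rule nn_integral_suminf) measurable
  also have "\<dots> = (\<Sum>m. ennreal (Gamma ((s + 1) / 2) * Gamma ((1 - s) / 2) * (2 * pi * real (Suc m)) powr (s - 1)))"
  proof (rule suminf_cong)
    fix m
    show "(\<integral>\<^sup>+x. ?R m x \<partial>lborel) = ennreal (Gamma ((s + 1) / 2) * Gamma ((1 - s) / 2) * (2 * pi * real (Suc m)) powr (s - 1))"
      by (rule nn_integral_powr_over_square_add) (use s in auto)
  qed
  also have "\<dots> = ennreal (Gamma ((s + 1) / 2) * Gamma ((1 - s) / 2) * ((2 * pi) powr (s - 1) * z))"
    using sums_mult[OF z', of "Gamma ((s + 1) / 2) * Gamma ((1 - s) / 2)"] s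
    by (subst suminf_ennreal2) (auto simp: sums_iff simp del: of_nat_Suc)
  finally have 2: "(\<integral>\<^sup>+x. (\<Sum>m. ?R m x) \<partial>lborel) = ennreal (Gamma ((s + 1) / 2) * Gamma ((1 - s) / 2) * ((2 * pi) powr (s - 1) * z))" .
  have "(\<integral>\<^sup>+x. (\<Sum>n. ?L n x) \<partial>lborel) = (\<integral>\<^sup>+x. (\<Sum>m. ?R m x) \<partial>lborel)"
    using AE_lborel_singleton[of "0::real"] by (intro nn_integral_cong_AE) (use pt in \<open>auto elim: eventually_mono\<close>)
  then have "Gamma (s + 2) / D * Re (zeta_W (of_real s)) = Gamma ((s + 1) / 2) * Gamma ((1 - s) / 2) * ((2 * pi) powr (s - 1) * z)"
    unfolding 1 2 using D s z0 sums_le[OF t0 sums_zero tsum] by (subst (asm) ennreal_inj) auto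
  then show ?thesis unfolding D_def by (simp add: mult_ac)
qed

subsection \<open>Non-vanishing on the half plane of real part at least 1\<close>

text \<open>The survivors of the sieve of Eratosthenes before stage N. Sieving by one prime at a
  time yields the Euler product as a finite identity with an explicit remainder, so no infinite
  product has to be handled.\<close>

definition rough :: "nat \<Rightarrow> nat set" where
  "rough N = {n. n > 0 \<and> (\<forall>p. prime p \<and> p < N \<longrightarrow> \<not> p dvd n)}"

lemma nat_powr_summable_on:
  assumes "Re s > 1"
  shows "(\<lambda>n. norm (of_nat n powr - s :: complex)) summable_on A"
proof -
  have "summable (\<lambda>n. real n powr - Re s)" using assms by (subst summable_real_powr_iff) auto
  then have "(\<lambda>n. real n powr - Re s) summable_on UNIV"
    by (intro norm_summable_imp_summable_on) auto
  then have "(\<lambda>n. real n powr - Re s) summable_on A" by (rule summable_on_subset) auto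
  then show ?thesis by (simp add: norm_powr_real_powr)
qed

definition rough_sum :: "nat \<Rightarrow> complex \<Rightarrow> complex" where
  "rough_sum N s = (\<Sum>\<^sub>\<infinity>n\<in>rough N. of_nat n powr - s)"

text \<open>For a prime N, the members of \<open>rough N\<close> divisible by N are precisely the N
  m with m in \<open>rough N\<close>; they contribute \<open>of_nat N powr - s\<close> times the
  whole sum.\<close>

lemma rough_sum_Suc:
  assumes s: "Re s > 1"
  shows "rough_sum (Suc N) s = (if prime N then (1 - of_nat N powr - s) * rough_sum N s else rough_sum N s)"
proof (cases "prime N")
  case False
  then have "rough (Suc N) = rough N" by (auto simp: rough_def less_Suc_eq)
  with False show ?thesis by (simp add: rough_sum_def)
next
  case True
  let ?f = "\<lambda>n. of_nat n powr - s :: complex"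
  have split: "rough N = rough (Suc N) \<union> (*) N ` rough N"
  proof (intro equalityI subsetI)
    fix n assume n: "n \<in> rough N"
    show "n \<in> rough (Suc N) \<union> (*) N ` rough N"
    proof (cases "N dvd n")
      case False
      then show ?thesis using n by (auto simp: rough_def less_Suc_eq)
    next
      case True
      then obtain m where m: "n = N * m" by auto
      then have "m \<in> rough N" using n by (auto simp: rough_def)
      then show ?thesis using m by auto
    qed
  next
    fix n assume "n \<in> rough (Suc N) \<union> (*) N ` rough N"
    then show "n \<in> rough N"
    proof
      assume "n \<in> (*) N ` rough N"
      then obtain m where m: "n = N * m" "m \<in> rough N" by auto
      have "\<not> p dvd n" if p: "prime p" "p < N" for p
      proof
        assume "p dvd n"
        then have "p dvd N \<or> p dvd m" using m p by (simp add: prime_dvd_mult_iff)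
        moreover have "\<not> p dvd m" using m p by (auto simp: rough_def)
        ultimately have "p = N" using p True primes_dvd_imp_eq by blast
        then show False using p by simp
      qed
      then show ?thesis using m True by (auto simp: rough_def prime_gt_0_nat)
    qed (auto simp: rough_def)
  qed
  have disj: "rough (Suc N) \<inter> (*) N ` rough N = {}"
    using True by (auto simp: rough_def)
  have sm: "?f summable_on A" for A
    by (rule Infinite_Sum.abs_summable_summable[OF nat_powr_summable_on[OF s]])
  have "rough_sum N s = rough_sum (Suc N) s + infsum ?f ((*) N ` rough N)"
    unfolding rough_sum_def by (subst split, rule infsum_Un_disjoint[OF sm sm disj])
  also have "infsum ?f ((*) N ` rough N) = infsum (?f \<circ> (*) N) (rough N)"
    using True by (intro infsum_reindex) (auto simp: inj_on_def prime_gt_0_nat)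
  also have "\<dots> = (\<Sum>\<^sub>\<infinity>n\<in>rough N. of_nat N powr - s * ?f n)"
    by (intro infsum_cong) (simp add: powr_times_real)
  also have "\<dots> = of_nat N powr - s * rough_sum N s"
    unfolding rough_sum_def by (rule infsum_cmult_right[OF sm])
  finally show ?thesis using True by (simp add: algebra_simps)
qed

lemma rough_sum_eq_prod:
  assumes s: "Re s > 1"
  shows "rough_sum N s = (\<Prod>p | prime p \<and> p < N. 1 - of_nat p powr - s) * rough_sum 0 s"
proof (induction N)
  case (Suc N)
  have fin: "finite {p. prime p \<and> p < N}" by simp
  show ?case
  proof (cases "prime N")
    case True
    then have "{p. prime p \<and> p < Suc N} = insert N {p. prime p \<and> p < N}" by (auto simp: less_Suc_eq)
    then show ?thesis using True fin by (simp add: rough_sum_Suc[OF s] Suc.IH)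
  next
    case False
    then have "{p. prime p \<and> p < Suc N} = {p. prime p \<and> p < N}" by (auto simp: less_Suc_eq)
    then show ?thesis using False fin by (simp add: rough_sum_Suc[OF s] Suc.IH)
  qed
qed simp

text \<open>Every member of \<open>rough N\<close> other than 1 has a prime factor that is at least
  N, hence is itself at least N; what remains is bounded by a tail of a convergent series.\<close>

lemma rough_sum_tendsto:
  assumes s: "Re s > 1"
  shows "(\<lambda>N. rough_sum N s) \<longlonglongrightarrow> 1"
proof -
  let ?f = "\<lambda>n. of_nat n powr - s :: complex"
  let ?g = "\<lambda>n. real n powr - Re s"
  have sg: "summable ?g" using s by (subst summable_real_powr_iff) auto
  have sgo: "?g summable_on A" for A
    using nat_powr_summable_on[OF s, of A] by (simp add: norm_powr_real_powr)
  have "norm (rough_sum N s - 1) \<le> (\<Sum>n. ?g (n + N))" if "N \<ge> 2" for N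
  proof -
    have sub: "rough N - {1} \<subseteq> {N..}"
    proof
      fix n assume n: "n \<in> rough N - {1}"
      then obtain p where p: "prime p" "p dvd n" using prime_factor_nat by (metis DiffE singletonI)
      with n have "p \<ge> N" by (force simp: rough_def not_less)
      moreover have "p \<le> n" using p n by (intro dvd_imp_le) (auto simp: rough_def)
      ultimately show "n \<in> {N..}" by simp
    qed
    have "rough N = insert 1 (rough N - {1})" by (auto simp: rough_def)
    then have "rough_sum N s = infsum ?f (insert 1 (rough N - {1}))" unfolding rough_sum_def by simp
    also have "\<dots> = ?f 1 + infsum ?f (rough N - {1})"
      by (intro infsum_insert Infinite_Sum.abs_summable_summable[OF nat_powr_summable_on[OF s]]) auto
    finally have "rough_sum N s - 1 = infsum ?f (rough N - {1})" by simp
    also have "norm \<dots> \<le> (\<Sum>\<^sub>\<infinity>n\<in>rough N - {1}. norm (?f n))"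
      by (rule norm_infsum_bound[OF nat_powr_summable_on[OF s]])
    also have "\<dots> = infsum ?g (rough N - {1})" by (simp add: norm_powr_real_powr)
    also have "\<dots> \<le> infsum ?g {N..}"
      using sub by (intro infsum_mono_neutral sgo) auto
    also have "\<dots> = infsum (?g \<circ> (\<lambda>n. n + N)) UNIV"
    proof -
      have "{N..} = range (\<lambda>n. n + N)"
      proof (intro equalityI subsetI)
        fix m assume "m \<in> {N..}"
        then have "m = (m - N) + N" by simp
        then show "m \<in> range (\<lambda>n. n + N)" by (rule range_eqI)
      qed auto
      then show ?thesis using infsum_reindex[of "\<lambda>n. n + N" UNIV ?g] by simp
    qed
    also have "\<dots> = (\<Sum>n. ?g (n + N))"
    proof -
      have sg': "summable (\<lambda>n. ?g (n + N))" using sg by (rule summable_ignore_initial_segment)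
      then have "((\<lambda>n. ?g (n + N)) has_sum (\<Sum>n. ?g (n + N))) UNIV"
        by (intro norm_summable_imp_has_sum summable_sums) simp_all
      then show ?thesis by (simp add: infsumI o_def)
    qed
    finally show ?thesis .
  qed
  then have "\<forall>\<^sub>F N in sequentially. norm (rough_sum N s - 1) \<le> (\<Sum>n. ?g (n + N))"
    using eventually_at_top_linorder by blast
  then have "(\<lambda>N. rough_sum N s - 1) \<longlonglongrightarrow> 0"
    using suminf_exist_split2[OF sg] by (rule Lim_null_comparison)
  then show ?thesis by (simp add: LIM_zero_iff)
qed

lemma rough_sum_0_sums:
  assumes s: "Re s > 1"
  shows "(\<lambda>n. 1 / of_nat (Suc n) powr s) sums rough_sum 0 s"
proof -
  let ?f = "\<lambda>n. of_nat n powr - s :: complex"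
  have "?f summable_on {0<..}" by (rule Infinite_Sum.abs_summable_summable[OF nat_powr_summable_on[OF s]])
  then have "(?f has_sum infsum ?f {0<..}) {0<..}" by simp
  moreover have "{0<..} = range Suc" by (auto simp: image_iff gr0_conv_Suc)
  ultimately have "(?f has_sum infsum ?f {0<..}) (range Suc)" by simp
  then have "(?f \<circ> Suc has_sum infsum ?f {0<..}) UNIV"
    by (subst (asm) has_sum_reindex) auto
  then have "(?f \<circ> Suc) sums infsum ?f {0<..}" by (rule has_sum_imp_sums)
  moreover have "rough 0 = {0<..}" by (auto simp: rough_def)
  ultimately show ?thesis by (simp add: rough_sum_def o_def powr_minus field_simps)
qed

text \<open>By \<open>rough_sum_eq_prod\<close> a zero would persist in all sieved sums, which
  nevertheless tend to 1.\<close>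

lemma Dirichlet_series_nonzero:
  assumes "Re s > 1" "(\<lambda>n. 1 / of_nat (Suc n) powr s) sums z"
  shows "z \<noteq> 0"
proof
  assume "z = 0"
  moreover have "rough_sum 0 s = z" using assms rough_sum_0_sums sums_unique2 by blast
  ultimately have "rough_sum N s = 0" for N using rough_sum_eq_prod[OF assms(1), of N] by simp
  then have "(\<lambda>N. 0) \<longlonglongrightarrow> (1 :: complex)" using rough_sum_tendsto[OF assms(1)] by simp
  then show False by (simp add: LIMSEQ_const_iff)
qed

text \<open>After taking logarithms, the coefficient of r^n / n is - (3 + 4 c + (2 c^2 - 1)) = - 2
  (1 + c)^2 with c = Re (w^n). The term n = 0 is harmless because division by 0 gives 0.\<close>

lemma three_four_one:
  fixes r :: real and w :: complex
  assumes r: "0 \<le> r" "r < 1" and w: "norm w = 1"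
  shows "norm (1 - of_real r :: complex) ^ 3 * norm (1 - of_real r * w) ^ 4 * norm (1 - of_real r * w ^ 2) \<le> 1"
proof -
  have ser: "(\<lambda>n. - (Re (z ^ n) / real n)) sums ln (norm (1 - z))" if z: "norm z < 1" for z :: complex
  proof -
    have "(\<lambda>n. - ((- (- z)) ^ n) / of_nat n) sums ln (1 + (- z))"
      by (rule Ln_series') (use z in simp)
    then have "(\<lambda>n. Re (- ((- (- z)) ^ n) / of_nat n)) sums Re (ln (1 + (- z)))"
      by (rule sums_Re)
    then have "(\<lambda>n. - (Re (z ^ n) / real n)) sums Re (ln (1 + (- z)))"
      by (simp add: Re_divide_of_nat)
    moreover have "1 - z \<noteq> 0" using z by auto
    ultimately show ?thesis by (simp add: Re_Ln)
  qed
  have nr: "norm (of_real r :: complex) < 1" "norm (of_real r * w) < 1" "norm (of_real r * w ^ 2) < 1"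
    using r w by (simp_all add: norm_mult norm_power)
  then have nz: "1 - of_real r \<noteq> (0::complex)" "1 - of_real r * w \<noteq> 0" "1 - of_real r * w ^ 2 \<noteq> 0"
    by auto
  let ?L = "3 * ln (norm (1 - of_real r :: complex)) + 4 * ln (norm (1 - of_real r * w)) + ln (norm (1 - of_real r * w ^ 2))"
  have L: "(\<lambda>n. 3 * (- (Re ((of_real r :: complex) ^ n) / real n)) + 4 * (- (Re ((of_real r * w) ^ n) / real n))
      + - (Re ((of_real r * w ^ 2) ^ n) / real n)) sums ?L"
    by (intro sums_add sums_mult ser nr)
  have nonpos: "3 * (- (Re ((of_real r :: complex) ^ n) / real n)) + 4 * (- (Re ((of_real r * w) ^ n) / real n))
      + - (Re ((of_real r * w ^ 2) ^ n) / real n) \<le> 0" for n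
  proof -
    define u where "u = w ^ n"
    have u: "norm u = 1" using w by (simp add: u_def norm_power)
    then have "(Re u)^2 + (Im u)^2 = 1" using cmod_power2[of u] by simp
    then have ru: "Re (u ^ 2) = 2 * (Re u)^2 - 1" by (simp add: power2_eq_square)
    have e1: "Re ((of_real r * w) ^ n) = r ^ n * Re u" 
      by (simp add: u_def power_mult_distrib flip: of_real_power)
    have e2: "Re ((of_real r * w ^ 2) ^ n) = r ^ n * Re (u ^ 2)"
    proof -
      have "(of_real r * w ^ 2) ^ n = of_real (r ^ n) * u ^ 2"
        by (simp add: u_def power_mult_distrib power_mult[symmetric] mult.commute)
      then show ?thesis by (simp del: of_real_power)
    qed
    have e3: "Re ((of_real r :: complex) ^ n) = r ^ n" by (simp flip: of_real_power)
    have "3 * (- (Re ((of_real r :: complex) ^ n) / real n)) + 4 * (- (Re ((of_real r * w) ^ n) / real n))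
      + - (Re ((of_real r * w ^ 2) ^ n) / real n) = - (r ^ n * (2 * (1 + Re u)^2) / real n)"
      unfolding e1 e2 e3 ru by (cases "n = 0") (simp_all add: field_simps power2_eq_square)
    then show ?thesis using r by simp
  qed
  have "?L \<le> 0" by (rule sums_le[OF nonpos L sums_zero])
  moreover have "?L = ln (norm (1 - of_real r :: complex) ^ 3 * norm (1 - of_real r * w) ^ 4 * norm (1 - of_real r * w ^ 2))"
  proof -
    have "3 * ln a + 4 * ln b + ln c = ln (a ^ 3 * b ^ 4 * c)" if "a > 0" "b > 0" "c > 0" for a b c :: real
      using that by (simp add: ln_mult_pos ln_realpow)
    then show ?thesis using nz by simp
  qed
  moreover have "norm (1 - of_real r :: complex) ^ 3 * norm (1 - of_real r * w) ^ 4 * norm (1 - of_real r * w ^ 2) > 0"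
    using nz by simp
  ultimately show ?thesis by (metis ln_le_zero_iff)
qed

text \<open>The inequality holds prime by prime, so the finite product Q N is at most 1. Multiplied
  by the three series it becomes the same expression in \<open>rough_sum N\<close>, which tends to
  1; no logarithm of the Dirichlet series is taken.\<close>

lemma Dirichlet_three_four_one:
  assumes \<sigma>: "\<sigma> > 1"
    and "(\<lambda>n. 1 / of_nat (Suc n) powr of_real \<sigma>) sums z0"
    and "(\<lambda>n. 1 / of_nat (Suc n) powr (of_real \<sigma> + \<i> * of_real t)) sums z1"
    and "(\<lambda>n. 1 / of_nat (Suc n) powr (of_real \<sigma> + \<i> * of_real (2 * t))) sums z2"
  shows "norm (z0 :: complex) ^ 3 * norm (z1 :: complex) ^ 4 * norm (z2 :: complex) \<ge> (1 :: real)"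
proof -
  define s where "s = (\<lambda>k. of_real \<sigma> + \<i> * of_real (real k * t))"
  have Re: "Re (s k) > 1" for k using \<sigma> by (simp add: s_def)
  have z: "rough_sum 0 (s 0) = z0" "rough_sum 0 (s 1) = z1" "rough_sum 0 (s 2) = z2"
    using rough_sum_0_sums[OF Re[of 0]] rough_sum_0_sums[OF Re[of 1]] rough_sum_0_sums[OF Re[of 2]] assms(2-4)
    by (simp_all add: s_def sums_iff)
  define P where "P = (\<lambda>k N. \<Prod>p | prime p \<and> p < N. 1 - of_nat p powr - s k)"
  define Q where "Q = (\<lambda>N. norm (P 0 N) ^ 3 * norm (P 1 N) ^ 4 * norm (P 2 N))"
  have "Q N \<le> 1" for N
  proof -
    have "Q N = (\<Prod>p | prime p \<and> p < N. norm (1 - of_nat p powr - s 0) ^ 3 * norm (1 - of_nat p powr - s 1) ^ 4 * norm (1 - of_nat p powr - s 2))"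
      unfolding Q_def P_def by (simp add: prod_norm[symmetric] prod.distrib prod_power_distrib)
    also have "\<dots> \<le> 1"
    proof (intro prod_le_1 conjI)
      fix p assume p: "p \<in> {p. prime p \<and> p < N}"
      then have p1: "p > 1" using prime_gt_1_nat by auto
      define r w where "r = real p powr - \<sigma>" and "w = of_nat p powr - (\<i> * of_real t)"
      have e: "of_nat p powr - s 0 = of_real r" "of_nat p powr - s 1 = of_real r * w" "of_nat p powr - s 2 = of_real r * w ^ 2"
      proof -
        have r': "of_real r = of_nat p powr - complex_of_real \<sigma>"
          unfolding r_def using powr_of_real[of "real p" "-\<sigma>"] by simp
        show "of_nat p powr - s 0 = of_real r" by (simp add: s_def r')
        show "of_nat p powr - s 1 = of_real r * w"
          unfolding r' w_def using p1 by (simp add: s_def powr_def exp_add[symmetric] algebra_simps)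
        show "of_nat p powr - s 2 = of_real r * w ^ 2"
          unfolding r' w_def power2_eq_square using p1 by (simp add: s_def powr_def exp_add[symmetric] algebra_simps)
      qed
      have "r < 1" unfolding r_def using powr_less_mono[of "- \<sigma>" 0 "real p"] p1 \<sigma> by simp
      moreover have "norm w = 1" using p1 by (simp add: w_def norm_powr_real_powr)
      moreover have "r \<ge> 0" by (simp add: r_def)
      ultimately show "norm (1 - of_nat p powr - s 0) ^ 3 * norm (1 - of_nat p powr - s 1) ^ 4 * norm (1 - of_nat p powr - s 2) \<le> 1"
        unfolding e by (intro three_four_one)
    qed auto
    finally show ?thesis .
  qed
  moreover have "(\<lambda>N. norm (rough_sum N (s 0)) ^ 3 * norm (rough_sum N (s 1)) ^ 4 * norm (rough_sum N (s 2))) \<longlonglongrightarrow> norm (1::complex) ^ 3 * norm (1::complex) ^ 4 * norm (1::complex)"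
    by (intro tendsto_intros rough_sum_tendsto Re)
  moreover have "norm (rough_sum N (s 0)) ^ 3 * norm (rough_sum N (s 1)) ^ 4 * norm (rough_sum N (s 2)) = Q N * (norm z0 ^ 3 * norm z1 ^ 4 * norm z2)" for N
    unfolding rough_sum_eq_prod[OF Re, of N] z Q_def P_def by (simp add: norm_mult power_mult_distrib mult_ac)
  ultimately have lim: "(\<lambda>N. Q N * (norm z0 ^ 3 * norm z1 ^ 4 * norm z2)) \<longlonglongrightarrow> 1" by simp
  show ?thesis
  proof (rule LIMSEQ_le_const2[OF lim], intro exI allI impI)
    fix N
    have "Q N * (norm z0 ^ 3 * norm z1 ^ 4 * norm z2) \<le> 1 * (norm z0 ^ 3 * norm z1 ^ 4 * norm z2)"
      using \<open>Q N \<le> 1\<close> by (intro mult_right_mono) auto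
    then show "Q N * (norm z0 ^ 3 * norm z1 ^ 4 * norm z2) \<le> norm z0 ^ 3 * norm z1 ^ 4 * norm z2" by simp
  qed
qed

subsection \<open>The completed zeta function\<close>

text \<open>Riemann's function s (s - 1) / 2 pi^(- s / 2) Gamma (s / 2) zeta (s). The factor s - 1
  sits in \<open>zeta_W\<close> and s / 2 in Gamma (s / 2 + 1), so the expression is holomorphic on
  Re s > -1 with no removable singularities to fill.\<close>

definition xi_half :: "complex \<Rightarrow> complex" where
  "xi_half s = zeta_W s * of_real pi powr (- s / 2) * Gamma (s / 2 + 1)"

lemma zeta_W_of_real:
  assumes "s > -1"
  shows "zeta_W (of_real s) = of_real (Re (zeta_W (of_real s)))"
proof -
  have pr: "of_nat n powr - complex_of_real s \<in> \<real>" "of_nat n powr (1 - complex_of_real s) \<in> \<real>" for n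
    using powr_of_real[of "real n" "- s"] powr_of_real[of "real n" "1 - s"] by simp_all
  have "trap_term n (of_real s) \<in> \<real>" for n
    unfolding trap_term_def by (intro Reals_divide Reals_add Reals_diff Reals_mult pr) auto
  then have "(\<lambda>n. trap_term (Suc n) (of_real s)) = (\<lambda>n. of_real (Re (trap_term (Suc n) (of_real s))))"
    by (simp add: fun_eq_iff)
  moreover have "summable (\<lambda>n. Re (trap_term (Suc n) (of_real s)))"
    using summable_trap_term[of "of_real s"] assms by (intro summable_Re) auto
  ultimately have "(\<Sum>n. trap_term (Suc n) (of_real s)) = of_real (\<Sum>n. Re (trap_term (Suc n) (of_real s)))"
    by (metis suminf_of_real)
  then have "zeta_W (of_real s) \<in> \<real>"
    unfolding zeta_W_def by (auto intro!: Reals_divide Reals_add)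
  then show ?thesis by simp
qed

lemma Gamma_duplication_real:
  fixes x :: real
  assumes "-1 < x" "x < 0"
  shows "Gamma (x / 2) * Gamma ((x + 1) / 2) = 2 powr (1 - x) * sqrt pi * Gamma x"
proof -
  have "(of_real (x / 2) :: complex) \<notin> \<int>\<^sub>\<le>\<^sub>0" 
    using assms by (auto elim!: nonpos_Ints_cases simp: complex_eq_iff)
  moreover have "of_real (x / 2) + 1 / 2 \<notin> (\<int>\<^sub>\<le>\<^sub>0 :: complex set)"
    using assms by (auto elim!: nonpos_Ints_cases simp: complex_eq_iff)
  ultimately have "Gamma (of_real (x / 2)) * Gamma (of_real (x / 2) + 1 / 2) =
      exp ((1 - 2 * of_real (x / 2)) * of_real (ln 2)) * of_real (sqrt pi) * Gamma (2 * complex_of_real (x / 2))"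
    by (rule Gamma_legendre_duplication)
  also have "of_real (x / 2) + 1 / 2 = complex_of_real ((x + 1) / 2)" by (simp add: field_simps)
  also have "2 * complex_of_real (x / 2) = of_real x" by simp
  also have "exp ((1 - complex_of_real x) * of_real (ln 2)) = of_real (2 powr (1 - x))"
    by (simp add: powr_def exp_of_real[symmetric])
  finally show ?thesis
    unfolding Gamma_complex_of_real of_real_mult[symmetric] of_real_eq_iff .
qed

text \<open>The duplication formula splits Gamma s into Gamma (s / 2) and Gamma ((s + 1) / 2). The
  latter also occurs on the other side of \<open>zeta_W_functional_equation_real\<close> and
  cancels, which leaves the symmetric form.\<close>

lemma xi_half_functional_equation_real:
  fixes s :: real
  assumes s: "-1 < s" "s < 0"
  shows "xi_half (of_real s) = xi_half (1 - of_real s)"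
proof -
  have pr: "of_real pi powr complex_of_real x = of_real (pi powr x)" for x
    using powr_of_real[of pi x] by simp
  define z where "z = Re (zeta_W (of_real (1 - s))) / (- s)"
  have zW: "zeta_W (of_real (1 - s)) = of_real (- s * z)"
    using zeta_W_of_real[of "1 - s"] s by (simp add: z_def)
  have "(\<lambda>n. (of_real (1 - s) - 1) * (1 / of_nat (Suc n) powr of_real (1 - s))) sums complex_of_real (- s * z)"
    using zeta_W_sums[of "of_real (1 - s)"] s zW by simp
  moreover have "(of_real (1 - s) - 1) * (1 / of_nat (Suc n) powr of_real (1 - s)) = complex_of_real (- s * (1 / real (Suc n) powr (1 - s)))" for n
    using powr_of_real[of "real (Suc n)" "1 - s"] by (simp del: of_nat_Suc)
  ultimately have "(\<lambda>n. - s * (1 / real (Suc n) powr (1 - s))) sums (- s * z)"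
    by (simp only: sums_of_real_iff)
  then have "(\<lambda>n. 1 / real (Suc n) powr (1 - s)) sums z"
    using s by (subst (asm) sums_mult_iff) auto
  note FE = zeta_W_functional_equation_real[OF s this]
  define W where "W = Re (zeta_W (of_real s))"
  define G Gh G' where "G = Gamma (s / 2)" and "Gh = Gamma ((s + 1) / 2)" and "G' = Gamma ((1 - s) / 2)"
  have Gh: "Gh > 0" unfolding Gh_def using s by (intro Gamma_real_pos) auto
  have nI: "s \<notin> \<int>\<^sub>\<le>\<^sub>0" "s + 1 \<notin> \<int>\<^sub>\<le>\<^sub>0" "s / 2 \<notin> \<int>\<^sub>\<le>\<^sub>0" "(1 - s) / 2 \<notin> \<int>\<^sub>\<le>\<^sub>0"
    using s by (auto elim!: nonpos_Ints_cases)
  have "Gamma (s + 1 + 1) = (s + 1) * (s * Gamma s)"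
    using Gamma_plus1[OF nI(1)] Gamma_plus1[OF nI(2)] by simp
  then have "Gamma (s + 2) / ((s - 1) * s * (s + 1)) = Gamma s / (s - 1)"
    using s by (simp add: add.assoc)
  with FE have "Gamma s / (s - 1) * W = (2 * pi) powr (s - 1) * Gh * G' * z"
    unfolding W_def Gh_def G'_def by simp
  then have "Gamma s * W = (s - 1) * ((2 * pi) powr (s - 1) * Gh * G' * z)"
    using s by (simp add: field_simps)
  moreover have "Gamma s = G * Gh * 2 powr (s - 1) / sqrt pi"
  proof -
    have "G * Gh = 2 powr (1 - s) * sqrt pi * Gamma s"
      unfolding G_def Gh_def by (rule Gamma_duplication_real[OF s])
    moreover have "2 powr (1 - s) * 2 powr (s - 1) = (1::real)" by (simp add: powr_add[symmetric])
    ultimately show ?thesis by (simp add: mult_ac) 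
  qed
  ultimately have "Gh * (2 powr (s - 1) * (G * W / sqrt pi)) = Gh * (2 powr (s - 1) * ((s - 1) * (pi powr (s - 1) * G' * z)))"
    by (simp add: powr_mult mult_ac)
  then have "G * W / sqrt pi = (s - 1) * (pi powr (s - 1) * G' * z)"
    using Gh by (simp only: mult_cancel_left) auto
  then have GW: "W * G = (s - 1) * (pi powr (s - 1) * sqrt pi) * G' * z"
    by (simp add: field_simps)
  have psq: "sqrt pi = pi powr (1 / 2)" by (simp add: powr_half_sqrt)
  have "pi powr (s - 1) * sqrt pi * pi powr (- s / 2) = pi powr (- (1 - s) / 2)"
  proof -
    have "s - 1 + 1 / 2 + - s / 2 = - (1 - s) / 2" by (simp add: field_simps)
    then show ?thesis unfolding psq powr_add[symmetric] by (simp only:)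
  qed
  then have main: "W * pi powr (- s / 2) * (s / 2 * G) = - s * z * pi powr (- (1 - s) / 2) * ((1 - s) / 2 * G')"
  proof -
    have "W * pi powr (- s / 2) * (s / 2 * G) = (W * G) * pi powr (- s / 2) * (s / 2)" by simp
    also have "\<dots> = (s - 1) * (pi powr (s - 1) * sqrt pi * pi powr (- s / 2)) * G' * z * (s / 2)"
      unfolding GW by (simp add: mult_ac)
    also have "pi powr (s - 1) * sqrt pi * pi powr (- s / 2) = pi powr (- (1 - s) / 2)" by fact
    finally show ?thesis by (simp add: field_simps)
  qed
  have "xi_half (of_real s) = of_real (W * pi powr (- s / 2) * (s / 2 * G))"
  proof -
    have "zeta_W (of_real s) = of_real W" unfolding W_def using s by (intro zeta_W_of_real) auto
    moreover have "of_real pi powr (- complex_of_real s / 2) = of_real (pi powr (- s / 2))" using pr[of "- s / 2"] by simp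
    moreover have "Gamma (complex_of_real s / 2 + 1) = of_real (s / 2 * G)"
      using Gamma_complex_of_real[of "s / 2 + 1"] Gamma_plus1[OF nI(3)] by (simp add: G_def)
    ultimately show ?thesis by (simp add: xi_half_def)
  qed
  moreover have "xi_half (1 - of_real s) = of_real (- s * z * pi powr (- (1 - s) / 2) * ((1 - s) / 2 * G'))"
  proof -
    have "zeta_W (1 - of_real s) = of_real (- s * z)" using zW by simp
    moreover have "of_real pi powr (- (1 - complex_of_real s) / 2) = of_real (pi powr (- (1 - s) / 2))" using pr[of "- (1 - s) / 2"] by simp
    moreover have "Gamma ((1 - complex_of_real s) / 2 + 1) = of_real ((1 - s) / 2 * G')"
      using Gamma_complex_of_real[of "(1 - s) / 2 + 1"] Gamma_plus1[OF nI(4)] by (simp add: G'_def)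
    ultimately show ?thesis by (simp only: xi_half_def of_real_mult)
  qed
  ultimately show ?thesis using main by (simp only:)
qed

lemma Gamma_half_plus_one_not_pole: "Re s > -2 \<Longrightarrow> s / 2 + 1 \<notin> \<int>\<^sub>\<le>\<^sub>0"
  by (auto elim!: nonpos_Ints_cases simp: complex_eq_iff)

lemma xi_half_holomorphic: "xi_half holomorphic_on {s. Re s > -1}"
  unfolding xi_half_def
  by (intro holomorphic_intros zeta_W_holomorphic) (simp_all add: Gamma_half_plus_one_not_pole)

text \<open>The strip -1 < Re s < 2 is symmetric under reflection and lies where both sides are
  holomorphic; the real interval (-1, 0), where they agree, accumulates inside it.\<close>

lemma xi_half_functional_equation:
  assumes "-1 < Re s" "Re s < 2"
  shows "xi_half s = xi_half (1 - s)"
proof -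
  let ?S = "{s. Re s > -1} \<inter> {s. Re s < 2}"
  have op: "open ?S" by (intro open_Int open_halfspace_Re_gt open_halfspace_Re_lt)
  have "convex ?S" by (intro convex_Int convex_halfspace_Re_gt convex_halfspace_Re_lt)
  then have con: "connected ?S" by (rule convex_connected)
  have hol: "(\<lambda>s. xi_half s - xi_half (1 - s)) holomorphic_on ?S"
  proof (rule holomorphic_on_diff)
    show "xi_half holomorphic_on ?S" by (rule holomorphic_on_subset[OF xi_half_holomorphic]) auto
    have "(xi_half \<circ> (\<lambda>s. 1 - s)) holomorphic_on ?S"
      by (rule holomorphic_on_compose_gen[OF _ xi_half_holomorphic]) (auto intro!: holomorphic_intros)
    then show "(\<lambda>s. xi_half (1 - s)) holomorphic_on ?S" by (simp add: o_def)
  qed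
  have "xi_half s - xi_half (1 - s) = 0"
  proof (rule analytic_continuation[OF hol op con, of "of_real ` {-1<..<0}" "of_real (-1/2)"])
    show "complex_of_real (-1/2) islimpt of_real ` {-1<..<0}"
    proof (rule islimpt_approachable[THEN iffD2], intro allI impI)
      fix e :: real assume e: "e > 0"
      define d where "d = min (e / 2) (1 / 4)"
      have d: "0 < d" "d < e" "d \<le> 1/4" using e by (auto simp: d_def)
      show "\<exists>x'\<in>of_real ` {-1<..<0}. x' \<noteq> complex_of_real (-1/2) \<and> dist x' (complex_of_real (-1/2)) < e"
        using d by (intro bexI[of _ "of_real (-1/2 + d)"]) (auto simp: dist_real_def simp del: of_real_add of_real_diff of_real_minus of_real_divide intro!: imageI)
    qed
    show "xi_half z - xi_half (1 - z) = 0" if "z \<in> of_real ` {-1<..<0}" for z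
      using that xi_half_functional_equation_real by force
  qed (use assms in auto)
  then show ?thesis by simp
qed

definition xi :: "complex \<Rightarrow> complex" where
  "xi s = (if Re s > -1 then xi_half s else xi_half (1 - s))"

lemma xi_functional_equation: "xi (1 - s) = xi s"
  using xi_half_functional_equation[of s] by (auto simp: xi_def)

lemma xi_holomorphic: "xi holomorphic_on A"
proof -
  have "xi holomorphic_on ({s. Re s > -1} \<union> {s. Re s < 2})"
  proof (intro holomorphic_on_Un open_halfspace_Re_gt open_halfspace_Re_lt)
    show "xi holomorphic_on {s. Re s > -1}"
      by (rule holomorphic_transform[OF xi_half_holomorphic]) (simp add: xi_def)
    have "(xi_half \<circ> (\<lambda>s. 1 - s)) holomorphic_on {s. Re s < 2}"
      by (rule holomorphic_on_compose_gen[OF _ xi_half_holomorphic]) (auto intro!: holomorphic_intros)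
    then show "xi holomorphic_on {s. Re s < 2}"
    proof (rule holomorphic_transform)
      fix s :: complex assume "s \<in> {s. Re s < 2}"
      then show "(xi_half \<circ> (\<lambda>s. 1 - s)) s = xi s"
        using xi_half_functional_equation[of s] by (simp add: xi_def)
    qed
  qed
  moreover have "{s. Re s > -1} \<union> {s. Re s < 2} = UNIV" by auto
  ultimately show ?thesis using holomorphic_on_subset by (metis subset_UNIV)
qed

section \<open>Identification of the zeta function and its zeros through xi\<close>

lemma zeta_eqI:
  assumes "f holomorphic_on (- {1})" "\<And>s. Re s > 1 \<Longrightarrow> (\<lambda>n. 1 / of_nat (Suc n) powr s) sums f s" "f 1 = 0"
  shows "zeta = f"
  unfolding zeta_def
proof (rule the_equality)
  fix g :: "complex \<Rightarrow> complex"
  assume g: "g holomorphic_on - {1} \<and> (\<forall>s. 1 < Re s \<longrightarrow> (\<lambda>n. 1 / of_nat (Suc n) powr s) sums g s) \<and> g 1 = 0"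
  show "g = f"
  proof
    fix s show "g s = f s"
    proof (cases "s = 1")
      case False
      show ?thesis
      proof (rule analytic_continuation_open[of "{s. Re s > 1}" "- {1}" g f])
        show "{s. Re s > 1} \<noteq> {}" by (auto intro: exI[of _ 2])
        show "connected (- {1 :: complex})" by (rule connected_punctured_universe) simp
        show "g z = f z" if "z \<in> {s. Re s > 1}" for z
          using that g assms(2) sums_unique2 by blast
      qed (use g assms False in \<open>auto intro: open_halfspace_Re_gt\<close>)
    qed (use g assms in auto)
  qed
qed (use assms in auto)

text \<open>Dividing by Gamma is written as multiplication by the entire function
  \<open>rGamma\<close>, so that the formula is visibly holomorphic off 1, also at the trivial
  zeros. The value at 1 is patched to the convention in the definition of
  \<open>zeta\<close>.\<close>

lemma zeta_eq_xi:
  "zeta = (\<lambda>s. if s = 1 then 0 else xi s * (of_real pi powr (s / 2) * rGamma (s / 2 + 1) / (s - 1)))"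
proof (rule zeta_eqI)
  have "(\<lambda>s. xi s * (of_real pi powr (s / 2) * rGamma (s / 2 + 1) / (s - 1))) holomorphic_on - {1}"
    by (intro holomorphic_intros xi_holomorphic) auto
  then show "(\<lambda>s. if s = 1 then 0 else xi s * (of_real pi powr (s / 2) * rGamma (s / 2 + 1) / (s - 1))) holomorphic_on - {1}"
    by (rule holomorphic_transform) auto
next
  fix s :: complex assume s: "Re s > 1"
  then have s1: "s \<noteq> 1" by auto
  have "of_real pi powr (- s / 2) * of_real pi powr (s / 2) = (1 :: complex)"
    by (simp add: powr_add[symmetric])
  moreover have "Gamma (s / 2 + 1) * rGamma (s / 2 + 1) = 1"
    using Gamma_half_plus_one_not_pole[of s] s by (simp add: rGamma_inverse_Gamma Gamma_nonzero)
  ultimately have "xi s * (of_real pi powr (s / 2) * rGamma (s / 2 + 1) / (s - 1)) = zeta_W s / (s - 1)"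
    using s by (simp add: xi_def xi_half_def mult_ac)
  moreover have "(\<lambda>n. ((s - 1) * (1 / of_nat (Suc n) powr s)) / (s - 1)) sums (zeta_W s / (s - 1))"
    by (rule sums_divide[OF zeta_W_sums[OF s]])
  ultimately show "(\<lambda>n. 1 / of_nat (Suc n) powr s) sums (if s = 1 then 0 else xi s * (of_real pi powr (s / 2) * rGamma (s / 2 + 1) / (s - 1)))"
    using s1 by simp
qed simp

lemma zeta_factor_nonzero:
  assumes "Re s > -2" "s \<noteq> 1"
  shows "of_real pi powr (s / 2) * rGamma (s / 2 + 1) / (s - 1) \<noteq> 0"
  using assms Gamma_half_plus_one_not_pole[of s] by (simp add: rGamma_eq_zero_iff)

lemma zeta_W_1: "zeta_W 1 = 1"
  by (simp add: zeta_W_def trap_term_def del: of_nat_Suc)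

lemma xi_1_nonzero: "xi 1 \<noteq> 0"
  using Gamma_half_plus_one_not_pole[of 1] by (simp add: xi_def xi_half_def zeta_W_1 Gamma_eq_zero_iff)

text \<open>Inside the strip \<open>zeta\<close> and \<open>xi\<close> differ by an analytic factor
  without zeros, of order 0. This transfers the multiplicities in \<open>k_partial\<close>, which
  are orders of \<open>zeta\<close>, to \<open>xi\<close>.\<close>

lemma zorder_zeta_eq_xi:
  assumes s: "0 < Re s" "Re s < 1"
  shows "zorder zeta s = zorder xi s" "zeta s = 0 \<longleftrightarrow> xi s = 0"
proof -
  let ?g = "\<lambda>s. of_real pi powr (s / 2) * rGamma (s / 2 + 1) / (s - 1)"
  have s1: "s \<noteq> 1" using s by auto
  have g0: "?g s \<noteq> 0" using zeta_factor_nonzero[of s] s s1 by simp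
  show "zeta s = 0 \<longleftrightarrow> xi s = 0" using g0 s1 by (simp add: zeta_eq_xi)
  have gan: "?g analytic_on {s}"
    by (intro analytic_intros) (use s1 in \<open>auto simp: pi_gt_zero[unfolded not_le[symmetric]]\<close>)
  have xan: "xi analytic_on {s}" using xi_holomorphic[of UNIV] by (simp add: analytic_on_holomorphic) blast
  have ev1: "\<forall>\<^sub>F z in at s. z \<noteq> 1" using s1 by (intro eventually_neq_at_within)
  have ev2: "\<forall>\<^sub>F z in at s. xi z \<noteq> 0"
    using xi_1_nonzero non_zero_neighbour_alt[OF xi_holomorphic open_UNIV connected_UNIV] by (auto elim: eventually_mono)
  have ev3: "\<forall>\<^sub>F z in at s. ?g z \<noteq> 0"
    using gan g0 by (intro tendsto_imp_eventually_ne[of ?g "?g s"]) (auto dest!: analytic_at_imp_isCont simp: isCont_def)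
  have "zorder zeta s = zorder (\<lambda>z. xi z * ?g z) s"
    by (rule zorder_cong) (use ev1 in \<open>auto elim!: eventually_mono simp: zeta_eq_xi\<close>)
  also have "\<dots> = zorder xi s + zorder ?g s"
    by (rule zorder_times_analytic[OF xan gan]) (use ev2 ev3 in eventually_elim, simp)
  also have "zorder ?g s = 0" by (rule zorder_eq_0I[OF gan g0])
  finally show "zorder zeta s = zorder xi s" by simp
qed

text \<open>At \<open>s = 1 / 2\<close> a telescoping bound keeps the trapezoidal corrections above \<open>- 1 / 4\<close>, while the leading
  term of \<open>zeta_W\<close> is \<open>3 / 4\<close>.\<close>

lemma xi_at_half_nonzero: "xi (1 / 2) \<noteq> 0"
proof -
  define t where "t = (\<lambda>n. Re (trap_term n (1 / 2)))"
  define q where "q = (\<lambda>n. real n powr - (1 / 2))"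
  have te: "t n = - (q n + q (Suc n)) / 4 + sqrt (Suc n) - sqrt n" for n
  proof -
    have "of_nat k powr complex_of_real x = of_real (real k powr x)" for k x
      using powr_of_real[of "real k" x] by simp
    from this[of _ "1/2"] this[of _ "-1/2"]
    have "of_nat k powr (1/2) = complex_of_real (sqrt k)" "of_nat k powr - (1/2) = complex_of_real (q k)" for k
      by (simp_all add: q_def powr_half_sqrt)
    then show ?thesis by (simp add: t_def trap_term_def field_simps del: of_nat_Suc)
  qed
  \<comment> \<open>With x and y the square roots of n + 1 and n + 2, y - x = 1 / (y + x) >= 1 / (2
    y); this replaces the average of the endpoint values by a difference, which telescopes.\<close>
  have lower: "t (Suc n) \<ge> - (q (Suc n) - q (Suc (Suc n))) / 4" for n
  proof -
    define x y where "x = sqrt (Suc n)" and "y = sqrt (Suc (Suc n))"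
    have xy: "x > 0" "y > 0" "x \<le> y" "y ^ 2 - x ^ 2 = 1" by (simp_all add: x_def y_def)
    have q: "q (Suc (Suc n)) = 1 / y" unfolding q_def y_def by (simp add: powr_minus_divide powr_half_sqrt)
    have "(y - x) * (y + x) = 1" using xy(4) by (simp add: power2_eq_square algebra_simps)
    then have "y - x = 1 / (y + x)" using xy by (simp add: field_simps)
    also have "1 / (y + x) \<ge> 1 / (2 * y)" using xy by (intro divide_left_mono) auto
    finally have "y - x \<ge> q (Suc (Suc n)) / 2" unfolding q by simp
    moreover have "t (Suc n) = - (q (Suc n) + q (Suc (Suc n))) / 4 + y - x" unfolding te x_def y_def ..
    ultimately show ?thesis by (simp add: field_simps)
  qed
  have s1: "summable (\<lambda>n. t (Suc n))" unfolding t_def by (intro summable_Re summable_trap_term) simp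
  have "(\<lambda>n. q (Suc n)) \<longlonglongrightarrow> 0"
    unfolding q_def by (intro LIMSEQ_Suc tendsto_neg_powr filterlim_real_sequentially) auto
  then have "(\<lambda>n. q (Suc n) - q (Suc (Suc n))) sums (q (Suc 0) - 0)"
    by (rule telescope_sums')
  then have "(\<lambda>n. - (q (Suc n) - q (Suc (Suc n))) / 4) sums (- (q (Suc 0) - 0) / 4)"
    by (intro sums_divide sums_minus)
  then have "(\<Sum>n. t (Suc n)) \<ge> - 1 / 4"
    using sums_le[OF lower _ summable_sums[OF s1]] by (simp add: q_def)
  moreover have "Re (zeta_W (1 / 2)) = 3 / 4 + (\<Sum>n. t (Suc n))"
    unfolding zeta_W_def t_def by (subst Re_suminf[symmetric]) (auto intro!: summable_trap_term)
  ultimately have "zeta_W (1 / 2) \<noteq> 0" by auto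
  then show ?thesis
    using Gamma_half_plus_one_not_pole[of "1/2"] by (simp add: xi_def xi_half_def Gamma_eq_zero_iff)
qed

text \<open>For Re s > 1 the Euler product decides. On Re s = 1, a zero at s would enter the 3-4-1
  product to the fourth power against the third power of the simple pole at 1; the product would
  tend to 0 although it is at least 1.\<close>

lemma zeta_W_eq_0_imp:
  assumes "zeta_W s = 0" "Re s > -1"
  shows "Re s < 1"
proof (rule ccontr)
  assume "\<not> Re s < 1"
  then consider "Re s > 1" | "Re s = 1" by linarith
  then show False
  proof cases
    case 1
    then have s1: "s \<noteq> 1" by auto
    have "(\<lambda>n. ((s - 1) * (1 / of_nat (Suc n) powr s)) / (s - 1)) sums (zeta_W s / (s - 1))"
      by (rule sums_divide[OF zeta_W_sums[OF 1]])
    then have "(\<lambda>n. 1 / of_nat (Suc n) powr s) sums 0" using s1 assms by simp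
    then show False using Dirichlet_series_nonzero[OF 1] by blast
  next
    case 2
    define t where "t = Im s"
    have s: "s = 1 + \<i> * of_real t" using 2 by (simp add: t_def complex_eq_iff)
    \<comment> \<open>At the pole itself \<open>zeta_W\<close> has the value 1, so the three points
      1, 1 + i t and 1 + 2 i t are distinct.\<close>
    have t: "t \<noteq> 0" using assms zeta_W_1 s by auto
    define W0 W1 W2 where "W0 = (\<lambda>e::real. zeta_W (1 + of_real e))"
      and "W1 = (\<lambda>e::real. zeta_W (s + of_real e))" and "W2 = (\<lambda>e::real. zeta_W (1 + \<i> * of_real (2 * t) + of_real e))"
    have diff: "zeta_W field_differentiable at z" if "Re z > -1" for z
      using zeta_W_holomorphic that holomorphic_on_imp_differentiable_at open_halfspace_Re_gt by blast
    then have cont: "isCont zeta_W z" if "Re z > -1" for z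
      using that field_differentiable_imp_continuous_at by blast
    have lim: "((\<lambda>e::real. zeta_W (z + of_real e)) \<longlongrightarrow> zeta_W z) (at_right 0)" if "Re z > -1" for z
    proof (rule isCont_tendsto_compose[OF cont[OF that]])
      have "((\<lambda>e::real. z + of_real e) \<longlongrightarrow> z + of_real 0) (at_right 0)" by (intro tendsto_intros)
      then show "((\<lambda>e::real. z + of_real e) \<longlongrightarrow> z) (at_right 0)" by simp
    qed
    obtain L where "(zeta_W has_field_derivative L) (at s)"
      using diff[of s] s by (auto simp: field_differentiable_def)
    then have "((\<lambda>h. (zeta_W (s + h) - zeta_W s) / h) \<longlongrightarrow> L) (at 0)" by (simp add: DERIV_def)
    moreover have "filterlim complex_of_real (at 0) (at_right 0)"
    proof (rule filterlim_atI)
      have "((\<lambda>e::real. complex_of_real e) \<longlongrightarrow> of_real 0) (at_right 0)" by (intro tendsto_intros)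
      then show "(complex_of_real \<longlongrightarrow> 0) (at_right 0)" by simp
      show "\<forall>\<^sub>F e in at_right 0. complex_of_real e \<noteq> 0"
        by (simp add: eventually_at_right_less[THEN eventually_mono])
    qed
    ultimately have limL: "((\<lambda>e::real. W1 e / of_real e) \<longlongrightarrow> L) (at_right 0)"
      unfolding W1_def using assms by (auto dest: filterlim_compose)
    \<comment> \<open>The 3-4-1 product at 1 + e. Writing \<open>W1 e\<close> as e times its
      difference quotient gives e^4, the pole gives e^-3, and the single e left over forces the
      limit 0.\<close>
    define Q where "Q = (\<lambda>e. norm (W0 e) ^ 3 * (norm (W1 e / of_real e) ^ 4 * e) * norm (W2 e) /
       (norm (\<i> * of_real t + of_real e) ^ 4 * norm (\<i> * of_real (2 * t) + of_real e)))"
    have "(Q \<longlongrightarrow> norm (zeta_W 1) ^ 3 * (norm L ^ 4 * 0) * norm (zeta_W (1 + \<i> * of_real (2 * t))) /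
       (norm (\<i> * of_real t + of_real 0) ^ 4 * norm (\<i> * of_real (2 * t) + of_real 0))) (at_right 0)"
      unfolding Q_def W0_def W2_def
      by (intro tendsto_intros lim limL) (use t in auto)
    then have Q0: "(Q \<longlongrightarrow> 0) (at_right 0)" by simp
    have "Q e \<ge> 1" if e: "e > 0" for e
    proof -
      have ser: "(\<lambda>n. 1 / of_nat (Suc n) powr z) sums (zeta_W z / (z - 1))" if "Re z > 1" for z
      proof -
        have "z \<noteq> 1" using that by auto
        then show ?thesis using sums_divide[OF zeta_W_sums[OF that], of "z - 1"] by simp
      qed
      have "1 \<le> norm (zeta_W (of_real (1 + e)) / (of_real (1 + e) - 1)) ^ 3
         * norm (zeta_W (of_real (1 + e) + \<i> * of_real t) / (of_real (1 + e) + \<i> * of_real t - 1)) ^ 4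
         * norm (zeta_W (of_real (1 + e) + \<i> * of_real (2 * t)) / (of_real (1 + e) + \<i> * of_real (2 * t) - 1))"
        by (rule Dirichlet_three_four_one[of "1 + e" _ t]) (use e in \<open>auto intro!: ser simp del: of_real_add of_nat_Suc\<close>)
      also have "\<dots> = Q e"
      proof -
        have "of_real (1 + e) = 1 + complex_of_real e" "of_real (1 + e) + \<i> * of_real t = s + of_real e"
          "of_real (1 + e) + \<i> * of_real (2 * t) = 1 + \<i> * of_real (2 * t) + complex_of_real e"
          "s + of_real e - 1 = \<i> * of_real t + of_real e"
          using s by simp_all
        moreover have "1 + \<i> * of_real (2 * t) + complex_of_real e - 1 = \<i> * of_real (2 * t) + of_real e" "1 + complex_of_real e - 1 = of_real e" by simp_all
        ultimately show ?thesis unfolding Q_def W0_def W1_def W2_def using e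
          by (simp only: norm_divide norm_of_real power_divide) (simp add: field_simps power_def)
      qed
      finally show ?thesis .
    qed
    then have "\<forall>\<^sub>F e in at_right 0. 1 \<le> Q e" 
      using eventually_at_right_less[of 0] by (auto elim: eventually_mono)
    then have "1 \<le> (0::real)" by (rule tendsto_lowerbound[OF Q0]) simp
    then show False by simp
  qed
qed

text \<open>The left bound is the right bound reflected by the functional equation.\<close>

lemma xi_eq_0_imp:
  assumes "xi s = 0"
  shows "0 < Re s" "Re s < 1"
proof -
  have *: "Re s < 1" if s: "xi s = 0" "Re s > -1" for s
  proof -
    have "zeta_W s = 0" using s Gamma_half_plus_one_not_pole[of s]
      by (simp add: xi_def xi_half_def Gamma_eq_zero_iff)
    then show ?thesis using zeta_W_eq_0_imp s by blast
  qed
  show "Re s < 1" using *[OF assms] by linarith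
  show "0 < Re s" using *[of "1 - s"] assms by (cases "Re s < 2") (auto simp: xi_functional_equation)
qed

subsection \<open>Partial fractions of even entire functions\<close>

text \<open>The map u / (2 A - u) sends the half plane Re u < A into the unit disc and fixes 0, so
  the Schwarz lemma bounds its composition with G by 1/2 on the half ball; solving for G gives the
  constant 2.\<close>

lemma Borel_Caratheodory_ball:
  assumes hol: "G holomorphic_on ball 0 R" and R: "R > 0" and G0: "G 0 = 0"
    and Re: "\<And>w. w \<in> ball 0 R \<Longrightarrow> Re (G w) < A"
    and w: "norm w \<le> R / 2"
  shows "norm (G w) \<le> 2 * A"
proof -
  have A: "A > 0" using Re[of 0] G0 R by simp
  define \<phi> where "\<phi> = (\<lambda>z. G (of_real R * z) / (2 * of_real A - G (of_real R * z)))"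
  have inb: "of_real R * z \<in> ball 0 R" if "norm z < 1" for z :: complex
    using that R by (simp add: norm_mult)
  have lt: "norm u < norm (2 * of_real A - u)" if "Re u < A" for u
  proof -
    have "norm (2 * of_real A - u) ^ 2 - norm u ^ 2 = 4 * A * (A - Re u)"
      by (simp only: cmod_power2) (simp add: power2_eq_square algebra_simps)
    also have "\<dots> > 0" using A that by simp
    finally have "norm u ^ 2 < norm (2 * of_real A - u) ^ 2" by simp
    then show ?thesis by (rule power_less_imp_less_base) simp
  qed
  have nz: "2 * of_real A - G (of_real R * z) \<noteq> 0" if "norm z < 1" for z
    using lt[OF Re[OF inb[OF that]]] by (metis norm_ge_zero norm_zero not_less)
  have "\<phi> holomorphic_on ball 0 1"
  proof -
    have "(G \<circ> (\<lambda>z. of_real R * z)) holomorphic_on ball 0 1"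
      by (rule holomorphic_on_compose_gen[OF _ hol]) (use inb in \<open>auto intro!: holomorphic_intros\<close>)
    then show ?thesis unfolding \<phi>_def
      by (intro holomorphic_on_divide holomorphic_on_diff) (use nz in \<open>auto simp: o_def intro!: holomorphic_intros\<close>)
  qed
  moreover have "\<phi> 0 = 0" by (simp add: \<phi>_def G0)
  moreover have "norm (\<phi> z) < 1" if "norm z < 1" for z
    using lt[OF Re[OF inb[OF that]]] nz[OF that] by (simp add: \<phi>_def norm_divide divide_less_eq)
  moreover define z where "z = w / of_real R"
  have nz1: "norm z \<le> 1 / 2" using w R by (simp add: z_def norm_divide field_simps)
  ultimately have "norm (\<phi> z) \<le> norm z" by (intro Schwarz_Lemma(1)) auto
  with nz1 have ph: "norm (\<phi> z) \<le> 1 / 2" by simp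
  have wz: "of_real R * z = w" using R by (simp add: z_def)
  have "2 * of_real A - G w \<noteq> 0" using nz[of z] nz1 wz by simp
  then have "G w = \<phi> z * (2 * of_real A - G w)" by (simp add: \<phi>_def wz)
  then have "norm (G w) = norm (\<phi> z) * norm (2 * of_real A - G w)" by (metis norm_mult)
  also have "\<dots> \<le> 1 / 2 * (2 * A + norm (G w))"
    using ph A norm_triangle_ineq4[of "2 * of_real A" "G w"] by (intro mult_mono) (auto simp: norm_mult)
  finally show ?thesis by simp
qed

lemma has_field_derivative_prod_zero_factors:
  fixes w :: complex
  assumes "finite S" "w \<notin> S" "0 \<notin> S"
  shows "((\<lambda>z. \<Prod>\<rho>\<in>S. (1 - z / \<rho>) ^ m \<rho>) has_field_derivative
     (\<Prod>\<rho>\<in>S. (1 - w / \<rho>) ^ m \<rho>) * (\<Sum>\<rho>\<in>S. of_nat (m \<rho>) / (w - \<rho>))) (at w)"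
  using assms
proof (induction S rule: finite_induct)
  case (insert \<rho> S)
  have \<rho>: "\<rho> \<noteq> 0" "w \<noteq> \<rho>" using insert.prems by (metis insertI1)+
  then have nz: "1 - w / \<rho> \<noteq> 0" "\<rho> \<noteq> 0" "w - \<rho> \<noteq> 0" by (simp_all add: eq_divide_eq_1)
  have d1: "((\<lambda>z. (1 - z / \<rho>) ^ m \<rho>) has_field_derivative (1 - w / \<rho>) ^ m \<rho> * (of_nat (m \<rho>) / (w - \<rho>))) (at w)"
  proof -
    have "((\<lambda>z. (1 - z / \<rho>) ^ m \<rho>) has_field_derivative of_nat (m \<rho>) * (- (1 / \<rho>) * (1 - w / \<rho>) ^ (m \<rho> - 1))) (at w)"
      using \<rho> by (auto intro!: derivative_eq_intros)
    moreover have "of_nat (m \<rho>) * (- (1 / \<rho>) * (1 - w / \<rho>) ^ (m \<rho> - 1)) = (1 - w / \<rho>) ^ m \<rho> * (of_nat (m \<rho>) / (w - \<rho>))"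
    proof (cases "m \<rho>")
      case (Suc k)
      have "(1 - w / \<rho>) / (w - \<rho>) = - (1 / \<rho>)" using nz by (simp add: field_simps)
      then have "(1 - w / \<rho>) ^ Suc k * (of_nat (Suc k) / (w - \<rho>)) = of_nat (Suc k) * (- (1 / \<rho>) * (1 - w / \<rho>) ^ k)"
        by (metis (no_types, lifting) mult.assoc mult.commute power_Suc times_divide_eq_right)
      then show ?thesis using Suc by simp
    qed simp
    ultimately show ?thesis by simp
  qed
  have "((\<lambda>z. (1 - z / \<rho>) ^ m \<rho> * (\<Prod>\<rho>\<in>S. (1 - z / \<rho>) ^ m \<rho>)) has_field_derivative
     ((1 - w / \<rho>) ^ m \<rho> * (of_nat (m \<rho>) / (w - \<rho>))) * (\<Prod>\<rho>\<in>S. (1 - w / \<rho>) ^ m \<rho>)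
     + ((\<Prod>\<rho>\<in>S. (1 - w / \<rho>) ^ m \<rho>) * (\<Sum>\<rho>\<in>S. of_nat (m \<rho>) / (w - \<rho>))) * (1 - w / \<rho>) ^ m \<rho>) (at w)"
    using DERIV_mult[OF d1 insert.IH] insert.prems by simp
  then show ?case using insert.hyps by (simp add: algebra_simps)
qed simp

text \<open>The factors 1 - w / rho are normalised to 1 at 0, so that dividing them out preserves F
  0. Matching orders make the quotient free of zeros on the ball.\<close>

lemma entire_divide_zeros:
  assumes hol: "F holomorphic_on UNIV" and F0: "F 0 \<noteq> 0" and r: "r > 0"
    and S: "S = {\<rho>. F \<rho> = 0 \<and> norm \<rho> < r}" 
  obtains g where "finite S" "g holomorphic_on UNIV" "\<And>w. norm w < r \<Longrightarrow> g w \<noteq> 0"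
    "\<And>w. F w = g w * (\<Prod>\<rho>\<in>S. (1 - w / \<rho>) ^ nat (zorder F \<rho>))"
proof -
  have nc: "\<not> F constant_on UNIV \<or> (\<forall>w. F w \<noteq> 0)" using F0 by (auto simp: constant_on_def)
  have fin: "finite S"
  proof (cases "\<forall>w. F w \<noteq> 0")
    case False
    then have "finite {z \<in> cball 0 r. F z = 0}"
      using nc by (intro holomorphic_compact_finite_zeros[OF hol]) auto
    then show ?thesis unfolding S by (rule finite_subset[rotated]) auto
  qed (simp add: S)
  define m where "m = (\<lambda>\<rho>. nat (zorder F \<rho>))"
  define P where "P = (\<lambda>w. \<Prod>\<rho>\<in>S. (1 - w / \<rho>) ^ m \<rho>)"
  have S0: "\<rho> \<noteq> 0" if "\<rho> \<in> S" for \<rho> using that F0 by (auto simp: S)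
  have Phol: "P holomorphic_on A" for A unfolding P_def by (intro holomorphic_intros) (use S0 in auto)
  have P_nz: "P w \<noteq> 0" if "w \<notin> S" for w
    unfolding P_def using that S0 fin by (auto simp: prod_zero_iff field_simps)
  have ev: "\<forall>\<^sub>F z in at w. F z \<noteq> 0" for w
    using non_zero_neighbour_alt[OF hol open_UNIV connected_UNIV, of w 0] F0 by (auto elim: eventually_mono)
  have Fan: "F analytic_on {w}" for w 
    by (rule analytic_on_subset[of _ UNIV]) (use hol in \<open>simp_all add: analytic_on_open\<close>)
  have m_pos: "zorder F \<rho> > 0" if "\<rho> \<in> S" for \<rho>
  proof -
    have "\<not> (\<forall>\<^sub>F z in at \<rho>. F z = 0)"
    proof
      assume "\<forall>\<^sub>F z in at \<rho>. F z = 0"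
      with ev[of \<rho>] have "\<forall>\<^sub>F z in at \<rho>. False" by eventually_elim simp
      then show False by simp
    qed
    then have "\<exists>\<^sub>F z in at \<rho>. F z \<noteq> 0" by (simp add: frequently_def)
    then show ?thesis using zorder_pos_iff'[OF Fan] that by (simp add: S)
  qed
  have zP: "zorder P \<rho> = zorder F \<rho>" if "\<rho> \<in> S" for \<rho>
  proof (rule zorder_eqI[of UNIV])
    show "(\<lambda>w. (- 1 / \<rho>) ^ m \<rho> * (\<Prod>\<rho>\<in>S - {\<rho>}. (1 - w / \<rho>) ^ m \<rho>)) holomorphic_on UNIV"
      by (intro holomorphic_intros) (use S0 in auto)
    show "(- 1 / \<rho>) ^ m \<rho> * (\<Prod>\<rho>'\<in>S - {\<rho>}. (1 - \<rho> / \<rho>') ^ m \<rho>') \<noteq> 0"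
      using fin S0 that by (auto simp: prod_zero_iff field_simps)
    fix w assume "w \<noteq> \<rho>"
    have "P w = (1 - w / \<rho>) ^ m \<rho> * (\<Prod>\<rho>\<in>S - {\<rho>}. (1 - w / \<rho>) ^ m \<rho>)"
      unfolding P_def by (rule prod.remove[OF fin that])
    also have "1 - w / \<rho> = (- 1 / \<rho>) * (w - \<rho>)" using S0[OF that] by (simp add: field_simps)
    also have "\<dots> ^ m \<rho> = (- 1 / \<rho>) ^ m \<rho> * (w - \<rho>) powi (zorder F \<rho>)"
      unfolding power_mult_distrib using m_pos[OF that] by (simp add: power_int_def m_def)
    finally show "P w = (- 1 / \<rho>) ^ m \<rho> * (\<Prod>\<rho>\<in>S - {\<rho>}. (1 - w / \<rho>) ^ m \<rho>) * (w - \<rho>) powi (zorder F \<rho>)"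
      by (simp only: mult_ac)
  qed auto
  have P_iff: "P w = 0 \<longleftrightarrow> w \<in> S" for w
  proof
    assume "w \<in> S"
    then show "P w = 0" unfolding P_def using fin S0 m_pos[of w] by (auto simp: prod_zero_iff m_def intro!: bexI[of _ w])
  qed (use P_nz in blast)
  obtain h where h: "h holomorphic_on ball 0 r" "\<And>z. z \<in> ball 0 r \<Longrightarrow> h z \<noteq> 0" "\<And>z. z \<in> ball 0 r \<Longrightarrow> F z = h z * P z"
  proof (rule holomorphic_zorder_factorization[of F "ball 0 r" P])
    show "F holomorphic_on ball 0 r" using hol by (rule holomorphic_on_subset) auto
    show "P z = 0 \<longleftrightarrow> F z = 0" if "z \<in> ball 0 r" for z using that by (auto simp: P_iff S)
    show "zorder P z = zorder F z" if z: "z \<in> ball 0 r" for z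
    proof (cases "z \<in> S")
      case False
      then have "F z \<noteq> 0" using z by (auto simp: S)
      moreover have "P analytic_on {z}" using Phol by (meson analytic_at open_UNIV UNIV_I)
      ultimately show ?thesis using zorder_eq_0I[of P z] P_nz[OF False] zorder_eq_0I[OF Fan, of z] by simp
    qed (rule zP)
  qed (auto intro: Phol)
  \<comment> \<open>Plain division fails only on S, which lies inside the ball, where the local
    factor h takes over; on the overlap the two agree.\<close>
  define g where "g = (\<lambda>w. if w \<in> ball 0 r then h w else F w / P w)"
  have "g holomorphic_on ball 0 r \<union> - S"
  proof (rule holomorphic_on_Un)
    show "g holomorphic_on ball 0 r" by (rule holomorphic_transform[OF h(1)]) (simp add: g_def)
    have "(\<lambda>w. F w / P w) holomorphic_on - S"
      by (intro holomorphic_on_divide Phol holomorphic_on_subset[OF hol]) (use P_nz in auto)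
    then show "g holomorphic_on - S"
      by (rule holomorphic_transform) (use h(3) P_nz in \<open>auto simp: g_def\<close>)
    show "open (- S)" using fin by (simp add: finite_imp_closed open_Compl)
  qed auto
  moreover have "ball 0 r \<union> - S = UNIV" by (auto simp: S)
  ultimately have "g holomorphic_on UNIV" by simp
  moreover have "g w \<noteq> 0" if "norm w < r" for w using that h(2) by (simp add: g_def)
  moreover have "F w = g w * P w" for w
    using h(3)[of w] P_nz[of w] by (auto simp: g_def S)
  ultimately show ?thesis using that[of g] fin unfolding P_def m_def by blast
qed

text \<open>A form of Landau's lemma. On the circle of radius 2 R every factor 1 - w / rho with norm
  rho < R has modulus at least 1, so the maximum principle passes the bound on F to the zero-free
  quotient. Its logarithm G is bounded by Borel-Caratheodory, and the second derivative of G by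
  Cauchy's estimate. Comparing w with 0 uses that second derivative, which is why R^2 appears and
  growth of order below 2 will be enough.\<close>

lemma log_deriv_partial_fraction_bound:
  assumes hol: "F holomorphic_on UNIV" and F0: "F 0 \<noteq> 0" and R: "R > 0"
    and bd: "\<And>w. norm w \<le> 2 * R \<Longrightarrow> norm (F w) \<le> M * norm (F 0)"
    and w: "norm w \<le> R / 4" "F w \<noteq> 0"
    and S: "S = {\<rho>. F \<rho> = 0 \<and> norm \<rho> < R}" 
  shows "norm ((deriv F w / F w - (\<Sum>\<rho>\<in>S. of_nat (nat (zorder F \<rho>)) / (w - \<rho>))) -
     (deriv F 0 / F 0 - (\<Sum>\<rho>\<in>S. of_nat (nat (zorder F \<rho>)) / (0 - \<rho>)))) \<le> 64 * (ln M + 1) / R ^ 2 * norm w"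
proof -
  obtain g where fin: "finite S" and g: "g holomorphic_on UNIV" "\<And>w. norm w < R \<Longrightarrow> g w \<noteq> 0"
    "\<And>w. F w = g w * (\<Prod>\<rho>\<in>S. (1 - w / \<rho>) ^ nat (zorder F \<rho>))"
    using entire_divide_zeros[OF hol F0 R S] by blast
  define P where "P = (\<lambda>w. \<Prod>\<rho>\<in>S. (1 - w / \<rho>) ^ nat (zorder F \<rho>))"
  have FP: "F w = g w * P w" for w using g(3) by (simp add: P_def)
  have M1: "M \<ge> 1" using bd[of 0] F0 R by simp
  have gF: "g 0 = F 0" using FP[of 0] by (simp add: P_def)
  have gb: "norm (g w) \<le> M * norm (F 0)" if "norm w < 2 * R" for w
  proof (rule maximum_modulus_frontier[of g "cball 0 (2 * R)"])
    show "continuous_on (closure (cball 0 (2 * R))) g" "g holomorphic_on interior (cball 0 (2 * R))"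
      using g(1) holomorphic_on_imp_continuous_on holomorphic_on_subset by blast+
    fix z assume "z \<in> frontier (cball (0::complex) (2 * R))"
    then have z: "norm z = 2 * R" using R by (simp add: frontier_cball)
    have "norm (P z) \<ge> 1"
    proof -
      have "norm ((1 - z / \<rho>) ^ nat (zorder F \<rho>)) \<ge> 1" if "\<rho> \<in> S" for \<rho>
      proof -
        have r: "norm \<rho> < R" "norm \<rho> > 0" using that F0 by (auto simp: S)
        have "norm (z / \<rho>) \<ge> 2" using r z by (simp add: norm_divide field_simps)
        then have "norm (1 - z / \<rho>) \<ge> 1" using norm_triangle_ineq3[of 1 "z / \<rho>"] by simp
        then show ?thesis by (simp add: norm_power one_le_power)
      qed
      then show ?thesis unfolding P_def prod_norm[symmetric] by (intro prod_ge_1) auto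
    qed
    then have "norm (g z) * 1 \<le> norm (g z) * norm (P z)" by (intro mult_left_mono) auto
    also have "\<dots> = norm (F z)" by (simp add: FP norm_mult)
    also have "\<dots> \<le> M * norm (F 0)" using z by (intro bd) simp
    finally show "norm (g z) \<le> M * norm (F 0)" by simp
  qed (use that in auto)
  obtain G where G: "G holomorphic_on ball 0 R" "\<And>z. z \<in> ball 0 R \<Longrightarrow> exp (G z) = g z / F 0" "G 0 = 0"
  proof -
    have h: "(\<lambda>z. g z / F 0) holomorphic_on ball 0 R"
      using g(1) F0 by (intro holomorphic_on_divide holomorphic_intros) (auto intro: holomorphic_on_subset)
    obtain H where H: "H holomorphic_on ball 0 R" "\<And>x. x \<in> ball 0 R \<Longrightarrow> exp (H x) = g x / F 0"
      using holomorphic_logarithm_exists[OF convex_ball open_ball h, of 0] g(2) F0 R by (metis divide_eq_0_iff dist_0_norm mem_ball centre_in_ball)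
    have "exp (H 0) = 1" using H(2)[of 0] R gF F0 by simp
    then show ?thesis using H R by (intro that[of "\<lambda>z. H z - H 0"]) (auto intro!: holomorphic_intros simp: exp_diff)
  qed
  \<comment> \<open>The summand 1 makes the bound on Re G strict and keeps A positive when M =
    1.\<close>
  define A where "A = ln M + 1"
  have A: "A > 0" using M1 by (simp add: A_def add_nonneg_pos)
  have ReG: "Re (G z) < A" if "z \<in> ball 0 R" for z
  proof -
    have "exp (Re (G z)) = norm (g z / F 0)" using G(2)[OF that] by (metis norm_exp_eq_Re)
    also have "\<dots> \<le> M" using gb[of z] that F0 R by (simp add: norm_divide field_simps)
    finally have "Re (G z) \<le> ln M" using M1 by (simp add: ln_ge_iff)
    then show ?thesis by (simp add: A_def)
  qed
  have Gb: "norm (G z) \<le> 2 * A" if "norm z \<le> R / 2" for z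
    by (rule Borel_Caratheodory_ball[OF G(1) R G(3) ReG that])
  \<comment> \<open>Cauchy's estimate on discs of radius R / 4, which stay in the half ball where G
    is at most 2 A: 2 * (2 A) * 16 = 64 A.\<close>
  have d2: "norm (deriv (deriv G) z) \<le> 64 * A / R ^ 2" if z: "z \<in> cball 0 (R / 4)" for z
  proof -
    have sub: "cball z (R / 4) \<subseteq> ball 0 R"
    proof
      fix u assume "u \<in> cball z (R / 4)"
      then show "u \<in> ball 0 R" using z R norm_triangle_ineq2[of u z] by (auto simp: dist_norm norm_minus_commute)
    qed
    have "norm ((deriv ^^ 2) G z) \<le> fact 2 * (2 * A) / (R / 4) ^ 2"
    proof (rule Cauchy_inequality)
      show "G holomorphic_on ball z (R / 4)" using G(1) sub by (meson ball_subset_cball holomorphic_on_subset order_trans)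
      show "continuous_on (cball z (R / 4)) G" using G(1) sub holomorphic_on_imp_continuous_on continuous_on_subset by blast
      fix x assume "norm (z - x) = R / 4"
      then have "norm x \<le> R / 2" using z norm_triangle_ineq2[of x z] by (simp add: norm_minus_commute)
      then show "norm (G x) \<le> 2 * A" by (rule Gb)
    qed (use R in simp)
    then show ?thesis by (simp add: numeral_2_eq_2 power2_eq_square)
  qed
  have G1hol: "deriv G holomorphic_on ball 0 R" using G(1) by (intro holomorphic_deriv) auto
  have bound: "norm (deriv G w - deriv G 0) \<le> 64 * A / R ^ 2 * norm (w - 0)"
  proof (rule field_differentiable_bound[of "cball 0 (R / 4)" "deriv G" "deriv (deriv G)"])
    fix z assume z: "z \<in> cball (0::complex) (R / 4)"
    then have "z \<in> ball 0 R" using R by auto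
    then have "(deriv G has_field_derivative deriv (deriv G) z) (at z)"
      using G1hol by (intro holomorphic_derivI[of _ "ball 0 R"]) auto
    then show "(deriv G has_field_derivative deriv (deriv G) z) (at z within cball 0 (R / 4))"
      by (rule has_field_derivative_at_within)
    show "norm (deriv (deriv G) z) \<le> 64 * A / R ^ 2" by (rule d2[OF z])
  qed (use w R in auto)
  have logd: "deriv G z = deriv F z / F z - (\<Sum>\<rho>\<in>S. of_nat (nat (zorder F \<rho>)) / (z - \<rho>))"
    if z: "norm z < R" "F z \<noteq> 0" for z
  proof -
    have zS: "z \<notin> S" "0 \<notin> S" using z F0 by (auto simp: S)
    let ?s = "\<Sum>\<rho>\<in>S. of_nat (nat (zorder F \<rho>)) / (z - \<rho>)"
    have dP: "(P has_field_derivative P z * ?s) (at z)"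
      unfolding P_def using fin zS by (intro has_field_derivative_prod_zero_factors)
    have dG: "(G has_field_derivative deriv G z) (at z)"
      using G(1) z by (intro holomorphic_derivI[of _ "ball 0 R"]) auto
    have "((\<lambda>u. F 0 * exp (G u) * P u) has_field_derivative F 0 * (exp (G z) * deriv G z) * P z + P z * ?s * (F 0 * exp (G z))) (at z)"
      using dP dG by (auto intro!: derivative_eq_intros)
    then have "(F has_field_derivative F 0 * (exp (G z) * deriv G z) * P z + P z * ?s * (F 0 * exp (G z))) (at z)"
    proof (rule has_field_derivative_transform_within_open)
      show "open (ball (0::complex) R)" "z \<in> ball 0 R" using z by auto
      show "F 0 * exp (G u) * P u = F u" if "u \<in> ball 0 R" for u
        using G(2)[OF that] FP[of u] F0 by simp
    qed
    then have "deriv F z = F 0 * (exp (G z) * deriv G z) * P z + P z * ?s * (F 0 * exp (G z))"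
      by (rule DERIV_imp_deriv)
    also have "\<dots> = (F 0 * exp (G z) * P z) * (deriv G z + ?s)" by (simp add: algebra_simps)
    also have "F 0 * exp (G z) * P z = F z" using G(2)[of z] FP[of z] F0 z by simp
    finally show ?thesis using z by (simp add: field_simps)
  qed
  have "norm w < R" using w R by linarith
  then show ?thesis using bound logd[of w] logd[of 0] w F0 R by (simp add: A_def)
qed

text \<open>Evenness gives F'(0) = 0, and the terms 1 / rho at the origin are purely imaginary
  because all zeros are. Hence taking real parts in \<open>log_deriv_partial_fraction_bound\<close>
  leaves only the terms at w, with no constant.\<close>

theorem even_entire_partial_fraction_Re:
  fixes F :: "complex \<Rightarrow> complex"
  assumes hol: "F holomorphic_on UNIV" and even: "\<And>w. F (- w) = F w" and F0: "F 0 \<noteq> 0"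
    and imag: "\<And>w. F w = 0 \<Longrightarrow> Re w = 0"
    and bd: "\<And>R w. norm w \<le> real R \<Longrightarrow> norm (F w) \<le> M R"
    and growth: "(\<lambda>R. ln (M R) / real R ^ 2) \<longlonglongrightarrow> 0"
    and w: "Re w > 0"
  shows "(\<lambda>R. \<Sum>\<rho> | F \<rho> = 0 \<and> norm \<rho> < real R. real (nat (zorder F \<rho>)) * Re (1 / (w - \<rho>)))
     \<longlonglongrightarrow> Re (deriv F w / F w)"
proof -
  define S where "S = (\<lambda>R::nat. {\<rho>. F \<rho> = 0 \<and> norm \<rho> < real R})"
  define E where "E = (\<lambda>R. 64 * (ln (M (2 * R) / norm (F 0)) + 1) / real R ^ 2 * norm w)"
  have Fw: "F w \<noteq> 0" using imag w by force
  have d0: "deriv F 0 = 0"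
  proof -
    have d: "(F has_field_derivative deriv F 0) (at 0)"
      using hol by (intro holomorphic_derivI[of _ UNIV]) auto
    have "((\<lambda>w. F (- w)) has_field_derivative deriv F 0 * - 1) (at 0)"
      by (rule DERIV_chain2[of F]) (use d in \<open>auto intro!: derivative_eq_intros\<close>)
    then have "(F has_field_derivative - deriv F 0) (at 0)" by (simp add: even)
    then have "deriv F 0 = - deriv F 0" by (rule DERIV_imp_deriv)
    then show ?thesis by simp
  qed
  have M0: "M R > 0" for R using bd[of 0 R] F0 by (metis norm_zero of_nat_0_le_iff order_less_le_trans zero_less_norm_iff)
  have "norm ((\<Sum>\<rho>\<in>S R. real (nat (zorder F \<rho>)) * Re (1 / (w - \<rho>))) - Re (deriv F w / F w)) \<le> E R" if R: "real R \<ge> 4 * norm w" "R > 0" for R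
  proof -
    let ?s = "\<lambda>w. \<Sum>\<rho>\<in>S R. of_nat (nat (zorder F \<rho>)) / (w - \<rho>)"
    have "norm ((deriv F w / F w - ?s w) - (deriv F 0 / F 0 - ?s 0)) \<le> E R"
      unfolding E_def
    proof (rule log_deriv_partial_fraction_bound[OF hol F0])
      fix z :: complex assume "norm z \<le> 2 * real R"
      then show "norm (F z) \<le> M (2 * R) / norm (F 0) * norm (F 0)" using bd[of z "2 * R"] F0 by simp
    qed (use R Fw in \<open>auto simp: S_def\<close>)
    then have "\<bar>Re ((deriv F w / F w - ?s w) - (deriv F 0 / F 0 - ?s 0))\<bar> \<le> E R"
      using abs_Re_le_cmod order_trans by blast
    moreover have "Re (of_nat (nat (zorder F \<rho>)) / (0 - \<rho>)) = 0" if "\<rho> \<in> S R" for \<rho>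
      using that imag[of \<rho>] by (simp add: S_def Re_divide)
    then have "Re (?s 0) = 0" by simp
    moreover have "Re (?s w) = (\<Sum>\<rho>\<in>S R. real (nat (zorder F \<rho>)) * Re (1 / (w - \<rho>)))"
      by (simp add: Re_divide)
    ultimately show ?thesis by (simp add: d0)
  qed
  note est = this
  have ev: "\<forall>\<^sub>F R in sequentially. norm ((\<Sum>\<rho>\<in>S R. real (nat (zorder F \<rho>)) * Re (1 / (w - \<rho>))) - Re (deriv F w / F w)) \<le> E R"
  proof (rule eventually_sequentiallyI[of "nat \<lceil>4 * norm w\<rceil> + 1"])
    fix R :: nat assume "nat \<lceil>4 * norm w\<rceil> + 1 \<le> R"
    then show "norm ((\<Sum>\<rho>\<in>S R. real (nat (zorder F \<rho>)) * Re (1 / (w - \<rho>))) - Re (deriv F w / F w)) \<le> E R"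
      by (intro est) (use real_nat_ceiling_ge[of "4 * norm w"] in linarith, linarith)
  qed
  have "E \<longlonglongrightarrow> 0"
  proof -
    have "filterlim (\<lambda>R::nat. 2 * R) at_top sequentially" by (rule mult_nat_left_at_top) simp
    from filterlim_compose[OF growth this]
    have "(\<lambda>R. ln (M (2 * R)) / real (2 * R) ^ 2) \<longlonglongrightarrow> 0" by simp
    moreover have "(\<lambda>R. (1 - ln (norm (F 0))) / real R ^ 2) \<longlonglongrightarrow> 0" by real_asymp
    ultimately have "(\<lambda>R. 64 * (4 * (ln (M (2 * R)) / real (2 * R) ^ 2) + (1 - ln (norm (F 0))) / real R ^ 2) * norm w) \<longlonglongrightarrow> 64 * (4 * 0 + 0) * norm w"
      by (intro tendsto_intros)
    moreover have "64 * (4 * (ln (M (2 * R)) / real (2 * R) ^ 2) + (1 - ln (norm (F 0))) / real R ^ 2) * norm w = E R" for R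
    proof -
      have l: "ln (M (2 * R) / norm (F 0)) = ln (M (2 * R)) - ln (norm (F 0))"
        using M0[of "2 * R"] F0 by (simp add: ln_div)
      show ?thesis unfolding E_def l by (cases "R = 0") (simp_all add: field_simps power_mult_distrib)
    qed
    ultimately show ?thesis by simp
  qed
  from Lim_null_comparison[OF ev this] show ?thesis
    unfolding S_def by (rule LIM_zero_cancel)
qed

subsection \<open>The Poisson integral of the Li kernel\<close>

text \<open>For a > 0 this maps the left half plane into the unit disc. With rho = 1/2 + w and a = b
  + 1/2 it is the fraction (rho + b) / (rho - 1 - b).\<close>

definition cayley :: "real \<Rightarrow> complex \<Rightarrow> complex" where
  "cayley a w = (w + of_real a) / (w - of_real a)"

text \<open>\<open>li_kernel a n h t\<close> is the value at \<open>- h + i t\<close> of a bounded harmonic function on the left half plane.\<close>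

definition li_kernel :: "real \<Rightarrow> nat \<Rightarrow> real \<Rightarrow> real \<Rightarrow> real" where
  "li_kernel a n h t = 1 - Re (cayley a (\<i> * of_real t - of_real h) ^ n)"

lemma norm_cayley_le_1:
  assumes "a > 0" "Re w \<le> 0"
  shows "norm (cayley a w) \<le> 1"
proof -
  have "norm (w + of_real a) ^ 2 \<le> norm (w - of_real a) ^ 2"
    using assms by (simp only: cmod_power2) (simp add: power2_eq_square algebra_simps mult_nonneg_nonpos)
  then have "norm (w + of_real a) \<le> norm (w - of_real a)" by (rule power2_le_imp_le) simp
  then show ?thesis by (simp add: cayley_def norm_divide divide_le_eq_1)
qed

lemma li_kernel_bounds:
  assumes "a > 0" "h \<ge> 0"
  shows "0 \<le> li_kernel a n h t" "li_kernel a n h t \<le> 2"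
proof -
  have "norm (cayley a (\<i> * of_real t - of_real h) ^ n) \<le> 1"
    unfolding norm_power using assms by (intro power_le_one norm_cayley_le_1) auto
  then have "\<bar>Re (cayley a (\<i> * of_real t - of_real h) ^ n)\<bar> \<le> 1"
    using abs_Re_le_cmod order_trans by blast
  then show "0 \<le> li_kernel a n h t" "li_kernel a n h t \<le> 2" unfolding li_kernel_def by linarith+
qed

lemma cayley_denominator_nonzero: "a > 0 \<Longrightarrow> h \<ge> 0 \<Longrightarrow> \<i> * of_real t - of_real h - of_real a \<noteq> 0"
  by (auto simp: complex_eq_iff)

lemma continuous_li_kernel:
  assumes "a > 0" "h \<ge> 0"
  shows "continuous_on UNIV (li_kernel a n h)"
  unfolding li_kernel_def cayley_def
  by (intro continuous_intros) (use cayley_denominator_nonzero[OF assms] in auto)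

lemma borel_measurable_li_kernel [measurable]:
  "a > 0 \<Longrightarrow> h \<ge> 0 \<Longrightarrow> li_kernel a n h \<in> borel_measurable borel"
  by (intro borel_measurable_continuous_onI continuous_li_kernel)

text \<open>Both values of \<open>cayley\<close> lie in the closed unit disc, where taking n-th
  powers is Lipschitz with constant n; their difference has a denominator whose two factors are each
  at least |t|.\<close>

lemma li_kernel_diff_le:
  assumes a: "a > 0" and h: "h \<ge> 0" and t: "t \<noteq> 0"
  shows "\<bar>li_kernel a n h t - li_kernel a n 0 t\<bar> \<le> 2 * a * n * h / t ^ 2"
proof -
  let ?w = "\<i> * of_real t - of_real h" and ?v = "\<i> * of_real t - of_real 0"
  have nz: "?w - of_real a \<noteq> 0" "?v - of_real a \<noteq> 0"
    using cayley_denominator_nonzero[OF a h] cayley_denominator_nonzero[OF a order_refl] by blast+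
  have "cayley a ?w - cayley a ?v = 2 * of_real a * of_real h / ((?w - of_real a) * (?v - of_real a))"
  proof -
    define A B where "A = ?w - of_real a" and "B = ?v - of_real a"
    have "A \<noteq> 0" "B \<noteq> 0" unfolding A_def B_def by (rule nz)+
    then have "(A + 2 * of_real a) / A - (B + 2 * of_real a) / B = 2 * of_real a * (B - A) / (A * B)"
      by (simp add: field_simps)
    moreover have "?w + of_real a = A + 2 * of_real a" "?v + of_real a = B + 2 * of_real a" "B - A = of_real h"
      by (simp_all add: A_def B_def algebra_simps)
    ultimately show ?thesis unfolding cayley_def A_def[symmetric] B_def[symmetric] by (simp only:)
  qed
  then have "norm (cayley a ?w - cayley a ?v) = 2 * a * h / (norm (?w - of_real a) * norm (?v - of_real a))"
    using a h by (simp add: norm_mult norm_divide)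
  also have "\<dots> \<le> 2 * a * h / (\<bar>t\<bar> * \<bar>t\<bar>)"
  proof (intro divide_left_mono mult_mono)
    show "\<bar>t\<bar> \<le> norm (?w - of_real a)" using abs_Im_le_cmod[of "?w - of_real a"] by simp
    show "\<bar>t\<bar> \<le> norm (?v - of_real a)" using abs_Im_le_cmod[of "?v - of_real a"] by simp
    then show "0 < norm (?w - complex_of_real a) * norm (?v - complex_of_real a) * (\<bar>t\<bar> * \<bar>t\<bar>)"
      using nz t by (intro mult_pos_pos) auto
  qed (use a h in auto)
  finally have d: "norm (cayley a ?w - cayley a ?v) \<le> 2 * a * h / t ^ 2" by (simp add: power2_eq_square)
  have "li_kernel a n h t - li_kernel a n 0 t = - Re (cayley a ?w ^ n - cayley a ?v ^ n)"
    by (simp add: li_kernel_def)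
  then have "\<bar>li_kernel a n h t - li_kernel a n 0 t\<bar> = \<bar>Re (cayley a ?w ^ n - cayley a ?v ^ n)\<bar>"
    by (simp only: abs_minus_cancel)
  also have "\<dots> \<le> norm (cayley a ?w ^ n - cayley a ?v ^ n)" by (rule abs_Re_le_cmod)
  also have "\<dots> \<le> real n * norm (cayley a ?w - cayley a ?v)"
    using a h by (intro norm_power_diff norm_cayley_le_1) auto
  also have "\<dots> \<le> real n * (2 * a * h / t ^ 2)" by (intro mult_left_mono d) auto
  finally show ?thesis by (simp add: mult_ac)
qed

text \<open>With $H^2 = 2anh$, the bound by a Poisson kernel of width \<open>H\<close>.\<close>

lemma li_kernel_diff_le_Poisson:
  assumes a: "a > 0" and h: "h > 0" and n: "n > 0"
  shows "\<bar>li_kernel a n h t - li_kernel a n 0 t\<bar> \<le> 4 * (2 * a * n * h) / (2 * a * n * h + t ^ 2)"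
proof -
  define q where "q = 2 * a * n * h"
  have q: "q > 0" using a h n by (simp add: q_def)
  have 2: "\<bar>li_kernel a n h t - li_kernel a n 0 t\<bar> \<le> 2"
    using li_kernel_bounds[OF a, of h n t] li_kernel_bounds[OF a, of 0 n t] h by auto
  \<comment> \<open>For t^2 <= q the trivial bound 2 is used and for larger t the bound q / t^2; in
    both ranges q + t^2 is at most twice the larger of q and t^2, and the constant 4 covers
    both.\<close>
  show ?thesis
  proof (cases "t ^ 2 \<le> q")
    case True
    have "2 * (q + t ^ 2) \<le> 4 * q" using True by simp
    then have "2 \<le> 4 * q / (q + t ^ 2)" using q by (subst le_divide_eq) (auto simp: add_pos_nonneg)
    then show ?thesis using 2 by (simp add: q_def)
  next
    case False
    then have t: "t \<noteq> 0" "t ^ 2 > 0" using q by auto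
    have "\<bar>li_kernel a n h t - li_kernel a n 0 t\<bar> \<le> q / t ^ 2"
      using li_kernel_diff_le[OF a _ t(1), of h n] h by (simp add: q_def)
    also have "q / t ^ 2 \<le> 4 * q / (q + t ^ 2)"
      using False q t by (simp add: field_simps)
    finally show ?thesis by (simp add: q_def)
  qed
qed

lemma mean_value_unit_circle:
  assumes "f holomorphic_on ball 0 1" "continuous_on (cball 0 1) f"
  shows "((\<lambda>x. f (exp (2 * of_real pi * \<i> * of_real x))) has_integral f 0) {0..1}"
proof -
  have "((\<lambda>u. f u / (u - 0)) has_contour_integral (2 * of_real pi * \<i> * f 0)) (circlepath 0 1)"
    by (rule Cauchy_integral_circlepath) (use assms in auto)
  then have "((\<lambda>x. f (circlepath 0 1 x) / (circlepath 0 1 x - 0) * vector_derivative (circlepath 0 1) (at x within {0..1}))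
      has_integral 2 * of_real pi * \<i> * f 0) {0..1}"
    by (simp only: has_contour_integral_def)
  then have "((\<lambda>x. (2 * of_real pi * \<i>) * f (exp (2 * of_real pi * \<i> * of_real x))) has_integral (2 * of_real pi * \<i>) * f 0) {0..1}"
  proof (rule has_integral_eq[rotated])
    fix x :: real assume "x \<in> {0..1}"
    then show "f (circlepath 0 1 x) / (circlepath 0 1 x - 0) * vector_derivative (circlepath 0 1) (at x within {0..1})
      = (2 * of_real pi * \<i>) * f (exp (2 * of_real pi * \<i> * of_real x))"
      using vector_derivative_circlepath01[of x 0 1] by (simp add: circlepath)
  qed
  then have "((\<lambda>x. 1 / (2 * of_real pi * \<i>) * ((2 * of_real pi * \<i>) * f (exp (2 * of_real pi * \<i> * of_real x)))) has_integral 1 / (2 * of_real pi * \<i>) * ((2 * of_real pi * \<i>) * f 0)) {0..1}"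
    by (rule has_integral_mult_right)
  then show ?thesis by simp
qed

lemma exp_two_i_arctan: "exp (2 * \<i> * of_real (arctan \<tau>)) = (1 + \<i> * of_real \<tau>) / (1 - \<i> * of_real \<tau>)"
proof -
  have nz: "1 - \<i> * of_real \<tau> \<noteq> 0" by (auto simp: complex_eq_iff)
  have q: "sqrt (1 + \<tau> ^ 2) > 0" by (simp add: add_pos_nonneg)
  have "exp (\<i> * of_real (arctan \<tau>)) = (1 + \<i> * of_real \<tau>) / of_real (sqrt (1 + \<tau> ^ 2))"
    by (simp add: exp_Euler cos_of_real sin_of_real cos_arctan sin_arctan add_divide_distrib flip: of_real_mult)
  then have "exp (\<i> * of_real (arctan \<tau>)) ^ 2 = (1 + \<i> * of_real \<tau>) ^ 2 / of_real (sqrt (1 + \<tau> ^ 2) ^ 2)"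
    by (simp only: power_divide of_real_power)
  also have "sqrt (1 + \<tau> ^ 2) ^ 2 = 1 + \<tau> ^ 2" by simp
  also have "complex_of_real (1 + \<tau> ^ 2) = (1 + \<i> * of_real \<tau>) * (1 - \<i> * of_real \<tau>)"
    by (simp add: algebra_simps power2_eq_square)
  also have "(1 + \<i> * of_real \<tau>) ^ 2 / ((1 + \<i> * of_real \<tau>) * (1 - \<i> * of_real \<tau>)) = (1 + \<i> * of_real \<tau>) / (1 - \<i> * of_real \<tau>)"
    using nz by (simp add: power2_eq_square)
  finally show ?thesis by (simp add: exp_double[symmetric] mult.assoc)
qed

text \<open>The Moebius map z -> i t0 - h (1 + z) / (1 - z) carries the disc to the left half plane
  and 0 to -h + i t0. The formula is the mean value property of the transported function at 0, with
  the circle re-parametrised by the line.\<close>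

lemma Poisson_integral_li_kernel:
  assumes a: "a > 0" and h: "h > 0"
  shows "(\<integral>\<^sup>+t. ennreal (li_kernel a n 0 t * (h / (h ^ 2 + (t - t0) ^ 2))) \<partial>lborel) = ennreal (pi * li_kernel a n h t0)"
proof -
  note [measurable] = borel_measurable_li_kernel[OF a order_refl]
  \<comment> \<open>Numerator and denominator of \<open>cayley\<close> after the Moebius map,
    multiplied by 1 - z. Clearing this factor makes the quotient continuous at z = 1 too, the image
    of infinity.\<close>
  define Nu De where "Nu = (\<lambda>z. (\<i> * of_real t0 + of_real a) * (1 - z) - of_real h * (1 + z))"
    and "De = (\<lambda>z. (\<i> * of_real t0 - of_real a) * (1 - z) - of_real h * (1 + z))"
  have De: "De z \<noteq> 0" if z: "norm z \<le> 1" for z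
  proof
    assume "De z = 0"
    then have e: "(\<i> * of_real t0 - of_real a) * (1 - z) = of_real h * (1 + z)" by (simp add: De_def)
    have z1: "z \<noteq> 1" using e h by auto
    have "(\<i> * of_real t0 - of_real a) * ((1 - z) * cnj (1 - z)) = of_real h * ((1 + z) * cnj (1 - z))"
      using e by (simp only: mult.assoc[symmetric])
    then have "Re ((\<i> * of_real t0 - of_real a) * ((1 - z) * cnj (1 - z))) = Re (of_real h * ((1 + z) * cnj (1 - z)))"
      by (rule arg_cong)
    moreover have "(1 - z) * cnj (1 - z) = of_real (norm (1 - z) ^ 2)" by (rule complex_norm_square[symmetric])
    moreover have "Re ((1 + z) * cnj (1 - z)) = 1 - norm z ^ 2"
      unfolding cmod_power2 by (simp add: power2_eq_square algebra_simps)
    moreover have "Re (of_real c * y) = c * Re y" "Re ((\<i> * of_real t0 - of_real a) * of_real c) = - a * c" for c y by simp_all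
    ultimately have "- a * norm (1 - z) ^ 2 = h * (1 - norm z ^ 2)" by (simp only:)
    moreover have "a * norm (1 - z) ^ 2 > 0" using a z1 by simp
    moreover have "h * (1 - norm z ^ 2) \<ge> 0" using h z by (simp add: power_le_one)
    ultimately show False by simp
  qed
  define H where "H = (\<lambda>z. (Nu z / De z) ^ n)"
  have Hhol: "H holomorphic_on ball 0 1" unfolding H_def Nu_def De_def
    by (intro holomorphic_intros) (use De in \<open>auto simp: De_def\<close>)
  have Hcont: "continuous_on (cball 0 1) H" unfolding H_def Nu_def De_def
    by (intro continuous_intros) (use De in \<open>auto simp: De_def\<close>)
  define \<phi> where "\<phi> = (\<lambda>x. 1 - Re (H (exp (2 * of_real pi * \<i> * of_real x))))"
  have nrm: "norm (exp (2 * of_real pi * \<i> * of_real x)) = 1" for x by simp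
  have \<phi>cont: "continuous_on UNIV \<phi>"
    unfolding \<phi>_def
    by (intro continuous_intros continuous_on_compose2[OF Hcont]) auto
  then have [measurable]: "\<phi> \<in> borel_measurable borel" by (rule borel_measurable_continuous_onI)
  \<comment> \<open>The angle, in full turns, of the point of the circle corresponding to i t; it is
    the distribution function of the Cauchy law centred at t0 with scale h, so its derivative is the
    Poisson kernel over pi.\<close>
  define g where "g = (\<lambda>t. 1 / 2 + arctan ((t - t0) / h) / pi)"
  have g01: "0 < g t" "g t < 1" for t
    using arctan_lbound[of "(t - t0) / h"] arctan_ubound[of "(t - t0) / h"] by (auto simp: g_def field_simps)
  have gmono: "g s \<le> g t" if "s \<le> t" for s t
    using that h by (simp add: g_def divide_right_mono arctan_monotone')
  have \<phi>g: "\<phi> (g t) = li_kernel a n 0 t" for t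
  proof -
    define \<tau> where "\<tau> = (t - t0) / h"
    have tt: "t = t0 + h * \<tau>" using h by (simp add: \<tau>_def)
    have nz: "1 - \<i> * of_real \<tau> \<noteq> 0" by (auto simp: complex_eq_iff)
    have "2 * of_real pi * \<i> * of_real (g t) = of_real pi * \<i> + 2 * \<i> * of_real (arctan \<tau>)"
      by (simp add: g_def \<tau>_def field_simps)
    then have "exp (2 * of_real pi * \<i> * of_real (g t)) = exp (of_real pi * \<i>) * exp (2 * \<i> * of_real (arctan \<tau>))"
      by (simp only: exp_add)
    then have e: "exp (2 * of_real pi * \<i> * of_real (g t)) = - ((1 + \<i> * of_real \<tau>) / (1 - \<i> * of_real \<tau>))"
      by (simp only: exp_two_i_arctan exp_pi_i mult_minus_left mult_1_left)
    define z q where "z = - ((1 + \<i> * of_real \<tau>) / (1 - \<i> * of_real \<tau>))" and "q = 1 - \<i> * of_real \<tau>"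
    have q: "q \<noteq> 0" using nz by (simp add: q_def)
    have z1: "1 - z = 2 / q" "1 + z = - 2 * \<i> * of_real \<tau> / q"
      using nz by (simp_all add: z_def q_def field_simps)
    have "Nu z = 2 / q * (\<i> * of_real t + of_real a)"
      unfolding Nu_def z1 tt using q by (simp add: field_simps)
    moreover have "De z = 2 / q * (\<i> * of_real t - of_real a)"
      unfolding De_def z1 tt using q by (simp add: field_simps)
    moreover have "2 / q \<noteq> 0" using q by simp
    ultimately have "Nu z / De z = (\<i> * of_real t + of_real a) / (\<i> * of_real t - of_real a)"
      by (simp only: mult_divide_mult_cancel_left_if if_False)
    then show ?thesis unfolding \<phi>_def e z_def[symmetric] H_def li_kernel_def cayley_def by simp
  qed
  \<comment> \<open>The endpoints 0 and 1 correspond to no finite t; there the sign follows by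
    continuity.\<close>
  have \<phi>0: "\<phi> x \<ge> 0" if "x \<in> {0..1}" for x
  proof -
    have dense: "\<phi> x \<ge> 0" if "x \<in> {0<..<1}" for x
    proof -
      define t where "t = t0 + h * tan (pi * (x - 1 / 2))"
      have "- (pi / 2) < pi * (x - 1 / 2)" "pi * (x - 1 / 2) < pi / 2" using that by (auto simp: field_simps)
      then have "g t = x" using h by (simp add: g_def t_def arctan_tan)
      then show ?thesis using \<phi>g[of t] li_kernel_bounds(1)[OF a order_refl] by metis
    qed
    have "closure {0<..<1::real} = {0..1}" by (rule closure_greaterThanLessThan) simp
    then have "x \<in> closure {0<..<1}" using that by simp
    moreover have "continuous_on (closure {0<..<1}) \<phi>" using \<phi>cont continuous_on_subset by blast
    ultimately show ?thesis using continuous_ge_on_closure dense by blast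
  qed
  have deriv: "(g has_real_derivative (h / (h ^ 2 + (t - t0) ^ 2)) / pi) (at t)" for t
  proof -
    have q: "h ^ 2 + (t - t0) ^ 2 > 0" using h by (simp add: add_pos_nonneg)
    have "(g has_real_derivative inverse (1 + ((t - t0) / h) ^ 2) * (1 / h) / pi) (at t)"
      unfolding g_def using h by (auto intro!: derivative_eq_intros)
    moreover have "inverse (1 + ((t - t0) / h) ^ 2) * (1 / h) = h / (h ^ 2 + (t - t0) ^ 2)"
      using h q by (simp add: field_simps power2_eq_square)
    ultimately show ?thesis by (simp only:)
  qed
  have eq: "(\<integral>\<^sup>+x. ennreal (\<phi> x) * indicator {g (- real k)..g (real k)} x \<partial>lborel)
     = (\<integral>\<^sup>+t. ennreal (li_kernel a n 0 t * ((h / (h ^ 2 + (t - t0) ^ 2)) / pi)) * indicator {- real k..real k} t \<partial>lborel)" for k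
  proof -
    have "(\<integral>\<^sup>+x. \<phi> x * indicator {g (- real k)..g (real k)} x \<partial>lborel)
       = (\<integral>\<^sup>+t. \<phi> (g t) * ((h / (h ^ 2 + (t - t0) ^ 2)) / pi) * indicator {- real k..real k} t \<partial>lborel)"
    proof (rule nn_integral_substitution)
      show "set_borel_measurable borel {g (- real k)..g (real k)} \<phi>"
        unfolding set_borel_measurable_def by measurable
      show "continuous_on {- real k..real k} (\<lambda>t. (h / (h ^ 2 + (t - t0) ^ 2)) / pi)"
        using h by (intro continuous_intros) (auto simp: add_pos_nonneg less_imp_neq[THEN not_sym])
    qed (use deriv h in auto)
    moreover have "(\<integral>\<^sup>+x. \<phi> x * indicator {g (- real k)..g (real k)} x \<partial>lborel) = (\<integral>\<^sup>+x. ennreal (\<phi> x) * indicator {g (- real k)..g (real k)} x \<partial>lborel)"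
      by (intro nn_integral_cong) (simp add: indicator_def)
    moreover have "(\<integral>\<^sup>+t. \<phi> (g t) * ((h / (h ^ 2 + (t - t0) ^ 2)) / pi) * indicator {- real k..real k} t \<partial>lborel)
      = (\<integral>\<^sup>+t. ennreal (li_kernel a n 0 t * ((h / (h ^ 2 + (t - t0) ^ 2)) / pi)) * indicator {- real k..real k} t \<partial>lborel)"
      unfolding \<phi>g by (intro nn_integral_cong) (simp add: indicator_def)
    ultimately show ?thesis by simp
  qed
  have U2: "(\<Union>k. {- real k..real k}) = UNIV"
  proof safe
    fix x :: real
    obtain k :: nat where "\<bar>x\<bar> \<le> real k" using real_arch_simple by blast
    then show "x \<in> (\<Union>k. {- real k..real k})" by (intro UN_I[of k]) auto
  qed auto
  have U1: "(\<Union>k. {g (- real k)..g (real k)}) = {0<..<1}"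
  proof (intro equalityI subsetI)
    fix x assume "x \<in> (\<Union>k. {g (- real k)..g (real k)})"
    then obtain k where "g (- real k) \<le> x" "x \<le> g (real k)" by auto
    then show "x \<in> {0<..<1}" using g01[of "- real k"] g01[of "real k"] by simp
  next
    fix x :: real assume x: "x \<in> {0<..<1}"
    define t where "t = t0 + h * tan (pi * (x - 1 / 2))"
    have "- (pi / 2) < pi * (x - 1 / 2)" "pi * (x - 1 / 2) < pi / 2" using x by (auto simp: field_simps)
    then have gt: "g t = x" using h by (simp add: g_def t_def arctan_tan)
    obtain k :: nat where "t \<in> {- real k..real k}" using U2 by blast
    then show "x \<in> (\<Union>k. {g (- real k)..g (real k)})"
      using gmono gt by (intro UN_I[of k]) auto
  qed
  have "(\<lambda>k. \<integral>\<^sup>+x. ennreal (\<phi> x) * indicator {g (- real k)..g (real k)} x \<partial>lborel) \<longlonglongrightarrow> (\<integral>\<^sup>+x. ennreal (\<phi> x) * indicator (\<Union>k. {g (- real k)..g (real k)}) x \<partial>lborel)"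
  proof (rule nn_integral_exhaust)
    show "incseq (\<lambda>k. {g (- real k)..g (real k)})" by (rule incseq_SucI) (simp add: gmono)
  qed auto
  moreover have "(\<lambda>k. \<integral>\<^sup>+t. ennreal (li_kernel a n 0 t * ((h / (h ^ 2 + (t - t0) ^ 2)) / pi)) * indicator {- real k..real k} t \<partial>lborel)
     \<longlonglongrightarrow> (\<integral>\<^sup>+t. ennreal (li_kernel a n 0 t * ((h / (h ^ 2 + (t - t0) ^ 2)) / pi)) * indicator (\<Union>k. {- real k..real k}) t \<partial>lborel)"
  proof (rule nn_integral_exhaust)
    show "incseq (\<lambda>k. {- real k..real k})" by (rule incseq_SucI) simp
    show "(\<lambda>t. ennreal (li_kernel a n 0 t * ((h / (h ^ 2 + (t - t0) ^ 2)) / pi))) \<in> borel_measurable lborel"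
      by measurable
  qed auto
  ultimately have "(\<integral>\<^sup>+x. ennreal (\<phi> x) * indicator {0<..<1} x \<partial>lborel) = (\<integral>\<^sup>+t. ennreal (li_kernel a n 0 t * ((h / (h ^ 2 + (t - t0) ^ 2)) / pi)) \<partial>lborel)"
    unfolding eq U1 U2 by (simp add: LIMSEQ_unique)
  moreover have "(\<integral>\<^sup>+x. ennreal (\<phi> x) * indicator {0<..<1} x \<partial>lborel) = (\<integral>\<^sup>+x. ennreal (\<phi> x) * indicator {0..1} x \<partial>lborel)"
  proof (rule nn_integral_cong_AE)
    have "AE x in lborel. x \<noteq> (0::real)" "AE x in lborel. x \<noteq> (1::real)" by (rule AE_lborel_singleton)+
    then show "AE x in lborel. ennreal (\<phi> x) * indicator {0<..<1} x = ennreal (\<phi> x) * indicator {0..1} x"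
      by eventually_elim (auto simp: indicator_def)
  qed
  moreover have "(\<integral>\<^sup>+x. ennreal (\<phi> x) * indicator {0..1} x \<partial>lborel) = ennreal (1 - Re (H 0))"
  proof (rule nn_integral_has_integral_lebesgue')
    have "((\<lambda>x. Re (H (exp (2 * of_real pi * \<i> * of_real x)))) has_integral Re (H 0)) {0..1}"
      by (intro has_integral_Re mean_value_unit_circle Hhol Hcont)
    moreover have "((\<lambda>x::real. 1) has_integral (1::real)) {0..1}"
      using has_integral_const_real[of "1::real" 0 1] by simp
    ultimately show "(\<phi> has_integral 1 - Re (H 0)) {0..1}"
      unfolding \<phi>_def by (rule has_integral_diff[rotated])
  qed (use \<phi>0 in auto)
  moreover have "1 - Re (H 0) = li_kernel a n h t0"
    by (simp add: H_def Nu_def De_def li_kernel_def cayley_def algebra_simps)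
  ultimately have "(\<integral>\<^sup>+t. ennreal (li_kernel a n 0 t * ((h / (h ^ 2 + (t - t0) ^ 2)) / pi)) \<partial>lborel) = ennreal (li_kernel a n h t0)"
    by simp
  then have "ennreal pi * (\<integral>\<^sup>+t. ennreal (li_kernel a n 0 t * ((h / (h ^ 2 + (t - t0) ^ 2)) / pi)) \<partial>lborel) = ennreal (pi * li_kernel a n h t0)"
    by (simp add: ennreal_mult')
  moreover have "ennreal pi * (\<integral>\<^sup>+t. ennreal (li_kernel a n 0 t * ((h / (h ^ 2 + (t - t0) ^ 2)) / pi)) \<partial>lborel)
     = (\<integral>\<^sup>+t. ennreal pi * ennreal (li_kernel a n 0 t * ((h / (h ^ 2 + (t - t0) ^ 2)) / pi)) \<partial>lborel)"
    by (rule nn_integral_cmult[symmetric]) measurable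
  moreover have "ennreal pi * ennreal (li_kernel a n 0 t * ((h / (h ^ 2 + (t - t0) ^ 2)) / pi)) = ennreal (li_kernel a n 0 t * (h / (h ^ 2 + (t - t0) ^ 2)))" for t
    by (simp add: ennreal_mult'[symmetric])
  ultimately show ?thesis by simp
qed

section \<open>Exact integrals of the Li kernel\<close>

lemma li_kernel_at_0:
  assumes a: "a > 0" and h: "h > 0"
  shows "li_kernel a n h 0 = 1 - ((h - a) / (h + a)) ^ n"
proof -
  have "cayley a (\<i> * of_real 0 - of_real h) = of_real ((h - a) / (h + a))"
  proof -
    have "cayley a (\<i> * of_real 0 - of_real h) = (- (of_real (h - a))) / (- (of_real (h + a)))"
      by (simp add: cayley_def)
    then show ?thesis by (simp only: minus_divide_divide of_real_divide)
  qed
  then show ?thesis unfolding li_kernel_def by (simp flip: of_real_power del: of_real_divide)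
qed

text \<open>k times the Poisson kernel of width k at 0 is k^2 / (k^2 + t^2), which increases to 1.
  So the integral is the limit of pi k (1 - ((k - a) / (k + a))^n), where a geometric sum exhibits
  the factor 2 a / (k + a).\<close>

lemma nn_integral_li_kernel:
  assumes a: "a > 0"
  shows "(\<integral>\<^sup>+t. ennreal (li_kernel a n 0 t) \<partial>lborel) = ennreal (2 * pi * a * n)"
proof -
  note [measurable] = borel_measurable_li_kernel[OF a order_refl]
  define F where "F = (\<lambda>k t. ennreal (li_kernel a n 0 t * (real (Suc k) ^ 2 / (real (Suc k) ^ 2 + t ^ 2))))"
  have f0: "li_kernel a n 0 t \<ge> 0" for t using li_kernel_bounds[OF a order_refl] by blast
  have lim1: "(\<lambda>k. \<integral>\<^sup>+t. F k t \<partial>lborel) \<longlonglongrightarrow> (\<integral>\<^sup>+t. ennreal (li_kernel a n 0 t) \<partial>lborel)"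
  proof (rule nn_integral_LIMSEQ)
    show "incseq F"
    proof (rule incseq_SucI, rule le_funI)
      fix k t
      have "real (Suc k) ^ 2 / (real (Suc k) ^ 2 + t ^ 2) \<le> real (Suc (Suc k)) ^ 2 / (real (Suc (Suc k)) ^ 2 + t ^ 2)"
      proof -
        define u v where "u = real (Suc k) ^ 2" and "v = real (Suc (Suc k)) ^ 2"
        have "0 < u" "u \<le> v" unfolding u_def v_def by (auto intro: power_mono)
        then have "u / (u + t ^ 2) \<le> v / (v + t ^ 2)"
          by (subst frac_le_eq) (auto simp: add_pos_nonneg less_imp_neq[THEN not_sym] field_simps mult_right_mono intro!: divide_nonpos_pos)
        then show ?thesis by (simp only: u_def v_def)
      qed
      then show "F k t \<le> F (Suc k) t" unfolding F_def by (intro ennreal_leI mult_left_mono f0)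
    qed
    show "F k \<in> borel_measurable lborel" for k unfolding F_def by measurable
    fix t :: real
    have "(\<lambda>k. real (Suc k) ^ 2 / (real (Suc k) ^ 2 + t ^ 2)) \<longlonglongrightarrow> 1" by real_asymp
    then have "(\<lambda>k. li_kernel a n 0 t * (real (Suc k) ^ 2 / (real (Suc k) ^ 2 + t ^ 2))) \<longlonglongrightarrow> li_kernel a n 0 t * 1"
      by (rule tendsto_mult_left)
    then show "(\<lambda>k. F k t) \<longlonglongrightarrow> ennreal (li_kernel a n 0 t)" unfolding F_def by (intro tendsto_ennrealI) simp
  qed
  have Fk: "(\<integral>\<^sup>+t. F k t \<partial>lborel) = ennreal (pi * (real (Suc k) * li_kernel a n (real (Suc k)) 0))" for k
  proof -
    have "(\<integral>\<^sup>+t. F k t \<partial>lborel) = (\<integral>\<^sup>+t. ennreal (real (Suc k)) * ennreal (li_kernel a n 0 t * (real (Suc k) / (real (Suc k) ^ 2 + (t - 0) ^ 2))) \<partial>lborel)"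
      unfolding F_def by (intro nn_integral_cong) (simp add: ennreal_mult'[symmetric] power2_eq_square mult_ac del: of_nat_Suc)
    also have "\<dots> = ennreal (real (Suc k)) * ennreal (pi * li_kernel a n (real (Suc k)) 0)"
      using Poisson_integral_li_kernel[OF a, of "real (Suc k)" n 0] by (subst nn_integral_cmult) auto
    also have "\<dots> = ennreal (pi * (real (Suc k) * li_kernel a n (real (Suc k)) 0))"
      by (simp add: ennreal_mult'[symmetric] mult_ac del: of_nat_Suc)
    finally show ?thesis .
  qed
  have "(\<lambda>k. real (Suc k) * li_kernel a n (real (Suc k)) 0) \<longlonglongrightarrow> 2 * a * n"
  proof -
    have e: "real (Suc k) * li_kernel a n (real (Suc k)) 0 = (2 * a * real (Suc k) / (real (Suc k) + a)) * (\<Sum>j<n. ((real (Suc k) - a) / (real (Suc k) + a)) ^ j)" for k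
    proof -
      have "1 - (real (Suc k) - a) / (real (Suc k) + a) = 2 * a / (real (Suc k) + a)"
        using a by (simp add: field_simps)
      then have "1 - ((real (Suc k) - a) / (real (Suc k) + a)) ^ n = 2 * a / (real (Suc k) + a) * (\<Sum>j<n. ((real (Suc k) - a) / (real (Suc k) + a)) ^ j)"
        by (simp only: one_diff_power_eq)
      moreover have "li_kernel a n (real (Suc k)) 0 = 1 - ((real (Suc k) - a) / (real (Suc k) + a)) ^ n"
        by (rule li_kernel_at_0[OF a]) simp
      ultimately show ?thesis by (simp del: of_nat_Suc)
    qed
    have "(\<lambda>k. 2 * a * real (Suc k) / (real (Suc k) + a)) \<longlonglongrightarrow> 2 * a" using a by real_asymp
    moreover have "(\<lambda>k. (real (Suc k) - a) / (real (Suc k) + a)) \<longlonglongrightarrow> 1" using a by real_asymp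
    ultimately have "(\<lambda>k. (2 * a * real (Suc k) / (real (Suc k) + a)) * (\<Sum>j<n. ((real (Suc k) - a) / (real (Suc k) + a)) ^ j)) \<longlonglongrightarrow> 2 * a * (\<Sum>j<n. 1 ^ j)"
      by (intro tendsto_intros)
    then show ?thesis unfolding e by simp
  qed
  then have "(\<lambda>k. ennreal (pi * (real (Suc k) * li_kernel a n (real (Suc k)) 0))) \<longlonglongrightarrow> ennreal (pi * (2 * a * n))"
    by (intro tendsto_ennrealI tendsto_mult_left)
  with lim1 show ?thesis unfolding Fk by (simp add: LIMSEQ_unique mult_ac)
qed

lemma ln_kernel_nonneg:
  fixes y t :: real
  assumes "y > 0"
  shows "0 \<le> 1 / y - y / (y ^ 2 + t ^ 2)"
proof -
  have q: "y ^ 2 + t ^ 2 > 0" using assms by (simp add: add_pos_nonneg)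
  have "1 / y - y / (y ^ 2 + t ^ 2) = t ^ 2 / (y * (y ^ 2 + t ^ 2))"
    using assms q by (simp add: field_simps power2_eq_square)
  also have "\<dots> \<ge> 0" using assms q by simp
  finally show ?thesis .
qed

text \<open>Writes the logarithm as a superposition of 1 / y minus Poisson kernels of width y >= a.
  The integrals of \<open>li_kernel\<close> against a constant and against a Poisson kernel are both
  known, and the difference is nonnegative.\<close>

lemma ln_kernel_nn_integral:
  assumes a: "a > 0"
  shows "(\<integral>\<^sup>+y. ennreal (1 / y - y / (y ^ 2 + t ^ 2)) * indicator {a..} y \<partial>lborel) = ennreal (ln (t ^ 2 + a ^ 2) / 2 - ln a)"
proof -
  have q: "y ^ 2 + t ^ 2 > 0" if "y \<ge> a" for y using that a by (simp add: add_pos_nonneg)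
  have "(\<integral>\<^sup>+y. ennreal (1 / y - y / (y ^ 2 + t ^ 2)) * indicator {a..} y \<partial>lborel) = ennreal (0 - (ln a - ln (a ^ 2 + t ^ 2) / 2))"
  proof (rule nn_integral_FTC_atLeast)
    show "((\<lambda>y. ln y - ln (y ^ 2 + t ^ 2) / 2) has_real_derivative 1 / y - y / (y ^ 2 + t ^ 2)) (at y)" if "a \<le> y" for y
    proof -
      have d: "((\<lambda>y. y ^ 2 + t ^ 2) has_real_derivative 2 * y) (at y)" by (auto intro!: derivative_eq_intros)
      have "((\<lambda>y. ln (y ^ 2 + t ^ 2)) has_real_derivative 1 / (y ^ 2 + t ^ 2) * (2 * y)) (at y)"
        by (rule DERIV_chain2[OF DERIV_ln_divide[OF q[OF that]] d])
      moreover have "0 < y" using that a by simp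
      ultimately have "((\<lambda>y. ln y - ln (y ^ 2 + t ^ 2) / 2) has_real_derivative 1 / y - 1 / (y ^ 2 + t ^ 2) * (2 * y) / 2) (at y)"
        by (intro DERIV_diff DERIV_ln_divide DERIV_cdivide)
      moreover have "1 / c * (2 * y) / 2 = y / c" for c :: real by simp
      ultimately show ?thesis by (simp only:)
    qed
    show "0 \<le> 1 / y - y / (y ^ 2 + t ^ 2)" if "a \<le> y" for y
      using that a by (intro ln_kernel_nonneg) simp
    show "((\<lambda>y. ln y - ln (y ^ 2 + t ^ 2) / 2) \<longlongrightarrow> 0) at_top" by real_asymp
  qed measurable
  then show ?thesis by (simp add: add.commute)
qed

lemma sum_lessThan_harm: "(\<Sum>k<n. harm k) = real n * harm n - real n"
proof (induction n)
  case (Suc n)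
  have "harm (Suc n) = harm n + 1 / real (Suc n)" by (simp add: harm_Suc divide_inverse)
  then show ?case using Suc by (simp add: field_simps)
qed (simp add: harm_def)

text \<open>With z = (y - a) / (y + a) one has 1 - z = 2 a / (y + a) and dz = (1 - z)^2 / (2 a) dy.
  Expanding 1 - z^n by two geometric sums and dividing by (1 - z)^2 leaves n / (1 - z) minus powers
  of z, all elementary to integrate. As y grows, z tends to 1, and the terms z^(j + 1) / (j + 1)
  become harmonic numbers.\<close>

lemma li_kernel_tail_nn_integral:
  assumes a: "a > 0" and n: "n > 0"
  shows "(\<integral>\<^sup>+y. ennreal (2 * pi * a * n / y - pi * (1 - ((y - a) / (y + a)) ^ n)) * indicator {a..} y \<partial>lborel) =
     ennreal (2 * pi * a * n * (ln 2 + harm n - 1))"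
    "\<And>y. y \<ge> a \<Longrightarrow> 2 * pi * a * n / y - pi * (1 - ((y - a) / (y + a)) ^ n) \<ge> 0"
proof -
  define z where "z = (\<lambda>y. (y - a) / (y + a))"
  have z1: "1 - z y = 2 * a / (y + a)" if "y \<ge> a" for y using that a by (simp add: z_def field_simps)
  have z01: "0 \<le> z y" "z y \<le> 1" if "y \<ge> a" for y using that a by (auto simp: z_def field_simps)
  \<comment> \<open>Antiderivative of (1 - z^n) / (2 a), normalised to vanish at y = a, where z =
    0.\<close>
  define Q where "Q = (\<lambda>y. n * ln ((y + a) / (2 * a)) - (\<Sum>k<n. \<Sum>j<k. z y ^ Suc j / real (Suc j)))"
  define \<Phi> where "\<Phi> = (\<lambda>y. 2 * pi * a * n * ln y - 2 * pi * a * Q y)"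
  have dz: "(z has_real_derivative 2 * a / (y + a) ^ 2) (at y)" if "y \<ge> a" for y
    unfolding z_def using that a by (auto intro!: derivative_eq_intros simp: power2_eq_square field_simps)
  have geo: "(1 - z y ^ n) = (1 - z y) * (n - (1 - z y) * (\<Sum>k<n. \<Sum>j<k. z y ^ j))" for y
  proof -
    have "(1 - z y) * (\<Sum>k<n. \<Sum>j<k. z y ^ j) = (\<Sum>k<n. 1 - z y ^ k)"
      unfolding sum_distrib_left one_diff_power_eq by simp
    also have "\<dots> = n - (\<Sum>k<n. z y ^ k)" by (simp add: sum_subtractf)
    finally show ?thesis by (simp add: one_diff_power_eq)
  qed
  have dQ: "(Q has_real_derivative (1 - z y ^ n) / (2 * a)) (at y)" if y: "y \<ge> a" for y
  proof -
    have pos: "(y + a) / (2 * a) > 0" using y a by simp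
    have dpow: "((\<lambda>y. z y ^ Suc j / real (Suc j)) has_real_derivative z y ^ j * (2 * a / (y + a) ^ 2)) (at y)" for j
    proof -
      have "((\<lambda>y. z y ^ Suc j / real (Suc j)) has_real_derivative real (Suc j) * (2 * a / (y + a) ^ 2 * z y ^ j) / real (Suc j)) (at y)"
        using DERIV_power[OF dz[OF y], of "Suc j"] by (intro DERIV_cdivide) simp
      then show ?thesis by (simp add: mult_ac del: of_nat_Suc)
    qed
    have dl: "((\<lambda>y. n * ln ((y + a) / (2 * a))) has_real_derivative n * (1 / (y + a))) (at y)"
      using pos y a by (auto intro!: derivative_eq_intros simp: field_simps)
    have "(Q has_real_derivative n * (1 / (y + a)) - (\<Sum>k<n. \<Sum>j<k. z y ^ j * (2 * a / (y + a) ^ 2))) (at y)"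
      unfolding Q_def by (intro DERIV_diff dl DERIV_sum dpow)
    moreover have "n * (1 / (y + a)) - (\<Sum>k<n. \<Sum>j<k. z y ^ j * (2 * a / (y + a) ^ 2)) = (1 - z y ^ n) / (2 * a)"
    proof -
      define X where "X = (\<Sum>k<n. \<Sum>j<k. z y ^ j)"
      have "(\<Sum>k<n. \<Sum>j<k. z y ^ j * (2 * a / (y + a) ^ 2)) = X * (2 * a / (y + a) ^ 2)"
        by (simp only: X_def sum_distrib_right)
      moreover have "(1 - z y ^ n) / (2 * a) = (2 * a / (y + a)) * (n - (2 * a / (y + a)) * X) / (2 * a)"
        unfolding geo X_def[symmetric] z1[OF y] ..
      moreover have "n * (1 / (y + a)) - X * (2 * a / (y + a) ^ 2) = (2 * a / (y + a)) * (n - (2 * a / (y + a)) * X) / (2 * a)"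
      proof -
        define s where "s = y + a"
        have "s \<noteq> 0" using a y by (simp add: s_def)
        then show ?thesis unfolding s_def[symmetric] using a by (simp add: field_simps power2_eq_square)
      qed
      ultimately show ?thesis by (simp only:)
    qed
    ultimately show ?thesis by (simp only:)
  qed
  have d\<Phi>: "(\<Phi> has_real_derivative 2 * pi * a * n / y - pi * (1 - z y ^ n)) (at y)" if y: "y \<ge> a" for y
  proof -
    have "(\<Phi> has_real_derivative 2 * pi * a * n * (1 / y) - 2 * pi * a * ((1 - z y ^ n) / (2 * a))) (at y)"
      unfolding \<Phi>_def using y a by (intro DERIV_diff DERIV_cmult dQ DERIV_ln_divide) auto
    then show ?thesis using a by simp
  qed
  have nonneg: "2 * pi * a * n / y - pi * (1 - z y ^ n) \<ge> 0" if y: "y \<ge> a" for y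
  proof -
    have "(\<Sum>k<n. z y ^ k) \<le> (\<Sum>k<n. 1)" using z01[OF y] by (intro sum_mono power_le_one) auto
    then have "1 - z y ^ n \<le> (2 * a / (y + a)) * n"
      unfolding one_diff_power_eq z1[OF y] using y a by (intro mult_left_mono) auto
    also have "\<dots> \<le> (2 * a / y) * n" using y a by (intro mult_right_mono divide_left_mono) auto
    finally have "pi * (1 - z y ^ n) \<le> pi * ((2 * a / y) * n)" by (intro mult_left_mono) auto
    then show ?thesis by (simp add: mult_ac)
  qed
  then show "\<And>y. y \<ge> a \<Longrightarrow> 2 * pi * a * n / y - pi * (1 - ((y - a) / (y + a)) ^ n) \<ge> 0" by (simp add: z_def)
  have lim: "(\<Phi> \<longlongrightarrow> 2 * pi * a * n * ln (2 * a) + 2 * pi * a * (\<Sum>k<n. harm k)) at_top"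
  proof -
    have zl: "(z \<longlongrightarrow> 1) at_top" unfolding z_def using a by real_asymp
    have ll: "((\<lambda>y. ln y - ln ((y + a) / (2 * a))) \<longlongrightarrow> ln (2 * a)) at_top"
    proof -
      have "((\<lambda>y. ln y - ln (y + a)) \<longlongrightarrow> 0) at_top" by real_asymp
      then have "((\<lambda>y. (ln y - ln (y + a)) + ln (2 * a)) \<longlongrightarrow> 0 + ln (2 * a)) at_top" by (intro tendsto_intros)
      then have "((\<lambda>y. (ln y - ln (y + a)) + ln (2 * a)) \<longlongrightarrow> ln (2 * a)) at_top" by simp
      then show ?thesis
      proof (rule Lim_transform_eventually)
        show "\<forall>\<^sub>F y in at_top. ln y - ln (y + a) + ln (2 * a) = ln y - ln ((y + a) / (2 * a))"
          using eventually_gt_at_top[of 0] by eventually_elim (use a in \<open>simp add: ln_div\<close>)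
      qed
    qed
    have "((\<lambda>y. 2 * pi * a * n * (ln y - ln ((y + a) / (2 * a))) + 2 * pi * a * (\<Sum>k<n. \<Sum>j<k. z y ^ Suc j / real (Suc j)))
       \<longlongrightarrow> 2 * pi * a * n * ln (2 * a) + 2 * pi * a * (\<Sum>k<n. \<Sum>j<k. 1 ^ Suc j / real (Suc j))) at_top"
      by (intro tendsto_intros ll zl) auto
    moreover have "(\<Sum>j<k. 1 ^ Suc j / real (Suc j)) = harm k" for k
      by (induction k) (simp_all add: harm_Suc harm_expand(1) divide_inverse)
    ultimately show ?thesis unfolding \<Phi>_def Q_def by (simp add: algebra_simps)
  qed
  have "(\<integral>\<^sup>+y. ennreal (2 * pi * a * n / y - pi * (1 - z y ^ n)) * indicator {a..} y \<partial>lborel)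
    = ennreal (2 * pi * a * n * ln (2 * a) + 2 * pi * a * (\<Sum>k<n. harm k) - \<Phi> a)"
    by (rule nn_integral_FTC_atLeast[OF _ d\<Phi> nonneg lim]) (simp_all add: z_def)
  also have "\<Phi> a = 2 * pi * a * n * ln a"
    using a by (simp add: \<Phi>_def Q_def z_def)
  also have "2 * pi * a * n * ln (2 * a) + 2 * pi * a * (\<Sum>k<n. harm k) - 2 * pi * a * n * ln a = 2 * pi * a * n * (ln 2 + harm n - 1)"
    unfolding sum_lessThan_harm using a by (simp add: ln_mult algebra_simps)
  finally show "(\<integral>\<^sup>+y. ennreal (2 * pi * a * n / y - pi * (1 - ((y - a) / (y + a)) ^ n)) * indicator {a..} y \<partial>lborel) =
     ennreal (2 * pi * a * n * (ln 2 + harm n - 1))" by (simp add: z_def)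
qed

text \<open>The logarithm is replaced by its integral over y from
  \<open>ln_kernel_nn_integral\<close> and the order exchanged; for each y the t-integral is 2 pi a
  n / y minus the Poisson integral, which is the integrand of
  \<open>li_kernel_tail_nn_integral\<close>.\<close>

lemma nn_integral_li_kernel_ln:
  assumes a: "a > 0" and n: "n > 0"
  shows "(\<integral>\<^sup>+t. ennreal (li_kernel a n 0 t * (ln (t ^ 2 + a ^ 2) / 2 - ln a)) \<partial>lborel) = ennreal (2 * pi * a * n * (ln 2 + harm n - 1))"
proof -
  note [measurable] = borel_measurable_li_kernel[OF a order_refl]
  have f0: "li_kernel a n 0 t \<ge> 0" for t using li_kernel_bounds[OF a order_refl] by blast
  have k0: "1 / y - y / (y ^ 2 + t ^ 2) \<ge> 0" if "y \<ge> a" for y t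
    using that a by (intro ln_kernel_nonneg) simp
  have "(\<integral>\<^sup>+t. ennreal (li_kernel a n 0 t * (ln (t ^ 2 + a ^ 2) / 2 - ln a)) \<partial>lborel)
    = (\<integral>\<^sup>+t. \<integral>\<^sup>+y. ennreal (li_kernel a n 0 t) * (ennreal (1 / y - y / (y ^ 2 + t ^ 2)) * indicator {a..} y) \<partial>lborel \<partial>lborel)"
  proof (intro nn_integral_cong)
    fix t
    show "ennreal (li_kernel a n 0 t * (ln (t ^ 2 + a ^ 2) / 2 - ln a)) = (\<integral>\<^sup>+y. ennreal (li_kernel a n 0 t) * (ennreal (1 / y - y / (y ^ 2 + t ^ 2)) * indicator {a..} y) \<partial>lborel)"
      using ln_kernel_nn_integral[OF a, of t] f0[of t] by (subst nn_integral_cmult) (auto simp: ennreal_mult')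
  qed
  also have "\<dots> = (\<integral>\<^sup>+y. \<integral>\<^sup>+t. ennreal (li_kernel a n 0 t) * (ennreal (1 / y - y / (y ^ 2 + t ^ 2)) * indicator {a..} y) \<partial>lborel \<partial>lborel)"
    by (rule lborel_pair.Fubini') measurable
  also have "\<dots> = (\<integral>\<^sup>+y. ennreal (2 * pi * a * n / y - pi * (1 - ((y - a) / (y + a)) ^ n)) * indicator {a..} y \<partial>lborel)"
  proof (intro nn_integral_cong)
    fix y
    show "(\<integral>\<^sup>+t. ennreal (li_kernel a n 0 t) * (ennreal (1 / y - y / (y ^ 2 + t ^ 2)) * indicator {a..} y) \<partial>lborel)
      = ennreal (2 * pi * a * n / y - pi * (1 - ((y - a) / (y + a)) ^ n)) * indicator {a..} y"
    proof (cases "y \<ge> a")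
      case True
      then have y: "y > 0" using a by linarith
      let ?X = "\<integral>\<^sup>+t. ennreal (li_kernel a n 0 t) * ennreal (1 / y - y / (y ^ 2 + t ^ 2)) \<partial>lborel"
      have u: "li_kernel a n y 0 = 1 - ((y - a) / (y + a)) ^ n" by (rule li_kernel_at_0[OF a y])
      have u0: "pi * li_kernel a n y 0 \<ge> 0" using li_kernel_bounds[OF a, of y n 0] y by simp
      \<comment> \<open>The Poisson part is added before it is subtracted, since on
        \<open>ennreal\<close> only a finite summand can be cancelled; with it the integrand
        collapses to 1 / y times \<open>li_kernel\<close>.\<close>
      have "?X + ennreal (pi * li_kernel a n y 0) = ?X + (\<integral>\<^sup>+t. ennreal (li_kernel a n 0 t * (y / (y ^ 2 + (t - 0) ^ 2))) \<partial>lborel)"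
        unfolding Poisson_integral_li_kernel[OF a y] ..
      also have "\<dots> = (\<integral>\<^sup>+t. ennreal (li_kernel a n 0 t) * ennreal (1 / y - y / (y ^ 2 + t ^ 2)) + ennreal (li_kernel a n 0 t * (y / (y ^ 2 + (t - 0) ^ 2))) \<partial>lborel)"
        by (rule nn_integral_add[symmetric]) measurable
      also have "\<dots> = (\<integral>\<^sup>+t. ennreal (1 / y) * ennreal (li_kernel a n 0 t) \<partial>lborel)"
      proof (intro nn_integral_cong)
        fix t
        have "ennreal (li_kernel a n 0 t) * ennreal (1 / y - y / (y ^ 2 + t ^ 2)) + ennreal (li_kernel a n 0 t * (y / (y ^ 2 + (t - 0) ^ 2)))
          = ennreal (li_kernel a n 0 t * (1 / y - y / (y ^ 2 + t ^ 2)) + li_kernel a n 0 t * (y / (y ^ 2 + t ^ 2)))"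
          using f0[of t] k0[OF True, of t] y by (simp add: ennreal_mult'[symmetric] ennreal_plus[symmetric] del: ennreal_plus)
        also have "li_kernel a n 0 t * (1 / y - y / (y ^ 2 + t ^ 2)) + li_kernel a n 0 t * (y / (y ^ 2 + t ^ 2)) = 1 / y * li_kernel a n 0 t"
          by (simp add: algebra_simps)
        also have "ennreal \<dots> = ennreal (1 / y) * ennreal (li_kernel a n 0 t)" using y by (intro ennreal_mult') auto
        finally show "ennreal (li_kernel a n 0 t) * ennreal (1 / y - y / (y ^ 2 + t ^ 2)) + ennreal (li_kernel a n 0 t * (y / (y ^ 2 + (t - 0) ^ 2))) = ennreal (1 / y) * ennreal (li_kernel a n 0 t)" .
      qed
      also have "\<dots> = ennreal (1 / y) * ennreal (2 * pi * a * n)"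
        unfolding nn_integral_li_kernel[OF a, symmetric] by (rule nn_integral_cmult) measurable
      also have "\<dots> = ennreal (2 * pi * a * n / y)" using y by (simp add: ennreal_mult'[symmetric])
      finally have "?X + ennreal (pi * li_kernel a n y 0) = ennreal (2 * pi * a * n / y)" .
      moreover have "?X = (?X + ennreal (pi * li_kernel a n y 0)) - ennreal (pi * li_kernel a n y 0)"
        by (rule ennreal_add_diff_cancel_right[symmetric]) simp
      ultimately have "?X = ennreal (2 * pi * a * n / y) - ennreal (pi * li_kernel a n y 0)"
        by (simp only:)
      also have "\<dots> = ennreal (2 * pi * a * n / y - pi * li_kernel a n y 0)" using u0 by (rule ennreal_minus)
      finally show ?thesis using True unfolding u by simp
    qed simp
  qed
  also have "\<dots> = ennreal (2 * pi * a * n * (ln 2 + harm n - 1))" by (rule li_kernel_tail_nn_integral[OF a n])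
  finally show ?thesis .
qed

text \<open>Split at |t| = sqrt n: inside, the bound 2 on an interval of length 2 sqrt n gives 4
  sqrt n; outside, 1 / (1 + |t|) is at most 1 / sqrt n and the total integral is 2 pi a n.\<close>

lemma nn_integral_li_kernel_over_linear:
  assumes a: "a > 0" and n: "n > 0"
  shows "(\<integral>\<^sup>+t. ennreal (li_kernel a n 0 t / (1 + \<bar>t\<bar>)) \<partial>lborel) \<le> ennreal ((4 + 2 * pi * a) * sqrt n)"
proof -
  note [measurable] = borel_measurable_li_kernel[OF a order_refl]
  have f: "0 \<le> li_kernel a n 0 t" "li_kernel a n 0 t \<le> 2" for t using li_kernel_bounds[OF a order_refl] by blast+
  define M where "M = sqrt n"
  have M: "M > 0" using n by (simp add: M_def)
  have "(\<integral>\<^sup>+t. ennreal (li_kernel a n 0 t / (1 + \<bar>t\<bar>)) \<partial>lborel) \<le> (\<integral>\<^sup>+t. ennreal 2 * indicator {- M..M} t + ennreal (1 / M) * ennreal (li_kernel a n 0 t) \<partial>lborel)"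
  proof (intro nn_integral_mono)
    fix t
    show "ennreal (li_kernel a n 0 t / (1 + \<bar>t\<bar>)) \<le> ennreal 2 * indicator {- M..M} t + ennreal (1 / M) * ennreal (li_kernel a n 0 t)"
    proof (cases "t \<in> {- M..M}")
      case True
      have "li_kernel a n 0 t / (1 + \<bar>t\<bar>) \<le> li_kernel a n 0 t / 1" using f by (intro divide_left_mono) auto
      then have "ennreal (li_kernel a n 0 t / (1 + \<bar>t\<bar>)) \<le> ennreal 2" using f[of t] by (intro ennreal_leI) simp
      also have "\<dots> \<le> ennreal 2 * indicator {- M..M} t + ennreal (1 / M) * ennreal (li_kernel a n 0 t)" using True by simp
      finally show ?thesis .
    next
      case False
      then have "M \<le> 1 + \<bar>t\<bar>" by auto
      then have "li_kernel a n 0 t / (1 + \<bar>t\<bar>) \<le> li_kernel a n 0 t / M" using f M by (intro divide_left_mono) auto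
      also have "\<dots> = 1 / M * li_kernel a n 0 t" by simp
      finally have "ennreal (li_kernel a n 0 t / (1 + \<bar>t\<bar>)) \<le> ennreal (1 / M * li_kernel a n 0 t)" by (rule ennreal_leI)
      also have "\<dots> = ennreal (1 / M) * ennreal (li_kernel a n 0 t)" using M by (intro ennreal_mult') auto
      finally show ?thesis using False by simp
    qed
  qed
  also have "\<dots> = (\<integral>\<^sup>+t. ennreal 2 * indicator {- M..M} t \<partial>lborel) + (\<integral>\<^sup>+t. ennreal (1 / M) * ennreal (li_kernel a n 0 t) \<partial>lborel)"
    by (rule nn_integral_add) measurable
  also have "(\<integral>\<^sup>+t. ennreal 2 * indicator {- M..M} t \<partial>lborel) = ennreal (4 * M)"
  proof -
    have "(\<integral>\<^sup>+t. ennreal 2 * indicator {- M..M} t \<partial>lborel) = ennreal 2 * emeasure lborel {- M..M}"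
      by (rule nn_integral_cmult_indicator) simp
    also have "emeasure lborel {- M..M} = ennreal (2 * M)" using M by simp
    also have "ennreal 2 * ennreal (2 * M) = ennreal (4 * M)" using M by (subst ennreal_mult'[symmetric]) auto
    finally show ?thesis .
  qed
  also have "(\<integral>\<^sup>+t. ennreal (1 / M) * ennreal (li_kernel a n 0 t) \<partial>lborel) = ennreal (1 / M) * ennreal (2 * pi * a * n)"
    unfolding nn_integral_li_kernel[OF a, symmetric] by (rule nn_integral_cmult) measurable
  also have "\<dots> = ennreal (2 * pi * a * M)"
  proof -
    have "1 / M * (2 * pi * a * n) = 2 * pi * a * M"
      using M real_sqrt_pow2[of "real n"] by (simp add: M_def field_simps power2_eq_square)
    then show ?thesis using M by (subst ennreal_mult'[symmetric]) auto
  qed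
  also have "ennreal (4 * M) + ennreal (2 * pi * a * M) = ennreal ((4 + 2 * pi * a) * M)"
    using M a by (subst ennreal_plus[symmetric]) (auto simp: algebra_simps)
  finally show ?thesis unfolding M_def .
qed

subsection \<open>The logarithmic derivative of the completed zeta function\<close>

lemma norm_Gamma_le: 
  assumes "Re z > 0"
  shows "norm (Gamma z) \<le> Gamma (Re z)"
proof -
  have c: "((\<lambda>t. of_real t powr (z - 1) / of_real (exp t)) has_integral Gamma z) {0..}"
    by (rule Gamma_integral_complex[OF assms])
  have r: "((\<lambda>t. t powr (Re z - 1) / exp t) has_integral Gamma (Re z)) {0..}"
    by (rule Gamma_integral_real[OF assms])
  have "norm (integral {0..} (\<lambda>t. of_real t powr (z - 1) / of_real (exp t))) \<le> integral {0..} (\<lambda>t. t powr (Re z - 1) / exp t)"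
    by (rule integral_norm_bound_integral) (use c r in \<open>auto simp: has_integral_integrable norm_divide norm_powr_real_powr\<close>)
  then show ?thesis using c r by (simp add: integral_unique)
qed

definition xi_center :: "complex \<Rightarrow> complex" where
  "xi_center w = xi (1 / 2 + w)"

lemma xi_center_holomorphic: "xi_center holomorphic_on A"
proof -
  have "(xi \<circ> (\<lambda>w. 1 / 2 + w)) holomorphic_on A"
    by (rule holomorphic_on_compose_gen[OF _ xi_holomorphic[of UNIV]]) (auto intro!: holomorphic_intros)
  then show ?thesis by (simp add: xi_center_def[abs_def] o_def)
qed

lemma xi_center_even: "xi_center (- w) = xi_center w"
  using xi_functional_equation[of "1 / 2 + w"] by (simp add: xi_center_def algebra_simps)

text \<open>Deliberately crude: a cubic, a factor of modulus at most 1 and a Gamma value below a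
  factorial. The logarithm is of size R ln R, while o(R^2) is all the partial fractions ask for.
  Evenness reduces to Re w >= 0.\<close>

lemma xi_center_growth:
  obtains M :: "nat \<Rightarrow> real" where
    "\<And>R w. norm w \<le> real R \<Longrightarrow> norm (xi_center w) \<le> M R" "(\<lambda>R. ln (M R) / real R ^ 2) \<longlonglongrightarrow> 0"
proof -
  obtain C where C: "C > 0" "\<And>s. Re s \<ge> 1 / 2 \<Longrightarrow> norm (zeta_W s) \<le> C * (1 + norm s) ^ 3"
    using zeta_W_bound by blast
  define M where "M = (\<lambda>R::nat. C * (real R + 2) ^ 3 * real (R + 2) ^ (R + 2))"
  have pos: "norm (xi_center w) \<le> M R" if w: "norm w \<le> real R" "Re w \<ge> 0" for w R
  proof -
    define s where "s = 1 / 2 + w"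
    have s: "Re s \<ge> 1 / 2" using w by (simp add: s_def)
    have ns: "norm s \<le> real R + 1" using w norm_triangle_ineq[of "1 / 2" w] by (simp add: s_def)
    have Rs: "Re s \<le> real R + 1" using ns complex_Re_le_cmod[of s] by linarith
    have W: "norm (zeta_W s) \<le> C * (real R + 2) ^ 3"
    proof -
      have "norm (zeta_W s) \<le> C * (1 + norm s) ^ 3" by (rule C(2)[OF s])
      also have "\<dots> \<le> C * (real R + 2) ^ 3" using ns C(1) by (intro mult_left_mono power_mono) auto
      finally show ?thesis .
    qed
    have P: "norm (of_real pi powr (- s / 2) :: complex) \<le> 1"
    proof -
      have "norm (of_real pi powr (- s / 2) :: complex) = pi powr (- Re s / 2)" by (simp add: norm_powr_real_powr)
      also have "\<dots> \<le> pi powr 0" using s pi_gt3 by (intro powr_mono) auto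
      finally show ?thesis by simp
    qed
    have G: "norm (Gamma (s / 2 + 1)) \<le> real (R + 2) ^ (R + 2)"
    proof -
      define x where "x = Re s / 2 + 1"
      have x: "x \<ge> 5 / 4" "x \<le> real R / 2 + 3 / 2" using s Rs by (auto simp: x_def)
      have "norm (Gamma (s / 2 + 1)) \<le> Gamma x" using norm_Gamma_le[of "s / 2 + 1"] s by (simp add: x_def)
      \<comment> \<open>As x >= 1, the argument may be raised by 1, into the range where Gamma is
        increasing.\<close>
      also have "\<dots> \<le> x * Gamma x" using mult_right_mono[of 1 x "Gamma x"] x by simp
      also have "x * Gamma x = Gamma (x + 1)"
      proof -
        have "x \<notin> \<int>\<^sub>\<le>\<^sub>0" using x by (auto elim!: nonpos_Ints_cases)
        then show ?thesis by (rule Gamma_plus1[symmetric])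
      qed
      also have "\<dots> \<le> Gamma (1 + real (R + 2))"
      proof (cases "x + 1 = 1 + real (R + 2)")
        case False
        then show ?thesis using x by (intro less_imp_le Gamma_real_strict_mono) auto
      qed simp
      also have "\<dots> = fact (R + 2)" by (rule Gamma_fact)
      also have "\<dots> \<le> real ((R + 2) ^ (R + 2))" by (rule fact_le_power)
      finally show ?thesis by (simp only: of_nat_power)
    qed
    have "norm (xi_center w) = norm (zeta_W s) * norm (of_real pi powr (- s / 2) :: complex) * norm (Gamma (s / 2 + 1))"
      unfolding xi_center_def s_def[symmetric] using s by (simp add: xi_def xi_half_def norm_mult)
    also have "\<dots> \<le> (C * (real R + 2) ^ 3) * 1 * real (R + 2) ^ (R + 2)"
      using C(1) by (intro mult_mono W P G) auto
    finally show ?thesis by (simp add: M_def)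
  qed
  have bd: "norm (xi_center w) \<le> M R" if "norm w \<le> real R" for w R
    using pos[of w R] pos[of "- w" R] that by (cases "Re w \<ge> 0") (auto simp: xi_center_even)
  have "(\<lambda>R. (ln C + 3 * ln (real R + 2) + (real R + 2) * ln (real R + 2)) / real R ^ 2) \<longlonglongrightarrow> 0" by real_asymp
  moreover have "ln (M R) = ln C + 3 * ln (real R + 2) + (real R + 2) * ln (real R + 2)" for R
  proof -
    have "ln (M R) = ln C + ln ((real R + 2) ^ 3) + ln ((real R + 2) ^ (R + 2))"
    proof -
      have "ln (C * x ^ 3 * x ^ k) = ln C + ln (x ^ 3) + ln (x ^ k)" if "x > 0" for x :: real and k
        using that C(1) by (simp add: ln_mult_pos)
      from this[of "real R + 2" "R + 2"] show ?thesis by (simp only: M_def of_nat_add of_nat_numeral)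
    qed
    also have "ln ((real R + 2) ^ 3) = 3 * ln (real R + 2)" by (subst ln_realpow) auto
    also have "ln ((real R + 2) ^ (R + 2)) = real (R + 2) * ln (real R + 2)" by (subst ln_realpow) auto
    finally show ?thesis by simp
  qed
  ultimately have "(\<lambda>R. ln (M R) / real R ^ 2) \<longlonglongrightarrow> 0" by simp
  note lim = this
  show ?thesis
  proof (rule that[of M])
    show "norm (xi_center w) \<le> M R" if "norm w \<le> real R" for R w using that by (rule bd)
  qed (rule lim)
qed

text \<open>Digamma z is the limit of ln m minus the sum of 1 / (z + k). Replacing ln m by the
  telescoping sum of ln |z + k + 1| - ln |z + k| leaves terms Re (Ln (1 + v) - v) with v = 1 / (z +
  k), which are quadratically small.\<close>

lemma Re_Digamma_approx:
  assumes z: "Re z \<ge> 2"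
  shows "\<bar>Re (Digamma z) - ln (norm z)\<bar> \<le> 8 / norm z"
proof -
  have nz: "norm z \<ge> 2" using z complex_Re_le_cmod[of z] by linarith
  define d where "d = (\<lambda>k. ln (norm (z + of_nat (Suc k))) - ln (norm (z + of_nat k)) - Re (inverse (z + of_nat k)))"
  have dk: "\<bar>d k\<bar> \<le> 4 * (1 / (norm z + real k - 1) - 1 / (norm z + real (Suc k) - 1))" for k
  proof -
    define u v where "u = z + of_nat k" and "v = inverse u"
    have Reu: "Re u \<ge> 2" using z by (simp add: u_def)
    then have nu: "norm u \<ge> 2" using complex_Re_le_cmod[of u] by linarith
    have u0: "u \<noteq> 0" using nu by auto
    have nve: "norm v = 1 / norm u" unfolding v_def norm_inverse by (rule inverse_eq_divide)
    have nv: "norm v \<le> 1 / 2" unfolding nve using nu by (intro divide_left_mono) auto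
    have v1: "1 + v \<noteq> 0"
    proof
      assume "1 + v = 0"
      then have "v = - 1" by (simp add: eq_neg_iff_add_eq_0 add.commute)
      then show False using nv by simp
    qed
    have "u * (1 + v) = u + 1" using u0 by (simp add: v_def distrib_left)
    then have "z + of_nat (Suc k) = u * (1 + v)" by (simp add: u_def)
    then have "d k = Re (Ln (1 + v) - v)"
      unfolding d_def u_def[symmetric] using u0 v1 by (simp add: norm_mult ln_mult_pos Re_Ln v_def[symmetric])
    then have "\<bar>d k\<bar> \<le> norm (Ln (1 + v) - v)" using abs_Re_le_cmod by metis
    also have "\<dots> \<le> norm v ^ 2 / (1 - norm v)" using nv by (intro Ln_approx_linear) auto
    also have "\<dots> \<le> norm v ^ 2 / (1 / 2)" using nv by (intro divide_left_mono) auto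
    also have "\<dots> = 2 / norm u ^ 2" unfolding nve by (simp add: power_divide)
    \<comment> \<open>As Re z > 0, |z + k|^2 >= |z|^2 + k^2 >= (|z| + k)^2 / 2; the following steps
      weaken this to a telescoping difference.\<close>
    also have "\<dots> \<le> 2 / ((norm z + real k) ^ 2 / 2)"
    proof (intro divide_left_mono)
      have "norm u ^ 2 = norm z ^ 2 + 2 * real k * Re z + (real k) ^ 2"
        unfolding u_def cmod_power2 by (simp add: power2_eq_square algebra_simps)
      moreover have "2 * real k * Re z \<ge> 0" using z by simp
      moreover have "2 * norm z * real k \<le> norm z ^ 2 + (real k) ^ 2"
        using sum_squares_bound[of "norm z" "real k"] by simp
      moreover have "(norm z + real k) ^ 2 = norm z ^ 2 + (real k) ^ 2 + 2 * norm z * real k" by (rule power2_sum)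
      ultimately show "(norm z + real k) ^ 2 / 2 \<le> norm u ^ 2" by linarith
      have "norm z + real k > 0" using nz by linarith
      then show "0 < norm u ^ 2 * ((norm z + real k) ^ 2 / 2)" using u0 by simp
    qed simp
    also have "\<dots> = 4 / ((norm z + real k) * (norm z + real k))" by (simp add: power2_eq_square)
    also have "\<dots> \<le> 4 / ((norm z + real k - 1) * (norm z + real k))"
      using nz by (intro divide_left_mono mult_right_mono) auto
    also have "\<dots> = 4 * (1 / (norm z + real k - 1) - 1 / (norm z + real (Suc k) - 1))"
      using nz by (simp add: divide_simps)
    finally show ?thesis .
  qed
  have part: "\<bar>\<Sum>k<m. d k\<bar> \<le> 8 / norm z" for m
  proof -
    have "\<bar>\<Sum>k<m. d k\<bar> \<le> (\<Sum>k<m. 4 * (1 / (norm z + real k - 1) - 1 / (norm z + real (Suc k) - 1)))"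
      by (rule order_trans[OF sum_abs sum_mono]) (rule dk)
    also have "\<dots> = 4 * (1 / (norm z - 1) - 1 / (norm z + real m - 1))"
      unfolding sum_distrib_left[symmetric] by (induction m) (simp_all add: algebra_simps)
    also have "\<dots> \<le> 4 * (1 / (norm z - 1))" using nz by simp
    also have "1 / (norm z - 1) \<le> 1 / (norm z / 2)" using nz by (intro frac_le) auto
    finally show ?thesis by simp
  qed
  have "(\<lambda>m. Re (of_real (ln (real m)) - (\<Sum>n<m. inverse (z + of_nat n)))) \<longlonglongrightarrow> Re (Digamma z)"
    using nz by (intro tendsto_Re Digamma_LIMSEQ) auto
  moreover have "(\<lambda>m. ln (norm (z + of_nat m)) - ln (real m)) \<longlonglongrightarrow> 0"
  proof -
    have "(\<lambda>m. z / of_nat m + 1) \<longlonglongrightarrow> 0 + 1"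
      by (intro tendsto_intros tendsto_divide_0[OF tendsto_const] tendsto_of_nat)
    then have "(\<lambda>m. ln (norm (z / of_nat m + 1))) \<longlonglongrightarrow> ln (norm (0 + 1 :: complex))"
      by (intro tendsto_ln tendsto_norm) auto
    then have "(\<lambda>m. ln (norm (z / of_nat m + 1))) \<longlonglongrightarrow> 0" by simp
    then show ?thesis
    proof (rule Lim_transform_eventually)
      show "\<forall>\<^sub>F m in sequentially. ln (norm (z / of_nat m + 1)) = ln (norm (z + of_nat m)) - ln (real m)"
      proof (rule eventually_sequentiallyI[of 1])
        fix m :: nat assume m: "m \<ge> 1"
        have "Re (z + of_nat m) > 0" using z by simp
        then have "z + of_nat m \<noteq> 0" by force
        moreover have "z / of_nat m + 1 = (z + of_nat m) / of_nat m" using m by (simp add: field_simps)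
        ultimately show "ln (norm (z / of_nat m + 1)) = ln (norm (z + of_nat m)) - ln (real m)"
          using m by (simp add: norm_divide ln_div)
      qed
    qed
  qed
  ultimately have "(\<lambda>m. Re (of_real (ln (real m)) - (\<Sum>n<m. inverse (z + of_nat n))) + (ln (norm (z + of_nat m)) - ln (real m)) - ln (norm z))
      \<longlonglongrightarrow> Re (Digamma z) + 0 - ln (norm z)"
    by (rule tendsto_diff[OF tendsto_add tendsto_const])
  moreover have "Re (of_real (ln (real m)) - (\<Sum>n<m. inverse (z + of_nat n))) + (ln (norm (z + of_nat m)) - ln (real m)) - ln (norm z) = (\<Sum>k<m. d k)" for m
  proof -
    have "(\<Sum>k<m. ln (norm (z + of_nat (Suc k))) - ln (norm (z + of_nat k))) = ln (norm (z + of_nat m)) - ln (norm z)"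
      by (subst sum_lessThan_telescope) simp
    then show ?thesis unfolding d_def sum_subtractf by simp
  qed
  ultimately have "(\<lambda>m. \<Sum>k<m. d k) \<longlonglongrightarrow> Re (Digamma z) - ln (norm z)" by simp
  then have "(\<lambda>m. \<bar>\<Sum>k<m. d k\<bar>) \<longlonglongrightarrow> \<bar>Re (Digamma z) - ln (norm z)\<bar>" by (rule tendsto_rabs)
  then show ?thesis by (rule LIMSEQ_le_const2) (use part in blast)
qed

text \<open>For m >= 2, m powr - Re s is at most 4 * 2 powr - Re s times 1 / m^2, and the inverse
  squares from 2 on sum to pi^2 / 6 - 1 <= 1. The exponential decay in Re s is what later makes the
  linear error term small.\<close>

lemma zeta_W_div_minus_1_le:
  assumes s: "Re s \<ge> 2"
  shows "norm (zeta_W s / (s - 1) - 1) \<le> 4 * 2 powr - Re s"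
proof -
  have s1: "s \<noteq> 1" using s by auto
  have "(\<lambda>n. ((s - 1) * (1 / of_nat (Suc n) powr s)) / (s - 1)) sums (zeta_W s / (s - 1))"
    using s by (intro sums_divide zeta_W_sums) simp
  then have "(\<lambda>n. 1 / of_nat (Suc n) powr s) sums (zeta_W s / (s - 1))" using s1 by simp
  then have S: "(\<lambda>n. 1 / of_nat (Suc (Suc n)) powr s) sums (zeta_W s / (s - 1) - 1)"
    by (subst sums_Suc_iff) simp
  have q: "(\<lambda>n. 1 / real (n + 1) ^ 2) sums (pi ^ 2 / 6)" using inverse_squares_sums by (simp add: add.commute)
  then have "(\<lambda>n. 1 / real (Suc n + 1) ^ 2) sums (pi ^ 2 / 6 - 1)" by (subst sums_Suc_iff) simp
  then have Q: "(\<lambda>n. 4 * 2 powr - Re s * (1 / real (Suc (Suc n)) ^ 2)) sums (4 * 2 powr - Re s * (pi ^ 2 / 6 - 1))"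
    by (intro sums_mult) simp
  have "norm (zeta_W s / (s - 1) - 1) \<le> 4 * 2 powr - Re s * (pi ^ 2 / 6 - 1)"
  proof -
    have t: "norm (1 / of_nat (Suc (Suc n)) powr s) \<le> 4 * 2 powr - Re s * (1 / real (Suc (Suc n)) ^ 2)" for n
    proof -
      define m where "m = real (Suc (Suc n))"
      have m: "m \<ge> 2" by (simp add: m_def)
      have "norm (1 / of_nat (Suc (Suc n)) powr s) = m powr - Re s"
        using norm_powr_real_powr[of "of_nat (Suc (Suc n))" s] by (simp add: m_def norm_divide powr_minus_divide del: of_nat_Suc)
      also have "\<dots> = m powr - (Re s - 2) * (1 / m ^ 2)"
        using m by (simp add: powr_diff powr_minus field_simps)
      finally have e: "norm (1 / of_nat (Suc (Suc n)) powr s) = m powr - (Re s - 2) * (1 / m ^ 2)" .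
      have "m powr - (Re s - 2) \<le> 2 powr - (Re s - 2)" using m s by (intro powr_mono2') auto
      also have "2 powr - (Re s - 2) = 4 * 2 powr - Re s" by (simp add: powr_diff powr_minus field_simps)
      finally have "m powr - (Re s - 2) * (1 / m ^ 2) \<le> 4 * 2 powr - Re s * (1 / m ^ 2)" by (rule mult_right_mono) simp
      then show ?thesis unfolding e by (simp only: m_def)
    qed
    have "norm (\<Sum>n. 1 / of_nat (Suc (Suc n)) powr s) \<le> (\<Sum>n. 4 * 2 powr - Re s * (1 / real (Suc (Suc n)) ^ 2))"
      by (rule norm_suminf_le[OF t sums_summable[OF Q]])
    then show ?thesis using S Q by (simp only: sums_unique[symmetric])
  qed
  also have "\<dots> \<le> 4 * 2 powr - Re s * 1"
  proof (intro mult_left_mono)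
    have "pi \<le> 32 / 10" using pi_approx by simp
    then have "pi ^ 2 \<le> (32 / 10) ^ 2" by (intro power_mono) auto
    then show "pi ^ 2 / 6 - 1 \<le> 1" by (simp add: power2_eq_square)
  qed simp
  finally show ?thesis by simp
qed

text \<open>Cauchy's estimate on a disc of radius 1 costs a factor 2 in 2 powr - Re s, and Re s >= 4
  keeps \<open>zeta_W s / (s - 1)\<close> within 1/4 of 1, so its modulus is at least 1/2; together
  4 * 2 * 2 = 16.\<close>

lemma zeta_W_log_deriv:
  assumes s: "Re s \<ge> 4"
  shows "norm (deriv zeta_W s / zeta_W s - 1 / (s - 1)) \<le> 16 * 2 powr - Re s" "zeta_W s \<noteq> 0"
proof -
  define Z where "Z = (\<lambda>s. zeta_W s / (s - 1))"
  have s1: "s - 1 \<noteq> 0" using s by auto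
  have Zhol: "Z holomorphic_on {s. Re s > 1}"
    unfolding Z_def by (intro holomorphic_on_divide holomorphic_on_subset[OF zeta_W_holomorphic] holomorphic_intros) auto
  have "norm (Z s - 1) \<le> 4 * 2 powr - Re s" unfolding Z_def using s by (intro zeta_W_div_minus_1_le) simp
  also have "\<dots> \<le> 4 * 2 powr - 4" using s by (intro mult_left_mono powr_mono) auto
  also have "\<dots> = 1 / 4" by (simp add: powr_minus)
  finally have Z1: "norm (Z s - 1) \<le> 1 / 4" .
  then have Zl: "norm (Z s) \<ge> 1 / 2" using norm_triangle_ineq2[of 1 "1 - Z s"] by (simp add: norm_minus_commute)
  show W0: "zeta_W s \<noteq> 0" using Zl by (auto simp: Z_def)
  have Re1: "Re u \<ge> Re s - 1" if "dist s u \<le> 1" for u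
    using that abs_Re_le_cmod[of "s - u"] by (simp add: dist_norm)
  have "norm ((deriv ^^ 1) (\<lambda>u. Z u - 1) s) \<le> fact 1 * (4 * 2 powr - (Re s - 1)) / 1 ^ 1"
  proof (rule Cauchy_inequality)
    have sub: "cball s 1 \<subseteq> {s. Re s > 1}" using Re1 s by fastforce
    have h: "(\<lambda>u. Z u - 1) holomorphic_on cball s 1"
      by (intro holomorphic_intros holomorphic_on_subset[OF Zhol sub])
    show "(\<lambda>u. Z u - 1) holomorphic_on ball s 1" by (rule holomorphic_on_subset[OF h]) auto
    show "continuous_on (cball s 1) (\<lambda>u. Z u - 1)" by (rule holomorphic_on_imp_continuous_on[OF h])
    fix u assume "norm (s - u) = 1"
    then have u: "Re u \<ge> Re s - 1" using Re1[of u] by (simp add: dist_norm)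
    have "norm (Z u - 1) \<le> 4 * 2 powr - Re u" unfolding Z_def using u s by (intro zeta_W_div_minus_1_le) simp
    also have "\<dots> \<le> 4 * 2 powr - (Re s - 1)" using u by (intro mult_left_mono powr_mono) auto
    finally show "norm (Z u - 1) \<le> 4 * 2 powr - (Re s - 1)" .
  qed simp
  moreover have Zd: "(Z has_field_derivative deriv Z s) (at s)"
    using Zhol s by (intro holomorphic_derivI[of _ "{s. Re s > 1}"] open_halfspace_Re_gt) auto
  then have "deriv (\<lambda>u. Z u - 1) s = deriv Z s"
    by (intro DERIV_imp_deriv) (auto intro!: derivative_eq_intros)
  moreover have "2 powr - (Re s - 1) = 2 * 2 powr - Re s" by (simp add: powr_diff powr_minus field_simps)
  ultimately have dZ: "norm (deriv Z s) \<le> 8 * 2 powr - Re s" by simp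
  have Wd: "(zeta_W has_field_derivative deriv zeta_W s) (at s)"
    using s by (intro holomorphic_derivI[OF zeta_W_holomorphic] open_halfspace_Re_gt) auto
  have "(Z has_field_derivative (deriv zeta_W s * (s - 1) - zeta_W s * 1) / ((s - 1) * (s - 1))) (at s)"
    unfolding Z_def using s1 by (intro DERIV_divide Wd) (auto intro!: derivative_eq_intros)
  then have "deriv Z s = (deriv zeta_W s * (s - 1) - zeta_W s * 1) / ((s - 1) * (s - 1))" by (rule DERIV_imp_deriv)
  moreover define q where "q = s - 1"
  ultimately have dq: "deriv Z s = (deriv zeta_W s * q - zeta_W s) / (q * q)" by simp
  have Zq: "Z s = zeta_W s / q" by (simp add: Z_def q_def)
  have "deriv zeta_W s / zeta_W s - 1 / q = deriv Z s / Z s"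
  proof -
    have "Z s \<noteq> 0" using Zl by auto
    moreover have "q \<noteq> 0" using s1 by (simp add: q_def)
    ultimately show ?thesis using W0 unfolding dq Zq by (simp add: field_simps)
  qed
  then have "deriv zeta_W s / zeta_W s - 1 / (s - 1) = deriv Z s / Z s" by (simp only: q_def)
  then have "norm (deriv zeta_W s / zeta_W s - 1 / (s - 1)) = norm (deriv Z s) / norm (Z s)" by (simp add: norm_divide)
  also have "\<dots> \<le> (8 * 2 powr - Re s) / (1 / 2)" using dZ Zl by (intro frac_le) auto
  finally show "norm (deriv zeta_W s / zeta_W s - 1 / (s - 1)) \<le> 16 * 2 powr - Re s" by simp
qed

lemma xi_log_deriv:
  assumes s: "Re s \<ge> 4"
  shows "deriv xi s / xi s = deriv zeta_W s / zeta_W s - of_real (ln pi) / 2 + Digamma (s / 2 + 1) / 2"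
proof -
  have W0: "zeta_W s \<noteq> 0" by (rule zeta_W_log_deriv(2)[OF s])
  have nI: "s / 2 + 1 \<notin> \<int>\<^sub>\<le>\<^sub>0" using Gamma_half_plus_one_not_pole[of s] s by simp
  define P G where "P = (of_real pi powr (- s / 2) :: complex)" and "G = Gamma (s / 2 + 1)"
  have PG: "P \<noteq> 0" "G \<noteq> 0" using nI by (auto simp: P_def G_def Gamma_eq_zero_iff)
  have Wd: "(zeta_W has_field_derivative deriv zeta_W s) (at s)"
    using s by (intro holomorphic_derivI[OF zeta_W_holomorphic] open_halfspace_Re_gt) auto
  have Pd: "((\<lambda>s. of_real pi powr (- s / 2)) has_field_derivative P * (- of_real (ln pi) / 2)) (at s)"
  proof -
    have "((\<lambda>z. of_real pi powr z) has_field_derivative Ln (of_real pi) * of_real pi powr (- s / 2)) (at (- s / 2))"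
      by (rule has_field_derivative_powr_right) simp
    moreover have "((\<lambda>s. - s / 2) has_field_derivative - 1 / 2) (at s)" by (auto intro!: derivative_eq_intros)
    ultimately have "((\<lambda>s. of_real pi powr (- s / 2)) has_field_derivative Ln (of_real pi) * of_real pi powr (- s / 2) * (- 1 / 2)) (at s)"
      by (rule DERIV_chain2)
    then show ?thesis by (simp add: P_def Ln_of_real mult_ac)
  qed
  have "((\<lambda>s. Gamma (s / 2 + 1)) has_field_derivative (Gamma (s / 2 + 1) * Digamma (s / 2 + 1)) * (1 / 2)) (at s)"
    by (rule DERIV_chain2[of Gamma]) (use nI in \<open>auto intro!: derivative_eq_intros\<close>)
  then have Gd: "((\<lambda>s. Gamma (s / 2 + 1)) has_field_derivative G * (Digamma (s / 2 + 1) / 2)) (at s)"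
    by (simp add: G_def)
  have "((\<lambda>s. zeta_W s * of_real pi powr (- s / 2) * Gamma (s / 2 + 1)) has_field_derivative
     (deriv zeta_W s * P + P * (- of_real (ln pi) / 2) * zeta_W s) * G + G * (Digamma (s / 2 + 1) / 2) * (zeta_W s * P)) (at s)"
    using DERIV_mult[OF DERIV_mult[OF Wd Pd] Gd] by (simp only: P_def G_def)
  then have "(xi has_field_derivative
     (deriv zeta_W s * P + P * (- of_real (ln pi) / 2) * zeta_W s) * G + G * (Digamma (s / 2 + 1) / 2) * (zeta_W s * P)) (at s)"
  proof (rule has_field_derivative_transform_within_open)
    show "open {s. Re s > -1}" by (rule open_halfspace_Re_gt)
  qed (use s in \<open>auto simp: xi_def xi_half_def\<close>)
  then have "deriv xi s = (deriv zeta_W s * P + P * (- of_real (ln pi) / 2) * zeta_W s) * G + G * (Digamma (s / 2 + 1) / 2) * (zeta_W s * P)"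
    by (rule DERIV_imp_deriv)
  moreover have "xi s = zeta_W s * P * G" using s by (simp add: xi_def xi_half_def P_def G_def)
  ultimately show ?thesis using W0 PG by (simp add: field_simps)
qed

lemma deriv_xi_center: "deriv xi_center w = deriv xi (1 / 2 + w)"
proof -
  have "(xi has_field_derivative deriv xi (1 / 2 + w)) (at (1 / 2 + w))"
    by (intro holomorphic_derivI[OF xi_holomorphic[of UNIV]]) auto
  then have "((\<lambda>w. xi (1 / 2 + w)) has_field_derivative deriv xi (1 / 2 + w) * 1) (at w)"
    by (intro DERIV_chain2[of xi]) (auto intro!: derivative_eq_intros)
  then show ?thesis unfolding xi_center_def[abs_def] by (simp add: DERIV_imp_deriv)
qed

text \<open>One error for each factor of \<open>xi\<close>: the Dirichlet series, the factor s - 1,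
  and half the Digamma error at z = s / 2 + 1 with s = 1/2 + w.\<close>

lemma xi_center_log_deriv_approx:
  fixes h t :: real
  assumes h: "h \<ge> 4"
  defines "w \<equiv> of_real h + \<i> * of_real t"
  defines "z \<equiv> (5 / 4 + w / 2 :: complex)"
  shows "\<bar>Re (deriv xi_center w / xi_center w) - (ln (norm z) / 2 - ln pi / 2)\<bar> \<le> 16 * 2 powr - h + 1 / norm (w - 1 / 2) + 4 / norm z"
proof -
  define s where "s = 1 / 2 + w"
  have s: "Re s \<ge> 4" using h by (simp add: s_def w_def)
  have zs: "z = s / 2 + 1" by (simp add: z_def s_def add_divide_distrib)
  have z2: "Re z \<ge> 2" using h by (simp add: z_def w_def)
  have "Re (deriv xi_center w / xi_center w) = Re (deriv zeta_W s / zeta_W s) - ln pi / 2 + Re (Digamma z) / 2"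
    unfolding deriv_xi_center xi_center_def s_def[symmetric] xi_log_deriv[OF s] zs by simp
  moreover have "\<bar>Re (deriv zeta_W s / zeta_W s - 1 / (s - 1))\<bar> \<le> 16 * 2 powr - h"
  proof -
    have "\<bar>Re (deriv zeta_W s / zeta_W s - 1 / (s - 1))\<bar> \<le> 16 * 2 powr - Re s"
      using zeta_W_log_deriv(1)[OF s] abs_Re_le_cmod order_trans by blast
    also have "\<dots> \<le> 16 * 2 powr - h" by (intro mult_left_mono powr_mono) (auto simp: s_def w_def)
    finally show ?thesis .
  qed
  moreover have "\<bar>Re (1 / (s - 1))\<bar> \<le> 1 / norm (w - 1 / 2)"
  proof -
    have "s - 1 = w - 1 / 2" by (simp add: s_def)
    then show ?thesis using abs_Re_le_cmod[of "1 / (s - 1)"] by (simp add: norm_divide)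
  qed
  moreover have "\<bar>Re (Digamma z) - ln (norm z)\<bar> \<le> 8 / norm z" by (rule Re_Digamma_approx[OF z2])
  ultimately show ?thesis unfolding minus_complex.sel by linarith
qed

definition li_density :: "real \<Rightarrow> real \<Rightarrow> real" where
  "li_density h t = Re (deriv xi_center (of_real h + \<i> * of_real t) / xi_center (of_real h + \<i> * of_real t))"

text \<open>Here |z| is half of sqrt (t^2 + (h + 5/2)^2). Replacing h + 5/2 by a yields the
  logarithm whose integral against \<open>li_kernel\<close> is exact; the change is of order 1 / (1
  + t^2) and is absorbed in C / (1 + |t|). The constant C depends on h, the coefficient 16 does
  not.\<close>

lemma li_density_approx:
  assumes a: "a > 0" and h: "h \<ge> 4"
  obtains C where "C \<ge> 0"
    "\<And>t. \<bar>li_density h t - ((ln (t ^ 2 + a ^ 2) / 2 - ln a) / 2 + (ln a - ln (2 * pi)) / 2)\<bar> \<le> 16 * 2 powr - h + C / (1 + \<bar>t\<bar>)"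
proof -
  define c where "c = h + 5 / 2"
  have c: "c > 0" using h by (simp add: c_def)
  define m where "m = min a c"
  have m: "m > 0" "m \<le> a" "m \<le> c" using a c by (auto simp: m_def)
  \<comment> \<open>18 = 2 + 16 collects the bounds for 1 / norm (w - 1/2) and 4 / norm z; the rest
    pays for replacing c by a.\<close>
  define C where "C = \<bar>c ^ 2 - a ^ 2\<bar> * (2 * (1 / m ^ 2 + 1)) + 18"
  have C0: "C \<ge> 0" unfolding C_def by (intro add_nonneg_nonneg mult_nonneg_nonneg) auto
  have "\<bar>li_density h t - ((ln (t ^ 2 + a ^ 2) / 2 - ln a) / 2 + (ln a - ln (2 * pi)) / 2)\<bar> \<le> 16 * 2 powr - h + C / (1 + \<bar>t\<bar>)" for t
  proof -
    define w where "w = of_real h + \<i> * of_real t"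
    define z where "z = (5 / 4 + w / 2 :: complex)"
    have d: "\<bar>li_density h t - (ln (norm z) / 2 - ln pi / 2)\<bar> \<le> 16 * 2 powr - h + 1 / norm (w - 1 / 2) + 4 / norm z"
      unfolding li_density_def using xi_center_log_deriv_approx[OF h, of t] by (simp only: w_def z_def)
    have p: "t ^ 2 + a ^ 2 > 0" "t ^ 2 + c ^ 2 > 0" "t ^ 2 + m ^ 2 > 0" using a c m by (auto simp: add_nonneg_pos)
    have nz: "norm z = sqrt (t ^ 2 + c ^ 2) / 2"
    proof -
      have "norm z ^ 2 = (t ^ 2 + c ^ 2) / 4"
        unfolding cmod_power2 by (simp add: z_def w_def c_def power2_eq_square field_simps)
      then have "norm z = sqrt ((t ^ 2 + c ^ 2) / 4)" by (metis norm_ge_zero real_sqrt_unique)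
      then show ?thesis by (simp add: real_sqrt_divide)
    qed
    have lz: "ln (norm z) = ln (t ^ 2 + c ^ 2) / 2 - ln 2"
    proof -
      have "ln (sqrt x / 2) = ln x / 2 - ln 2" if "x > 0" for x :: real using that by (simp add: ln_div ln_sqrt)
      from this[OF p(2)] show ?thesis unfolding nz .
    qed
    have b1: "1 / norm (w - 1 / 2) \<le> 2 / (1 + \<bar>t\<bar>)"
    proof -
      have "\<bar>t\<bar> \<le> norm (w - 1 / 2)" using abs_Im_le_cmod[of "w - 1 / 2"] by (simp add: w_def)
      moreover have "1 \<le> norm (w - 1 / 2)" using abs_Re_le_cmod[of "w - 1 / 2"] h by (simp add: w_def)
      ultimately have "1 / norm (w - 1 / 2) \<le> 1 / ((1 + \<bar>t\<bar>) / 2)" by (intro frac_le) auto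
      then show ?thesis by simp
    qed
    have b2: "4 / norm z \<le> 16 / (1 + \<bar>t\<bar>)"
    proof -
      have "\<bar>t\<bar> / 2 \<le> norm z" using abs_Im_le_cmod[of z] by (simp add: z_def w_def)
      moreover have "2 \<le> norm z" using abs_Re_le_cmod[of z] h by (simp add: z_def w_def)
      ultimately have "4 / norm z \<le> 4 / ((1 + \<bar>t\<bar>) / 4)" by (intro frac_le) auto
      then show ?thesis by simp
    qed
    have lnd: "\<bar>ln (t ^ 2 + c ^ 2) - ln (t ^ 2 + a ^ 2)\<bar> \<le> \<bar>c ^ 2 - a ^ 2\<bar> / (t ^ 2 + m ^ 2)"
    proof -
      have q: "ln x - ln y \<le> \<bar>c ^ 2 - a ^ 2\<bar> / (t ^ 2 + m ^ 2)" if "x - y \<le> \<bar>c ^ 2 - a ^ 2\<bar>" "y \<ge> t ^ 2 + m ^ 2" "x > 0" for x y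
      proof -
        have y: "y > 0" using that p by linarith
        have "ln x - ln y = ln (x / y)" using that y by (simp add: ln_div)
        also have "\<dots> \<le> x / y - 1" using that y by (intro ln_le_minus_one) simp
        also have "\<dots> = (x - y) / y" using y by (simp add: field_simps)
        also have "\<dots> \<le> \<bar>c ^ 2 - a ^ 2\<bar> / y" using that y by (intro divide_right_mono) auto
        also have "\<dots> \<le> \<bar>c ^ 2 - a ^ 2\<bar> / (t ^ 2 + m ^ 2)" using that y p by (intro divide_left_mono) auto
        finally show ?thesis .
      qed
      have "m ^ 2 \<le> a ^ 2" "m ^ 2 \<le> c ^ 2" using m by (auto intro: power_mono)
      then show ?thesis using q[of "t ^ 2 + c ^ 2" "t ^ 2 + a ^ 2"] q[of "t ^ 2 + a ^ 2" "t ^ 2 + c ^ 2"] p by (simp add: abs_le_iff)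
    qed
    have b3: "\<bar>c ^ 2 - a ^ 2\<bar> / (t ^ 2 + m ^ 2) \<le> \<bar>c ^ 2 - a ^ 2\<bar> * (2 * (1 / m ^ 2 + 1)) / (1 + \<bar>t\<bar>)"
    proof -
      have "2 * \<bar>t\<bar> \<le> t ^ 2 + 1" using sum_squares_bound[of "\<bar>t\<bar>" 1] by simp
      moreover have "1 + u \<le> 2 * (1 + v)" if "2 * u \<le> v + 1" "0 \<le> v" for u v :: real using that by argo
      ultimately have "1 + \<bar>t\<bar> \<le> 2 * (1 + t ^ 2)" using zero_le_power2 by blast
      also have "1 + t ^ 2 \<le> (1 / m ^ 2 + 1) * (t ^ 2 + m ^ 2)" using m by (simp add: field_simps)
      finally have le: "1 + \<bar>t\<bar> \<le> 2 * (1 / m ^ 2 + 1) * (t ^ 2 + m ^ 2)" by (simp only: mult.assoc)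
      have "1 / (t ^ 2 + m ^ 2) \<le> 2 * (1 / m ^ 2 + 1) / (1 + \<bar>t\<bar>)"
        using le p by (simp add: field_simps)
      from mult_left_mono[OF this, of "\<bar>c ^ 2 - a ^ 2\<bar>"] show ?thesis by simp
    qed
    have "li_density h t - ((ln (t ^ 2 + a ^ 2) / 2 - ln a) / 2 + (ln a - ln (2 * pi)) / 2)
      = (li_density h t - (ln (norm z) / 2 - ln pi / 2)) + (ln (t ^ 2 + c ^ 2) - ln (t ^ 2 + a ^ 2)) / 4"
      unfolding lz by (simp add: ln_mult field_simps)
    also have "\<bar>\<dots>\<bar> \<le> (16 * 2 powr - h + 2 / (1 + \<bar>t\<bar>) + 16 / (1 + \<bar>t\<bar>)) + \<bar>c ^ 2 - a ^ 2\<bar> * (2 * (1 / m ^ 2 + 1)) / (1 + \<bar>t\<bar>)"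
    proof -
      have "\<bar>A + B / 4\<bar> \<le> (E + x + y) + Q" if "\<bar>A\<bar> \<le> E + x' + y'" "x' \<le> x" "y' \<le> y" "\<bar>B\<bar> \<le> q" "q \<le> Q"
        for A B E x y x' y' q Q :: real using that by linarith
      from this[OF d b1 b2 lnd b3] show ?thesis .
    qed
    also have "\<dots> = 16 * 2 powr - h + C / (1 + \<bar>t\<bar>)" by (simp add: C_def add_divide_distrib)
    finally show ?thesis .
  qed
  with C0 show ?thesis using that by blast
qed

text \<open>Needed at a width of order sqrt n, so only the logarithmic growth in h matters; 20
  exceeds the sum of the three error bounds 16, 1 and 2.\<close>

lemma li_density_0_le: "h \<ge> 4 \<Longrightarrow> li_density h 0 \<le> 20 + ln (h + 3)"
proof -
  assume h: "h \<ge> 4"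
  define w where "w = of_real h + \<i> * of_real 0"
  define z where "z = (5 / 4 + w / 2 :: complex)"
  have d: "\<bar>li_density h 0 - (ln (norm z) / 2 - ln pi / 2)\<bar> \<le> 16 * 2 powr - h + 1 / norm (w - 1 / 2) + 4 / norm z"
    unfolding li_density_def using xi_center_log_deriv_approx[OF h, of 0] by (simp only: w_def z_def)
  have nz: "norm z = 5 / 4 + h / 2"
  proof -
    have "z = of_real (5 / 4 + h / 2)" by (simp add: z_def w_def)
    then show ?thesis using h by (simp only: norm_of_real)
  qed
  have nw: "norm (w - 1 / 2) = h - 1 / 2"
  proof -
    have "w - 1 / 2 = of_real (h - 1 / 2)" by (simp add: w_def)
    then show ?thesis using h by (simp only: norm_of_real)
  qed
  have "2 powr - h \<le> 1" using powr_mono[of "- h" 0 2] h by simp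
  moreover have "1 / norm (w - 1 / 2) \<le> 1" "4 / norm z \<le> 2" unfolding nz nw using h by (simp_all add: field_simps)
  moreover have "ln (norm z) \<le> ln (h + 3)" unfolding nz using h by simp
  moreover have "ln (norm z) \<ge> 0" unfolding nz using h by simp
  moreover have "ln pi \<ge> 0" using pi_gt3 by simp
  ultimately show ?thesis using d by linarith
qed

section \<open>Zeros of xi on the critical line and their Poisson sums\<close>

locale RH =
  assumes RH: "riemann_hypothesis"
begin

definition Z :: "complex set" where "Z = {w. xi_center w = 0}"

definition zmult :: "complex \<Rightarrow> real" where "zmult w = real (nat (zorder xi_center w))"

lemma zmult_nonneg [simp]: "zmult w \<ge> 0" by (simp add: zmult_def)

lemma nontrivial_zeros_iff: "\<rho> \<in> nontrivial_zeros \<longleftrightarrow> \<rho> - 1 / 2 \<in> Z"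
proof
  assume "\<rho> \<in> nontrivial_zeros"
  then show "\<rho> - 1 / 2 \<in> Z" using zorder_zeta_eq_xi(2)[of \<rho>] by (simp add: nontrivial_zeros_def Z_def xi_center_def)
next
  assume "\<rho> - 1 / 2 \<in> Z"
  then have "xi \<rho> = 0" by (simp add: Z_def xi_center_def)
  then show "\<rho> \<in> nontrivial_zeros" using xi_eq_0_imp[of \<rho>] zorder_zeta_eq_xi(2)[of \<rho>] by (simp add: nontrivial_zeros_def)
qed

lemma Z_imaginary: "w \<in> Z \<Longrightarrow> Re w = 0"
  using RH nontrivial_zeros_iff[of "1 / 2 + w"] by (auto simp: riemann_hypothesis_def)

lemma Z_eq: "w \<in> Z \<Longrightarrow> w = \<i> * of_real (Im w)"
  using Z_imaginary by (simp add: complex_eq_iff)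

lemma Z_norm: "w \<in> Z \<Longrightarrow> norm w = \<bar>Im w\<bar>"
  using Z_imaginary by (simp add: cmod_def)

lemma xi_center_0: "xi_center 0 \<noteq> 0" using xi_at_half_nonzero by (simp add: xi_center_def)

lemma finite_Z: "finite {w \<in> Z. norm w \<le> R}"
proof -
  have "\<exists>w. xi_center w = 0" if "infinite {w \<in> Z. norm w \<le> R}"
    using that by (metis (mono_tags, lifting) Collect_empty_eq Z_def finite.emptyI mem_Collect_eq)
  then have "infinite {w \<in> Z. norm w \<le> R} \<Longrightarrow> \<not> xi_center constant_on UNIV"
    using xi_center_0 by (auto simp: constant_on_def)
  moreover have "\<not> xi_center constant_on UNIV \<Longrightarrow> finite {w \<in> cball 0 R. xi_center w = 0}"
    by (rule holomorphic_compact_finite_zeros[OF xi_center_holomorphic]) auto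
  moreover have "{w \<in> Z. norm w \<le> R} = {w \<in> cball 0 R. xi_center w = 0}" by (auto simp: Z_def)
  ultimately show ?thesis by auto
qed

lemma finite_Z_less: "finite {w \<in> Z. norm w < R}"
  by (rule finite_subset[OF _ finite_Z[of R]]) auto

lemma countable_Z: "countable Z"
proof -
  have eq: "Z = (\<Union>R::nat. {w \<in> Z. norm w \<le> real R})" using real_arch_simple by auto
  have "countable (\<Union>R::nat. {w \<in> Z. norm w \<le> real R})"
    by (rule countable_UN) (simp_all add: countable_finite finite_Z)
  then show ?thesis by (rule ssubst[OF eq, where P = countable])
qed

lemma Z_minus: "- w \<in> Z \<longleftrightarrow> w \<in> Z" by (simp add: Z_def xi_center_even)

lemma xi_center_analytic: "xi_center analytic_on A"
proof -
  have "xi_center analytic_on UNIV" using xi_center_holomorphic by (simp add: analytic_on_open)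
  then show ?thesis by (rule analytic_on_subset) simp
qed

lemma zorder_minus: "zorder xi_center (- w) = zorder xi_center w"
  using Meromorphic.zorder_uminus[OF analytic_on_imp_meromorphic_on[OF xi_center_analytic], of w]
  by (simp add: xi_center_even)

lemma zorder_nonneg: "zorder xi_center w \<ge> 0"
proof (rule zorder_ge_0)
  show "xi_center analytic_on {w}" by (rule xi_center_analytic)
  show "\<exists>\<^sub>F z in at w. xi_center z \<noteq> 0"
    using non_zero_neighbour_alt[OF xi_center_holomorphic open_UNIV connected_UNIV, of w 0] xi_center_0
    by (intro eventually_frequently) (auto elim: eventually_mono)
qed

lemma Poisson_kernel_Re:
  assumes "w \<in> Z"
  shows "Re (1 / (of_real h + \<i> * of_real t - w)) = h / (h ^ 2 + (t - Im w) ^ 2)"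
  using Z_imaginary[OF assms] by (simp add: Re_divide)

lemma Poisson_sum_tendsto:
  assumes h: "h > 0"
  shows "(\<lambda>R. \<Sum>w | w \<in> Z \<and> norm w < real R. zmult w * (h / (h ^ 2 + (t - Im w) ^ 2))) \<longlonglongrightarrow> li_density h t"
proof -
  obtain M :: "nat \<Rightarrow> real" where M: "\<And>R w. norm w \<le> real R \<Longrightarrow> norm (xi_center w) \<le> M R" "(\<lambda>R. ln (M R) / real R ^ 2) \<longlonglongrightarrow> 0"
    using xi_center_growth by blast
  have "(\<lambda>R. \<Sum>w | xi_center w = 0 \<and> norm w < real R. real (nat (zorder xi_center w)) * Re (1 / (of_real h + \<i> * of_real t - w)))
     \<longlonglongrightarrow> Re (deriv xi_center (of_real h + \<i> * of_real t) / xi_center (of_real h + \<i> * of_real t))"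
    by (rule even_entire_partial_fraction_Re[OF xi_center_holomorphic xi_center_even xi_center_0 _ M(1) M(2)])
       (use h Z_imaginary in \<open>auto simp: Z_def\<close>)
  moreover have "(\<Sum>w | xi_center w = 0 \<and> norm w < real R. real (nat (zorder xi_center w)) * Re (1 / (of_real h + \<i> * of_real t - w)))
    = (\<Sum>w | w \<in> Z \<and> norm w < real R. zmult w * (h / (h ^ 2 + (t - Im w) ^ 2)))" for R
  proof (rule sum.cong)
    show "{w. xi_center w = 0 \<and> norm w < real R} = {w. w \<in> Z \<and> norm w < real R}" by (simp add: Z_def)
    fix w assume "w \<in> {w. w \<in> Z \<and> norm w < real R}"
    then show "real (nat (zorder xi_center w)) * Re (1 / (of_real h + \<i> * of_real t - w)) = zmult w * (h / (h ^ 2 + (t - Im w) ^ 2))"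
      by (simp only: zmult_def Poisson_kernel_Re mem_Collect_eq)
  qed
  ultimately show ?thesis by (simp add: li_density_def)
qed

text \<open>For nonnegative summands the sums over growing discs define an integral over counting
  measure on Z, where the order of summation no longer matters and Fubini is available.\<close>

lemma nn_integral_Z_tendsto:
  assumes "\<And>w. w \<in> Z \<Longrightarrow> g w \<ge> 0"
  shows "(\<lambda>R. ennreal (\<Sum>w | w \<in> Z \<and> norm w < real R. g w)) \<longlonglongrightarrow> (\<integral>\<^sup>+w. ennreal (g w) \<partial>count_space Z)"
proof -
  define A where "A = (\<lambda>R::nat. {w \<in> Z. norm w < real R})"
  have U: "(\<Union>R. A R) = Z"
  proof (intro equalityI subsetI)
    fix w assume w: "w \<in> Z"
    obtain R :: nat where "norm w < real R" using reals_Archimedean2 by blast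
    then show "w \<in> (\<Union>R. A R)" using w by (auto simp: A_def)
  qed (auto simp: A_def)
  have "(\<lambda>R. \<integral>\<^sup>+w. ennreal (g w) * indicator (A R) w \<partial>count_space Z) \<longlonglongrightarrow> (\<integral>\<^sup>+w. ennreal (g w) * indicator (\<Union>R. A R) w \<partial>count_space Z)"
  proof (rule nn_integral_exhaust)
    show "incseq A" by (rule incseq_SucI) (auto simp: A_def)
  qed (auto simp: A_def)
  moreover have "(\<integral>\<^sup>+w. ennreal (g w) * indicator (A R) w \<partial>count_space Z) = ennreal (\<Sum>w | w \<in> Z \<and> norm w < real R. g w)" for R
  proof -
    have fin: "finite (A R)" unfolding A_def by (rule finite_Z_less)
    have "(\<integral>\<^sup>+w. ennreal (g w) * indicator (A R) w \<partial>count_space Z) = (\<Sum>w\<in>A R. ennreal (g w) * indicator (A R) w)"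
      by (rule nn_integral_count_space'[OF fin]) (auto simp: A_def)
    also have "\<dots> = (\<Sum>w\<in>A R. ennreal (g w))" by (rule sum.cong) auto
    also have "\<dots> = ennreal (\<Sum>w\<in>A R. g w)" using assms by (intro sum_ennreal) (auto simp: A_def)
    finally show ?thesis by (simp add: A_def)
  qed
  moreover have "(\<integral>\<^sup>+w. ennreal (g w) * indicator (\<Union>R. A R) w \<partial>count_space Z) = (\<integral>\<^sup>+w. ennreal (g w) \<partial>count_space Z)"
    unfolding U by (intro nn_integral_cong) auto
  ultimately show ?thesis by simp
qed

lemma li_density_nonneg: "h > 0 \<Longrightarrow> li_density h t \<ge> 0"
  by (rule LIMSEQ_le_const[OF Poisson_sum_tendsto]) (auto intro!: sum_nonneg exI[of _ 0])

lemma nn_integral_Poisson: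
  assumes h: "h > 0"
  shows "(\<integral>\<^sup>+w. ennreal (zmult w * (h / (h ^ 2 + (t - Im w) ^ 2))) \<partial>count_space Z) = ennreal (li_density h t)"
proof (rule LIMSEQ_unique[OF nn_integral_Z_tendsto])
  show "(\<lambda>R. ennreal (\<Sum>w | w \<in> Z \<and> norm w < real R. zmult w * (h / (h ^ 2 + (t - Im w) ^ 2)))) \<longlonglongrightarrow> ennreal (li_density h t)"
    by (intro tendsto_ennrealI Poisson_sum_tendsto h)
qed (use h in auto)

lemma continuous_li_density:
  assumes h: "h > 0"
  shows "continuous_on UNIV (li_density h)"
proof -
  have c1: "continuous_on UNIV (deriv xi_center)" "continuous_on UNIV xi_center"
    by (intro holomorphic_on_imp_continuous_on holomorphic_deriv xi_center_holomorphic open_UNIV)+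
  have nz: "xi_center (of_real h + \<i> * of_real t) \<noteq> 0" for t
    using Z_imaginary[of "of_real h + \<i> * of_real t"] h by (auto simp: Z_def)
  show ?thesis unfolding li_density_def[abs_def]
    by (intro continuous_intros continuous_on_compose2[OF c1(1)] continuous_on_compose2[OF c1(2)]) (use nz in auto)
qed

text \<open>The Poisson kernel is used twice: summed over the zeros it is the density at t,
  integrated in t it returns the harmonic extension at Im w. Countability of Z licenses the
  exchange.\<close>

lemma sum_li_kernel_eq_integral:
  assumes a: "a > 0" and h: "h > 0"
  shows "ennreal pi * (\<integral>\<^sup>+w. ennreal (zmult w * li_kernel a n h (Im w)) \<partial>count_space Z)
     = (\<integral>\<^sup>+t. ennreal (li_kernel a n 0 t * li_density h t) \<partial>lborel)"
proof -
  note [measurable] = borel_measurable_li_kernel[OF a order_refl]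
  have f0: "li_kernel a n 0 t \<ge> 0" for t using li_kernel_bounds[OF a order_refl] by blast
  have "(\<integral>\<^sup>+t. ennreal (li_kernel a n 0 t * li_density h t) \<partial>lborel)
     = (\<integral>\<^sup>+t. \<integral>\<^sup>+w. ennreal (zmult w) * ennreal (li_kernel a n 0 t * (h / (h ^ 2 + (t - Im w) ^ 2))) \<partial>count_space Z \<partial>lborel)"
  proof (intro nn_integral_cong)
    fix t
    have "ennreal (li_kernel a n 0 t * li_density h t) = ennreal (li_kernel a n 0 t) * (\<integral>\<^sup>+w. ennreal (zmult w * (h / (h ^ 2 + (t - Im w) ^ 2))) \<partial>count_space Z)"
      unfolding nn_integral_Poisson[OF h] using f0 by (rule ennreal_mult')
    also have "\<dots> = (\<integral>\<^sup>+w. ennreal (li_kernel a n 0 t) * ennreal (zmult w * (h / (h ^ 2 + (t - Im w) ^ 2))) \<partial>count_space Z)"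
      by (rule nn_integral_cmult[symmetric]) simp
    also have "\<dots> = (\<integral>\<^sup>+w. ennreal (zmult w) * ennreal (li_kernel a n 0 t * (h / (h ^ 2 + (t - Im w) ^ 2))) \<partial>count_space Z)"
      by (intro nn_integral_cong) (simp add: ennreal_mult'[symmetric] f0 mult_ac)
    finally show "ennreal (li_kernel a n 0 t * li_density h t) = (\<integral>\<^sup>+w. ennreal (zmult w) * ennreal (li_kernel a n 0 t * (h / (h ^ 2 + (t - Im w) ^ 2))) \<partial>count_space Z)" .
  qed
  also have "\<dots> = (\<integral>\<^sup>+w. \<integral>\<^sup>+t. ennreal (zmult w) * ennreal (li_kernel a n 0 t * (h / (h ^ 2 + (t - Im w) ^ 2))) \<partial>lborel \<partial>count_space Z)"
    by (rule nn_integral_count_space_nn_integral[OF countable_Z]) measurable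
  also have "\<dots> = (\<integral>\<^sup>+w. ennreal pi * ennreal (zmult w * li_kernel a n h (Im w)) \<partial>count_space Z)"
  proof (intro nn_integral_cong)
    fix w
    have "(\<integral>\<^sup>+t. ennreal (zmult w) * ennreal (li_kernel a n 0 t * (h / (h ^ 2 + (t - Im w) ^ 2))) \<partial>lborel)
      = ennreal (zmult w) * ennreal (pi * li_kernel a n h (Im w))"
      unfolding Poisson_integral_li_kernel[OF a h, symmetric] by (rule nn_integral_cmult) measurable
    also have "\<dots> = ennreal pi * ennreal (zmult w * li_kernel a n h (Im w))"
      by (simp add: ennreal_mult'[symmetric] mult_ac)
    finally show "(\<integral>\<^sup>+t. ennreal (zmult w) * ennreal (li_kernel a n 0 t * (h / (h ^ 2 + (t - Im w) ^ 2))) \<partial>lborel)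
      = ennreal pi * ennreal (zmult w * li_kernel a n h (Im w))" .
  qed
  also have "\<dots> = ennreal pi * (\<integral>\<^sup>+w. ennreal (zmult w * li_kernel a n h (Im w)) \<partial>count_space Z)"
    by (rule nn_integral_cmult) simp
  finally show ?thesis ..
qed

text \<open>The error of the density has no sign, so the argument moves to Bochner integrals. The
  product of \<open>li_kernel\<close> and the density is integrable because it differs from the
  explicit integrable M by at most e times \<open>li_kernel\<close> plus C r, where r is
  \<open>li_kernel\<close> over 1 + |t|.\<close>

lemma integral_li_kernel_density:
  assumes a: "a > 0" and n: "n > 0" and h: "h \<ge> 4"
    and C: "C \<ge> 0" "\<And>t. \<bar>li_density h t - ((ln (t ^ 2 + a ^ 2) / 2 - ln a) / 2 + (ln a - ln (2 * pi)) / 2)\<bar> \<le> e + C / (1 + \<bar>t\<bar>)"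
  obtains I where "I \<ge> 0" "(\<integral>\<^sup>+t. ennreal (li_kernel a n 0 t * li_density h t) \<partial>lborel) = ennreal I"
    "\<bar>I - pi * a * n * (harm n - 1 + ln (2 * a) - ln (2 * pi))\<bar> \<le> e * (2 * pi * a * n) + C * ((4 + 2 * pi * a) * sqrt n)"
proof -
  have h0: "h > 0" using h by simp
  note [measurable] = borel_measurable_li_kernel[OF a order_refl]
  have [measurable]: "li_density h \<in> borel_measurable borel"
    by (intro borel_measurable_continuous_onI continuous_li_density h0)
  let ?f = "li_kernel a n 0" and ?L = "\<lambda>t. ln (t ^ 2 + a ^ 2) / 2 - ln a"
  have f0: "?f t \<ge> 0" for t using li_kernel_bounds[OF a order_refl] by blast
  have L0: "?L t \<ge> 0" for t
  proof -
    have "ln a = ln (a ^ 2) / 2" using a by (simp add: ln_realpow)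
    also have "\<dots> \<le> ln (t ^ 2 + a ^ 2) / 2" using a by (intro divide_right_mono ln_mono) (auto simp: add_nonneg_pos)
    finally show ?thesis by simp
  qed
  have nt: "(\<integral>\<^sup>+t. ennreal (?f t / (1 + \<bar>t\<bar>)) \<partial>lborel) < \<infinity>"
    using nn_integral_li_kernel_over_linear[OF a n] by (rule order.strict_trans1) simp
  define r where "r = (\<lambda>t. ?f t / (1 + \<bar>t\<bar>))"
  have r0: "r t \<ge> 0" for t unfolding r_def using f0 by simp
  have ir: "integrable lborel r" unfolding r_def using nt f0 by (intro integrableI_nonneg) auto
  have Ir: "(\<integral>t. r t \<partial>lborel) \<le> (4 + 2 * pi * a) * sqrt n"
  proof -
    have "ennreal (\<integral>t. r t \<partial>lborel) = (\<integral>\<^sup>+t. ennreal (r t) \<partial>lborel)"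
      by (rule nn_integral_eq_integral[symmetric]) (use ir r0 in auto)
    also have "\<dots> \<le> ennreal ((4 + 2 * pi * a) * sqrt n)" unfolding r_def by (rule nn_integral_li_kernel_over_linear[OF a n])
    finally show ?thesis using a by (subst (asm) ennreal_le_iff) auto
  qed
  have bf: "has_bochner_integral lborel ?f (2 * pi * a * n)"
    using nn_integral_li_kernel[OF a, of n] f0 a by (intro has_bochner_integral_nn_integral) auto
  have hn: "harm n \<ge> (1::real)" 
    using member_le_sum[of 1 "{1..n}" "\<lambda>k. inverse (real k)"] n by (simp add: harm_def)
  then have hn2: "ln 2 + harm n - 1 \<ge> (0::real)" by (simp add: add_increasing)
  have bL: "has_bochner_integral lborel (\<lambda>t. ?f t * ?L t) (2 * pi * a * n * (ln 2 + harm n - 1))"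
    using nn_integral_li_kernel_ln[OF a n] f0 L0 a hn2 by (intro has_bochner_integral_nn_integral) (auto intro!: mult_nonneg_nonneg)
  define c0 where "c0 = (ln a - ln (2 * pi)) / 2"
  define M where "M = (\<lambda>t. (?f t * ?L t) / 2 + c0 * ?f t)"
  have bM: "has_bochner_integral lborel M (2 * pi * a * n * (ln 2 + harm n - 1) / 2 + c0 * (2 * pi * a * n))"
    unfolding M_def by (intro has_bochner_integral_add has_bochner_integral_divide_zero has_bochner_integral_mult_right bL bf)
  have ifi: "integrable lborel ?f" using bf by (simp add: has_bochner_integral_iff)
  have dif: "\<bar>?f t * li_density h t - M t\<bar> \<le> e * ?f t + C * r t" for t
  proof -
    have "?f t * li_density h t - M t = ?f t * (li_density h t - (?L t / 2 + c0))"
      by (simp add: M_def algebra_simps)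
    then have "\<bar>?f t * li_density h t - M t\<bar> = ?f t * \<bar>li_density h t - (?L t / 2 + c0)\<bar>"
      using f0[of t] by (simp add: abs_mult)
    also have "\<dots> \<le> ?f t * (e + C / (1 + \<bar>t\<bar>))"
      using C(2)[of t] f0[of t] unfolding c0_def by (intro mult_left_mono) auto
    finally show ?thesis by (simp add: r_def algebra_simps)
  qed
  have ib: "integrable lborel (\<lambda>t. e * ?f t + C * r t)"
    by (intro Bochner_Integration.integrable_add integrable_mult_right ir ifi)
  have id: "integrable lborel (\<lambda>t. ?f t * li_density h t - M t)"
  proof (rule Bochner_Integration.integrable_bound[OF ib])
    show "(\<lambda>t. ?f t * li_density h t - M t) \<in> borel_measurable lborel" unfolding M_def by measurable
    show "AE t in lborel. norm (?f t * li_density h t - M t) \<le> norm (e * ?f t + C * r t)"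
      using dif by (intro AE_I2) (simp add: order_trans[OF _ abs_ge_self])
  qed
  have iM: "integrable lborel M" using bM by (simp add: has_bochner_integral_iff)
  have "integrable lborel (\<lambda>t. (?f t * li_density h t - M t) + M t)" by (intro Bochner_Integration.integrable_add id iM)
  then have ifd: "integrable lborel (\<lambda>t. ?f t * li_density h t)" by simp
  have fd0: "?f t * li_density h t \<ge> 0" for t using f0 li_density_nonneg[OF h0] by simp
  define I where "I = (\<integral>t. ?f t * li_density h t \<partial>lborel)"
  have "I - (\<integral>t. M t \<partial>lborel) = (\<integral>t. ?f t * li_density h t - M t \<partial>lborel)"
    unfolding I_def by (rule Bochner_Integration.integral_diff[OF ifd iM, symmetric])
  then have "\<bar>I - (\<integral>t. M t \<partial>lborel)\<bar> \<le> (\<integral>t. \<bar>?f t * li_density h t - M t\<bar> \<partial>lborel)"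
    using integral_abs_bound[of lborel "\<lambda>t. ?f t * li_density h t - M t"] by simp
  also have "\<dots> \<le> (\<integral>t. e * ?f t + C * r t \<partial>lborel)"
    by (rule integral_mono[OF integrable_abs[OF id] ib dif])
  also have "\<dots> = e * (\<integral>t. ?f t \<partial>lborel) + C * (\<integral>t. r t \<partial>lborel)"
    using bf ir by (subst Bochner_Integration.integral_add) (auto simp: has_bochner_integral_iff)
  also have "\<dots> \<le> e * (2 * pi * a * n) + C * ((4 + 2 * pi * a) * sqrt n)"
    using bf mult_left_mono[OF Ir C(1)] by (simp add: has_bochner_integral_iff)
  also have "(\<integral>t. M t \<partial>lborel) = pi * a * n * (harm n - 1 + ln (2 * a) - ln (2 * pi))"
  proof -
    have "(\<integral>t. M t \<partial>lborel) = 2 * pi * a * n * (ln 2 + harm n - 1) / 2 + c0 * (2 * pi * a * n)"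
      using bM by (simp add: has_bochner_integral_iff)
    also have "\<dots> = pi * a * n * (harm n - 1 + ln (2 * a) - ln (2 * pi))"
      using a by (simp add: c0_def ln_mult field_simps)
    finally show ?thesis .
  qed
  finally have "\<bar>I - pi * a * n * (harm n - 1 + ln (2 * a) - ln (2 * pi))\<bar> \<le> e * (2 * pi * a * n) + C * ((4 + 2 * pi * a) * sqrt n)" .
  moreover have "(\<integral>\<^sup>+t. ennreal (?f t * li_density h t) \<partial>lborel) = ennreal I"
    unfolding I_def by (rule nn_integral_eq_integral[OF ifd]) (use fd0 in auto)
  moreover have "I \<ge> 0" unfolding I_def using fd0 by (intro integral_nonneg_AE) auto
  ultimately show ?thesis using that by blast
qed

end

subsection \<open>Summation over the zeros\<close>

context RH
begin

text \<open>Finiteness of the sum on the critical line is not known beforehand. The pointwise bound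
  \<open>li_kernel_diff_le_Poisson\<close>, summed over the zeros, is one Poisson sum of width H =
  sqrt (2 a n h) centred at 0, that is 4 H times \<open>li_density H 0\<close>. It carries
  finiteness over from h > 0 and then bounds the difference in both directions.\<close>

lemma sum_li_kernel_finite:
  assumes a: "a > 0" and n: "n > 0" and h: "h \<ge> 4"
    and C: "C \<ge> 0" "\<And>t. \<bar>li_density h t - ((ln (t ^ 2 + a ^ 2) / 2 - ln a) / 2 + (ln a - ln (2 * pi)) / 2)\<bar> \<le> e + C / (1 + \<bar>t\<bar>)"
  obtains \<kappa> where "\<kappa> \<ge> 0" "(\<integral>\<^sup>+w. ennreal (zmult w * li_kernel a n 0 (Im w)) \<partial>count_space Z) = ennreal \<kappa>"
    "\<bar>\<kappa> - a * n * (harm n - 1 + ln (2 * a) - ln (2 * pi))\<bar> \<le>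
       2 * a * e * n + C * (4 + 2 * pi * a) / pi * sqrt n + 4 * sqrt (2 * a * n * h) * li_density (sqrt (2 * a * n * h)) 0"
proof -
  have h0: "h > 0" using h by simp
  define q where "q = 2 * a * n * h"
  define H where "H = sqrt q"
  have q: "q > 0" using a n h0 by (simp add: q_def)
  have H: "H > 0" "H ^ 2 = q" using q by (simp_all add: H_def)
  obtain I where I: "I \<ge> 0" "(\<integral>\<^sup>+t. ennreal (li_kernel a n 0 t * li_density h t) \<partial>lborel) = ennreal I"
    "\<bar>I - pi * a * n * (harm n - 1 + ln (2 * a) - ln (2 * pi))\<bar> \<le> e * (2 * pi * a * n) + C * ((4 + 2 * pi * a) * sqrt n)"
    using integral_li_kernel_density[OF a n h C] by blast
  let ?S = "\<lambda>h. \<integral>\<^sup>+w. ennreal (zmult w * li_kernel a n h (Im w)) \<partial>count_space Z"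
  define E where "E = 4 * H * li_density H 0"
  have E0: "E \<ge> 0" unfolding E_def using H li_density_nonneg[of H 0] by simp
  have "ennreal pi * ?S h = ennreal I" using sum_li_kernel_eq_integral[OF a h0, of n] I(2) by simp
  then have "ennreal (1 / pi) * (ennreal pi * ?S h) = ennreal (1 / pi) * ennreal I" by simp
  then have Sh: "?S h = ennreal (I / pi)"
    using I(1) by (simp add: mult.assoc[symmetric] ennreal_mult'[symmetric])
  have EE: "(\<integral>\<^sup>+w. ennreal (zmult w * (4 * q / (q + Im w ^ 2))) \<partial>count_space Z) = ennreal E"
  proof -
    have "(\<integral>\<^sup>+w. ennreal (zmult w * (4 * q / (q + Im w ^ 2))) \<partial>count_space Z)
      = (\<integral>\<^sup>+w. ennreal (4 * H) * ennreal (zmult w * (H / (H ^ 2 + (0 - Im w) ^ 2))) \<partial>count_space Z)"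
    proof (intro nn_integral_cong)
      fix w
      have "zmult w * (4 * q / (q + Im w ^ 2)) = 4 * H * (zmult w * (H / (H ^ 2 + (0 - Im w) ^ 2)))"
        unfolding H(2)[symmetric] by (simp add: power2_eq_square mult_ac)
      then show "ennreal (zmult w * (4 * q / (q + Im w ^ 2))) = ennreal (4 * H) * ennreal (zmult w * (H / (H ^ 2 + (0 - Im w) ^ 2)))"
        using H(1) by (simp add: ennreal_mult'[symmetric])
    qed
    also have "\<dots> = ennreal (4 * H) * ennreal (li_density H 0)"
      unfolding nn_integral_Poisson[OF H(1), symmetric] by (rule nn_integral_cmult) simp
    also have "\<dots> = ennreal E" unfolding E_def using H(1) by (intro ennreal_mult'[symmetric]) auto
    finally show ?thesis .
  qed
  have pt: "ennreal (zmult w * x) \<le> ennreal (zmult w * y) + ennreal (zmult w * (4 * q / (q + Im w ^ 2)))"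
    if "\<bar>x - y\<bar> \<le> 4 * q / (q + Im w ^ 2)" "y \<ge> 0" for w x y
  proof -
    have "0 \<le> 4 * q / (q + Im w ^ 2)" using q by (intro divide_nonneg_nonneg) auto
    moreover have "zmult w * x \<le> zmult w * (y + 4 * q / (q + Im w ^ 2))"
      using that by (intro mult_left_mono) (auto simp: zmult_nonneg)
    moreover have "0 \<le> zmult w * y" using that by simp
    ultimately have "ennreal (zmult w * x) \<le> ennreal (zmult w * y + zmult w * (4 * q / (q + Im w ^ 2)))"
      by (intro ennreal_leI) (simp only: distrib_left)
    also have "\<dots> = ennreal (zmult w * y) + ennreal (zmult w * (4 * q / (q + Im w ^ 2)))"
      by (rule ennreal_plus[OF \<open>0 \<le> zmult w * y\<close> mult_nonneg_nonneg[OF zmult_nonneg \<open>0 \<le> 4 * q / (q + Im w ^ 2)\<close>]])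
    finally show ?thesis .
  qed
  have kd: "\<bar>li_kernel a n h t - li_kernel a n 0 t\<bar> \<le> 4 * q / (q + t ^ 2)" for t
    unfolding q_def by (rule li_kernel_diff_le_Poisson[OF a h0 n])
  have le1: "?S 0 \<le> ?S h + ennreal E"
  proof -
    have "?S 0 \<le> (\<integral>\<^sup>+w. ennreal (zmult w * li_kernel a n h (Im w)) + ennreal (zmult w * (4 * q / (q + Im w ^ 2))) \<partial>count_space Z)"
      by (intro nn_integral_mono pt) (use kd li_kernel_bounds[OF a] h0 in \<open>auto simp: abs_minus_commute\<close>)
    also have "\<dots> = ?S h + ennreal E" unfolding EE[symmetric] by (rule nn_integral_add) auto
    finally show ?thesis .
  qed
  have le2: "?S h \<le> ?S 0 + ennreal E"
  proof -
    have "?S h \<le> (\<integral>\<^sup>+w. ennreal (zmult w * li_kernel a n 0 (Im w)) + ennreal (zmult w * (4 * q / (q + Im w ^ 2))) \<partial>count_space Z)"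
      by (intro nn_integral_mono pt) (use kd li_kernel_bounds[OF a] in auto)
    also have "\<dots> = ?S 0 + ennreal E" unfolding EE[symmetric] by (rule nn_integral_add) auto
    finally show ?thesis .
  qed
  have "?S 0 < \<infinity>" using le1 unfolding Sh by (rule order.strict_trans1) simp
  then obtain \<kappa> where \<kappa>: "\<kappa> \<ge> 0" "?S 0 = ennreal \<kappa>" by (metis ennreal_cases infinity_ennreal_def less_irrefl)
  have "\<kappa> \<le> I / pi + E"
    using le1 I(1) E0 \<kappa>(1) unfolding Sh \<kappa>(2) by (simp flip: ennreal_plus)
  moreover have "I / pi \<le> \<kappa> + E"
    using le2 I(1) E0 \<kappa>(1) unfolding Sh \<kappa>(2) by (simp flip: ennreal_plus)
  ultimately have k1: "\<bar>\<kappa> - I / pi\<bar> \<le> E" by linarith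
  have k2: "\<bar>I / pi - a * n * (harm n - 1 + ln (2 * a) - ln (2 * pi))\<bar> \<le> 2 * a * e * n + C * (4 + 2 * pi * a) / pi * sqrt n"
  proof -
    have "I / pi - a * n * (harm n - 1 + ln (2 * a) - ln (2 * pi)) = (I - pi * a * n * (harm n - 1 + ln (2 * a) - ln (2 * pi))) / pi"
      by (simp add: diff_divide_distrib)
    then have "\<bar>I / pi - a * n * (harm n - 1 + ln (2 * a) - ln (2 * pi))\<bar> = \<bar>I - pi * a * n * (harm n - 1 + ln (2 * a) - ln (2 * pi))\<bar> / pi"
      by (simp add: abs_divide)
    also have "\<dots> \<le> (e * (2 * pi * a * n) + C * ((4 + 2 * pi * a) * sqrt n)) / pi"
      using I(3) by (intro divide_right_mono) auto
    also have "\<dots> = 2 * a * e * n + C * (4 + 2 * pi * a) / pi * sqrt n"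
      by (simp add: add_divide_distrib mult_ac)
    finally show ?thesis .
  qed
  have "\<bar>\<kappa> - a * n * (harm n - 1 + ln (2 * a) - ln (2 * pi))\<bar> \<le>
       2 * a * e * n + C * (4 + 2 * pi * a) / pi * sqrt n + E" using k1 k2 by linarith
  with \<kappa> show ?thesis using that unfolding E_def H_def q_def by blast
qed

section \<open>The truncated sums over zeros and the asymptotic formula\<close>

lemma cnj_cayley_imaginary: "cnj (cayley a (\<i> * of_real t)) = cayley a (- (\<i> * of_real t))"
  by (simp add: cayley_def)

lemma cayley_minus: "(w - of_real a) / (w + of_real a) = cayley a (- w)"
proof -
  have "cayley a (- w) = (- (w - of_real a)) / (- (w + of_real a))" by (simp add: cayley_def)
  then show ?thesis by (simp only: minus_divide_divide)
qed

text \<open>For b < -1/2 the fraction is \<open>cayley a (- w)\<close> instead of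
  \<open>cayley a w\<close>. On the imaginary axis w and - w give conjugate values, and they are
  zeros of equal order, so averaging over the pair yields the same real sum for either sign of b +
  1/2.\<close>

lemma k_partial_eq:
  assumes "b \<noteq> - 1 / 2"
  defines "a \<equiv> \<bar>2 * b + 1\<bar> / 2"
  shows "k_partial n b T = of_real (\<Sum>w | w \<in> Z \<and> \<bar>Im w\<bar> \<le> T. zmult w * li_kernel a n 0 (Im w))"
proof -
  define A where "A = {w. w \<in> Z \<and> \<bar>Im w\<bar> \<le> T}"
  define \<sigma> where "\<sigma> = (if b > - 1 / 2 then 1 else - 1 :: complex)"
  have \<sigma>: "\<sigma> = 1 \<or> \<sigma> = - 1" by (simp add: \<sigma>_def)
  have fr: "(1 / 2 + w + of_real b) / (1 / 2 + w - 1 - of_real b) = cayley a (\<sigma> * w)" for w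
  proof (cases "b > - 1 / 2")
    case True
    then have "a = b + 1 / 2" by (simp add: a_def field_simps)
    then show ?thesis using True by (simp add: \<sigma>_def cayley_def algebra_simps)
  next
    case False
    then have ab: "a = - (b + 1 / 2)" by (simp add: a_def field_simps)
    have e: "1 / 2 + w + of_real b = w - of_real a" "1 / 2 + w - 1 - of_real b = w + of_real a"
      by (simp_all add: ab algebra_simps)
    show ?thesis unfolding e cayley_minus using False by (simp add: \<sigma>_def)
  qed
  have zo: "of_int (zorder zeta (1 / 2 + w)) = complex_of_real (zmult w)" if "w \<in> Z" for w
  proof -
    have x0: "xi (1 / 2 + w) = 0" using that by (simp add: Z_def xi_center_def)
    have "zorder zeta (1 / 2 + w) = zorder xi (1 / 2 + w)"
      by (rule zorder_zeta_eq_xi(1)[OF xi_eq_0_imp[OF x0]])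
    also have "\<dots> = zorder (\<lambda>u. xi (u + (1 / 2 + w))) 0" by (rule zorder_shift)
    also have "\<dots> = zorder (\<lambda>u. xi_center (u + w)) 0" by (simp add: xi_center_def add_ac)
    also have "\<dots> = zorder xi_center w" by (rule zorder_shift[symmetric])
    finally show ?thesis using zorder_nonneg[of w] by (simp add: zmult_def)
  qed
  define g where "g = (\<lambda>w. complex_of_real (zmult w) * (1 - cayley a (\<sigma> * w) ^ n))"
  have bij: "bij_betw (\<lambda>w. 1 / 2 + w) A {\<rho>. \<rho> \<in> nontrivial_zeros \<and> \<bar>Im \<rho>\<bar> \<le> T}"
  proof (rule bij_betwI[where g = "\<lambda>\<rho>. \<rho> - 1 / 2"])
    show "(\<lambda>w. 1 / 2 + w) \<in> A \<rightarrow> {\<rho>. \<rho> \<in> nontrivial_zeros \<and> \<bar>Im \<rho>\<bar> \<le> T}"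
      using nontrivial_zeros_iff by (auto simp: A_def)
    show "(\<lambda>\<rho>. \<rho> - 1 / 2) \<in> {\<rho>. \<rho> \<in> nontrivial_zeros \<and> \<bar>Im \<rho>\<bar> \<le> T} \<rightarrow> A"
      using nontrivial_zeros_iff by (auto simp: A_def)
  qed auto
  have k1: "k_partial n b T = (\<Sum>w\<in>A. g w)"
    unfolding k_partial_def sum.reindex_bij_betw[OF bij, symmetric]
  proof (rule sum.cong)
    fix w assume "w \<in> A"
    then have "w \<in> Z" by (simp add: A_def)
    then show "of_int (zorder zeta (1 / 2 + w)) * (1 - ((1 / 2 + w + of_real b) / (1 / 2 + w - 1 - of_real b)) ^ n) = g w"
      by (simp only: zo fr g_def)
  qed simp
  have bij2: "bij_betw uminus A A"
    by (rule bij_betwI[where g = uminus]) (auto simp: A_def Z_minus)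
  have zm: "zmult (- w) = zmult w" for w by (simp add: zmult_def zorder_minus)
  have "(\<Sum>w\<in>A. g w) = (\<Sum>w\<in>A. g (- w))" by (rule sum.reindex_bij_betw[OF bij2, symmetric])
  then have "2 * k_partial n b T = (\<Sum>w\<in>A. g w + g (- w))" unfolding k1 by (simp add: sum.distrib)
  also have "\<dots> = (\<Sum>w\<in>A. 2 * of_real (zmult w * li_kernel a n 0 (Im w)))"
  proof (rule sum.cong)
    fix w assume "w \<in> A"
    then have w: "w = \<i> * of_real (Im w)" using Z_eq by (simp add: A_def)
    define c where "c = cayley a (\<i> * of_real (Im w)) ^ n"
    have cc: "cayley a (- (\<i> * of_real (Im w))) ^ n = cnj c"
      unfolding c_def complex_cnj_power cnj_cayley_imaginary ..
    \<comment> \<open>Either value of the sign merely orders the two conjugate summands.\<close>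
    have "cayley a (\<sigma> * w) ^ n + cayley a (\<sigma> * - w) ^ n = c + cnj c"
      using \<sigma> by (elim disjE; subst (1 2) w) (simp_all add: cc c_def[symmetric] add.commute)
    also have "\<dots> = 2 * of_real (Re c)" by (simp add: complex_add_cnj)
    finally have s: "cayley a (\<sigma> * w) ^ n + cayley a (\<sigma> * - w) ^ n = 2 * of_real (Re c)" .
    have "g w + g (- w) = of_real (zmult w) * (2 - (cayley a (\<sigma> * w) ^ n + cayley a (\<sigma> * - w) ^ n))"
      unfolding g_def zm by (simp add: algebra_simps)
    also have "\<dots> = 2 * of_real (zmult w * li_kernel a n 0 (Im w))"
      unfolding s by (simp add: li_kernel_def c_def algebra_simps)
    finally show "g w + g (- w) = 2 * of_real (zmult w * li_kernel a n 0 (Im w))" .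
  qed simp
  finally have "2 * k_partial n b T = 2 * of_real (\<Sum>w\<in>A. zmult w * li_kernel a n 0 (Im w))"
    by (simp only: of_real_sum sum_distrib_left)
  then have "k_partial n b T = of_real (\<Sum>w\<in>A. zmult w * li_kernel a n 0 (Im w))"
    by (simp only: mult_cancel_left) simp
  then show ?thesis unfolding A_def .
qed

text \<open>Nonnegative terms make the truncated sum monotone in T, so integer T = R suffice; there
  it lies between the sums over |w| < R and |w| < R + 1, because |w| = |Im w| for every
  zero.\<close>

lemma k_partial_tendsto:
  assumes b: "b \<noteq> - 1 / 2"
  defines "a \<equiv> \<bar>2 * b + 1\<bar> / 2"
  assumes \<kappa>: "\<kappa> \<ge> 0" "(\<integral>\<^sup>+w. ennreal (zmult w * li_kernel a n 0 (Im w)) \<partial>count_space Z) = ennreal \<kappa>"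
  shows "(k_partial n b \<longlongrightarrow> of_real \<kappa>) at_top"
proof -
  have a: "a > 0" using b by (simp add: a_def)
  define g where "g = (\<lambda>w. zmult w * li_kernel a n 0 (Im w))"
  have g0: "g w \<ge> 0" for w unfolding g_def using li_kernel_bounds[OF a] by simp
  define S where "S = (\<lambda>T. \<Sum>w | w \<in> Z \<and> \<bar>Im w\<bar> \<le> T. g w)"
  have fin: "finite {w. w \<in> Z \<and> \<bar>Im w\<bar> \<le> T}" for T
  proof -
    have "{w. w \<in> Z \<and> \<bar>Im w\<bar> \<le> T} = {w \<in> Z. norm w \<le> T}" using Z_norm by auto
    then show ?thesis using finite_Z by simp
  qed
  have mono: "mono S" unfolding S_def by (intro monoI sum_mono2 fin g0) auto
  have le: "{w. w \<in> Z \<and> \<bar>Im w\<bar> \<le> real R} \<subseteq> {w. w \<in> Z \<and> norm w < real (Suc R)}" for R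
    using Z_norm by auto
  have lim: "(\<lambda>R. \<Sum>w | w \<in> Z \<and> norm w < real R. g w) \<longlonglongrightarrow> \<kappa>"
  proof -
    have "(\<lambda>R. ennreal (\<Sum>w | w \<in> Z \<and> norm w < real R. g w)) \<longlonglongrightarrow> ennreal \<kappa>"
      using nn_integral_Z_tendsto[of g] g0 \<kappa>(2) by (simp add: g_def)
    then show ?thesis using \<kappa>(1) g0 by (subst (asm) tendsto_ennreal_iff) (simp_all add: sum_nonneg)
  qed
  have "(\<lambda>R. S (real R)) \<longlonglongrightarrow> \<kappa>"
  proof (rule tendsto_sandwich[OF _ _ lim LIMSEQ_Suc[OF lim]])
    show "\<forall>\<^sub>F R in sequentially. (\<Sum>w | w \<in> Z \<and> norm w < real R. g w) \<le> S (real R)"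
      unfolding S_def by (intro always_eventually allI sum_mono2 fin g0) (auto simp: Z_norm)
    show "\<forall>\<^sub>F R in sequentially. S (real R) \<le> (\<Sum>w | w \<in> Z \<and> norm w < real (Suc R). g w)"
      unfolding S_def by (intro always_eventually allI sum_mono2 g0 le finite_Z_less)
  qed
  then have "(S \<longlongrightarrow> \<kappa>) at_top" by (rule tendsto_at_topI_sequentially_real[OF mono])
  then have "((\<lambda>T. complex_of_real (S T)) \<longlongrightarrow> of_real \<kappa>) at_top" by (rule tendsto_of_real)
  moreover have "k_partial n b = (\<lambda>T. of_real (S T))"
    unfolding S_def g_def a_def using k_partial_eq[OF b, of n] by auto
  ultimately show ?thesis by simp
qed

text \<open>The order of choices matters: h is fixed from the target c, which makes the linear error
  small, and only then n grows, with C depending on h. Euler's constant enters through harm n = ln n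
  + gamma + o(1). Convergence for every n >= 1 already follows with h = 4.\<close>

theorem k_coeff_asymptotics:
  assumes b: "b \<noteq> - 1 / 2"
  defines "a \<equiv> \<bar>2 * b + 1\<bar> / 2"
  defines "main \<equiv> \<lambda>n. a * real n * ln (real n) + a * (euler_mascheroni - 1 - ln (2 * pi / \<bar>2 * b + 1\<bar>)) * real n"
  shows "(\<forall>n\<ge>1. (k_partial n b \<longlongrightarrow> k_coeff n b) at_top \<and> k_coeff n b \<in> \<real>) \<and>
    (\<lambda>n. k_coeff n b - of_real (main n)) \<in> o(\<lambda>n. of_nat n)"
proof -
  have a: "a > 0" using b by (simp add: a_def)
  have ab: "\<bar>2 * b + 1\<bar> = 2 * a" by (simp add: a_def)
  have nt: "\<not> trivial_limit (at_top :: real filter)" by simp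
  have ex: "\<exists>\<kappa>. (k_partial n b \<longlongrightarrow> of_real \<kappa>) at_top \<and> k_coeff n b = of_real \<kappa> \<and>
      \<bar>\<kappa> - a * n * (harm n - 1 + ln (2 * a) - ln (2 * pi))\<bar> \<le>
       2 * a * e * n + C * (4 + 2 * pi * a) / pi * sqrt n + 4 * sqrt (2 * a * n * h) * li_density (sqrt (2 * a * n * h)) 0"
    if n: "n > 0" and h: "h \<ge> 4" and C: "C \<ge> 0" "\<And>t. \<bar>li_density h t - ((ln (t ^ 2 + a ^ 2) / 2 - ln a) / 2 + (ln a - ln (2 * pi)) / 2)\<bar> \<le> e + C / (1 + \<bar>t\<bar>)"
    for n h C e
  proof -
    obtain \<kappa> where \<kappa>: "\<kappa> \<ge> 0" "(\<integral>\<^sup>+w. ennreal (zmult w * li_kernel a n 0 (Im w)) \<partial>count_space Z) = ennreal \<kappa>"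
      "\<bar>\<kappa> - a * n * (harm n - 1 + ln (2 * a) - ln (2 * pi))\<bar> \<le>
       2 * a * e * n + C * (4 + 2 * pi * a) / pi * sqrt n + 4 * sqrt (2 * a * n * h) * li_density (sqrt (2 * a * n * h)) 0"
      using sum_li_kernel_finite[OF a n h C] by blast
    have "(k_partial n b \<longlongrightarrow> of_real \<kappa>) at_top"
      using k_partial_tendsto[OF b \<kappa>(1)] \<kappa>(2) unfolding a_def by blast
    then show ?thesis using \<kappa>(3) tendsto_Lim[OF nt] unfolding k_coeff_def by blast
  qed
  have conv: "(k_partial n b \<longlongrightarrow> k_coeff n b) at_top \<and> k_coeff n b \<in> \<real>" if "n \<ge> 1" for n
  proof -
    obtain C where C: "C \<ge> 0" "\<And>t. \<bar>li_density 4 t - ((ln (t ^ 2 + a ^ 2) / 2 - ln a) / 2 + (ln a - ln (2 * pi)) / 2)\<bar> \<le> 16 * 2 powr - 4 + C / (1 + \<bar>t\<bar>)"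
      using li_density_approx[OF a order_refl] by blast
    show ?thesis using ex[OF _ order_refl C, of n] that by auto
  qed
  have "(\<lambda>n. k_coeff n b - of_real (main n)) \<in> o(\<lambda>n. of_nat n)"
  proof (rule landau_o.smallI)
    fix c :: real assume c: "c > 0"
    have "((\<lambda>h. 32 * a * 2 powr - h) \<longlongrightarrow> 0) at_top" by real_asymp
    \<comment> \<open>32 a 2^(-h) is the coefficient of n in the error bound, 2 a e with e = 16 *
      2^(-h); it receives one half of c.\<close>
    then have "\<forall>\<^sub>F h in at_top. 32 * a * 2 powr - h < c / 2" using c by (intro order_tendstoD) auto
    then have "\<forall>\<^sub>F h in at_top. 32 * a * 2 powr - h < c / 2 \<and> h \<ge> 4"
      using eventually_ge_at_top by (rule eventually_conj)
    then obtain h where h: "32 * a * 2 powr - h < c / 2" "h \<ge> 4" by (auto simp: eventually_at_top_linorder)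
    obtain C where C: "C \<ge> 0" "\<And>t. \<bar>li_density h t - ((ln (t ^ 2 + a ^ 2) / 2 - ln a) / 2 + (ln a - ln (2 * pi)) / 2)\<bar> \<le> 16 * 2 powr - h + C / (1 + \<bar>t\<bar>)"
      using li_density_approx[OF a h(2)] by blast
    define B where "B = C * (4 + 2 * pi * a) / pi"
    \<comment> \<open>All remaining errors divided by n; for fixed h they are of order ln n / sqrt
      n, except the harmonic one, which tends to 0.\<close>
    define r where "r = (\<lambda>n. a * \<bar>harm n - ln (real n) - euler_mascheroni\<bar> + B * (sqrt n / n)
       + 4 * sqrt (2 * a * n * h) * (20 + ln (sqrt (2 * a * n * h) + 3)) / n)"
    have "(\<lambda>n. harm n - ln (real n) - euler_mascheroni :: real) \<longlonglongrightarrow> euler_mascheroni - euler_mascheroni"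
      by (intro tendsto_diff euler_mascheroni_LIMSEQ tendsto_const)
    then have "(\<lambda>n. \<bar>harm n - ln (real n) - euler_mascheroni :: real\<bar>) \<longlonglongrightarrow> 0" by (simp add: tendsto_rabs_zero)
    moreover have "(\<lambda>n. sqrt (real n) / real n) \<longlonglongrightarrow> 0" by real_asymp
    moreover have "(\<lambda>n. 4 * sqrt (2 * a * real n * h) * (20 + ln (sqrt (2 * a * real n * h) + 3)) / real n) \<longlonglongrightarrow> 0"
    proof -
      have "h > 0" using h by simp
      with a show ?thesis by real_asymp
    qed
    ultimately have "r \<longlonglongrightarrow> a * 0 + B * 0 + 0" unfolding r_def by (intro tendsto_add tendsto_mult_left)
    then have "r \<longlonglongrightarrow> 0" by simp
    then have ev1: "\<forall>\<^sub>F n in sequentially. r n < c / 2" using c by (intro order_tendstoD) auto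
    have "filterlim (\<lambda>n. sqrt (2 * a * real n * h)) at_top sequentially"
    proof -
      have "h > 0" using h by simp
      with a show ?thesis by real_asymp
    qed
    \<comment> \<open>The density bound at 0 requires a width of at least 4.\<close>
    then have ev2: "\<forall>\<^sub>F n in sequentially. sqrt (2 * a * real n * h) \<ge> 4" by (simp add: filterlim_at_top)
    show "\<forall>\<^sub>F n in sequentially. norm (k_coeff n b - of_real (main n)) \<le> c * norm (of_nat n :: complex)"
      using ev1 ev2 eventually_gt_at_top[of 0]
    proof eventually_elim
      case (elim n)
      obtain \<kappa> where \<kappa>: "k_coeff n b = of_real \<kappa>" "\<bar>\<kappa> - a * n * (harm n - 1 + ln (2 * a) - ln (2 * pi))\<bar> \<le>
         2 * a * (16 * 2 powr - h) * n + B * sqrt n + 4 * sqrt (2 * a * n * h) * li_density (sqrt (2 * a * n * h)) 0"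
        using ex[OF elim(3) h(2) C] unfolding B_def by blast
      have D: "4 * sqrt (2 * a * n * h) * li_density (sqrt (2 * a * n * h)) 0 \<le> 4 * sqrt (2 * a * n * h) * (20 + ln (sqrt (2 * a * n * h) + 3))"
      proof (rule mult_left_mono)
        show "0 \<le> 4 * sqrt (2 * a * n * h)" using elim(2) by linarith
      qed (rule li_density_0_le[OF elim(2)])
      \<comment> \<open>As |2 b + 1| = 2 a, the term - ln (2 pi / |2 b + 1|) is ln (2 a) - ln (2
        pi).\<close>
      have mn: "main n = a * n * (harm n - 1 + ln (2 * a) - ln (2 * pi)) - a * n * (harm n - ln n - euler_mascheroni)"
        unfolding main_def ab using a by (simp add: ln_div ln_mult_pos algebra_simps)
      have "\<bar>\<kappa> - main n\<bar> \<le> \<bar>\<kappa> - a * n * (harm n - 1 + ln (2 * a) - ln (2 * pi))\<bar> + \<bar>a * n * (harm n - ln n - euler_mascheroni)\<bar>"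
        unfolding mn by linarith
      also have "\<bar>a * n * (harm n - ln n - euler_mascheroni)\<bar> = a * \<bar>harm n - ln n - euler_mascheroni\<bar> * n"
        using a by (simp add: abs_mult)
      finally have "\<bar>\<kappa> - main n\<bar> \<le> (32 * a * 2 powr - h) * n + B * sqrt n + 4 * sqrt (2 * a * n * h) * (20 + ln (sqrt (2 * a * n * h) + 3)) + a * \<bar>harm n - ln n - euler_mascheroni\<bar> * n"
        using \<kappa>(2) D by simp
      also have "\<dots> = (32 * a * 2 powr - h + r n) * n"
        using elim(3) by (simp add: r_def field_simps)
      also have "\<dots> \<le> c * n" using h(1) elim(1) by (intro mult_right_mono) auto
      finally show ?case unfolding \<kappa>(1) of_real_diff[symmetric] norm_of_real by simp
    qed
  qed
  with conv show ?thesis by blast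
qed

end

theorem theorem4:
  fixes b :: real
  assumes RH: "riemann_hypothesis"
    and b: "b \<noteq> - 1 / 2"
  shows "(\<forall>n\<ge>1. (k_partial n b \<longlongrightarrow> k_coeff n b) at_top \<and> k_coeff n b \<in> \<real>) \<and>
    (\<lambda>n. k_coeff n b - of_real
        (\<bar>2 * b + 1\<bar> / 2 * real n * ln (real n) +
         \<bar>2 * b + 1\<bar> / 2 * (euler_mascheroni - 1 - ln (2 * pi / \<bar>2 * b + 1\<bar>)) * real n))
      \<in> o(\<lambda>n. of_nat n)"
proof -
  interpret RH using RH by unfold_locales
  show ?thesis by (rule k_coeff_asymptotics[OF b])
qed

end
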